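(* Let $k$ be a CM-field and $p$ an odd prime number that splits completely in $k$. Let $k^{\mathrm{an}}_\infty/k$ be an anti-cyclotomic $\mathbb{Z}_p$-extension, put $K=k^{\mathrm{cy}}_\infty k^{\mathrm{an}}_\infty$, and let $X$ be a $\mathbb{Z}_p[[\mathrm{Gal}(K/k)]]$-module that is cyclic as a $\mathbb{Z}_p[[\mathrm{Gal}(K/k^{\mathrm{cy}}_\infty)]]$-module. Let $k_\infty/k$ be a $\mathbb{Z}_p$-extension with $k_\infty\subseteq K$ and $k_\infty\cap k^{\mathrm{an}}_\infty=k$, and let $k'_\infty$ be the complex conjugate of $k_\infty$. Then at least one of the following holds: (1) $\operatorname{rank}_p X_{\mathrm{Gal}(K/k_\infty)}\leq 1$; (2) $\operatorname{rank}_p X_{\mathrm{Gal}(K/k'_\infty)}\leq 1$.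
   Context: $k^{\mathrm{cy}}_\infty/k$ is the cyclotomic $\mathbb{Z}_p$-extension. $\widetilde{k}$ is the composite of all $\mathbb{Z}_p$-extensions of $k$; complex conjugation $J$ acts on $\Gamma=\mathrm{Gal}(\widetilde{k}/k)$, $\Gamma^+=\frac{1+J}{2}\Gamma$, $\widetilde{k}^{\mathrm{an}}=\widetilde{k}^{\Gamma^+}$, and a $\mathbb{Z}_p$-extension of $k$ is called anti-cyclotomic if it is contained in $\widetilde{k}^{\mathrm{an}}$. For a profinite group $G$ and a profinite $G$-module $M$, $M_G$ denotes the maximal $G$-coinvariant quotient. For a $\mathbb{Z}_p$-module $M$, $\operatorname{rank}_p M=\dim_{\mathbb{F}_p}(\mathbb{F}_p\otimes_{\mathbb{Z}_p}M)$. *)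

theory Defs
  imports
    "HOL-Analysis.Analysis"
    "HOL-Algebra.Algebra"
    "HOL-Algebra.Algebraic_Closure_Type"
    "HOL-Number_Theory.Residues"
begin

section \<open>Number fields inside the complex numbers\<close>

text \<open>
  All fields are subfields of \<open>\<complex>\<close>.  For a CM-field \<open>k \<subseteq> \<complex>\<close> complex conjugation on \<open>k\<close>, and on
  extensions of \<open>k\<close> that are Galois over the maximal real subfield, is induced by \<^const>\<open>cnj\<close>.
\<close>

abbreviation CC :: "complex ring" where
  "CC \<equiv> ring_of_type_algebra"

abbreviation sub_ring :: "complex set \<Rightarrow> complex ring" where
  "sub_ring L \<equiv> CC\<lparr>carrier := L\<rparr>"

definition compositum :: "complex set \<Rightarrow> complex set \<Rightarrow> complex set" where
  "compositum K L = generate_field CC (K \<union> L)"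

definition number_field :: "complex set \<Rightarrow> bool" where
  "number_field k \<longleftrightarrow> subfield k CC \<and> ring.finite_dimension CC \<rat> k"

definition totally_real :: "complex set \<Rightarrow> bool" where
  "totally_real k \<longleftrightarrow> (\<forall>\<sigma> \<in> ring_hom (sub_ring k) CC. \<sigma> ` k \<subseteq> \<real>)"

definition totally_imaginary :: "complex set \<Rightarrow> bool" where
  "totally_imaginary k \<longleftrightarrow> (\<forall>\<sigma> \<in> ring_hom (sub_ring k) CC. \<not> \<sigma> ` k \<subseteq> \<real>)"

definition CM_field :: "complex set \<Rightarrow> bool" where
  "CM_field k \<longleftrightarrow> number_field k \<and> totally_imaginary k \<and>
     (\<exists>F. F \<subseteq> k \<and> number_field F \<and> totally_real F \<and> ring.dimension CC 2 F k)"

definition ring_of_integers :: "complex set \<Rightarrow> complex ring" where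
  "ring_of_integers k = sub_ring {x \<in> k. algebraic_int x}"

text \<open>\<open>p\<close> splits completely in \<open>k\<close> if it lies below exactly \<open>[k : \<rat>]\<close> primes of \<open>k\<close>.\<close>

definition splits_completely :: "nat \<Rightarrow> complex set \<Rightarrow> bool" where
  "splits_completely p k \<longleftrightarrow>
     ring.dimension CC (card {P. primeideal P (ring_of_integers k) \<and> of_nat p \<in> P}) \<rat> k"


section \<open>Galois groups with the Krull topology\<close>

text \<open>
  Elements of \<open>Gal L k\<close> are taken to be undefined outside \<open>L\<close>, so that they are determined by
  their values on \<open>L\<close>; for \<open>k \<subseteq> F \<subseteq> L\<close> the set \<open>carrier (Gal L F)\<close> is then a subset of
  \<open>carrier (Gal L k)\<close>.
\<close>

definition Gal :: "complex set \<Rightarrow> complex set \<Rightarrow> (complex \<Rightarrow> complex) monoid" where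
  "Gal L k =
    \<lparr>carrier = {\<sigma> \<in> ring_iso (sub_ring L) (sub_ring L) \<inter> extensional L. \<forall>x\<in>k. \<sigma> x = x},
     monoid.mult = compose L,
     one = (\<lambda>x\<in>L. x)\<rparr>"

text \<open>
  The Krull topology on the Galois group of an algebraic extension is the topology of pointwise
  convergence for the discrete topology on \<open>L\<close>.
\<close>

definition krull_topology :: "complex set \<Rightarrow> complex set \<Rightarrow> (complex \<Rightarrow> complex) topology" where
  "krull_topology L k =
     subtopology (product_topology (\<lambda>_. discrete_topology L) L) (carrier (Gal L k))"

definition galois_extension :: "complex set \<Rightarrow> complex set \<Rightarrow> bool" where
  "galois_extension k L \<longleftrightarrow>
     subfield k CC \<and> subfield L CC \<and> k \<subseteq> L \<and>
     (\<forall>x\<in>L. ring.algebraic CC k x) \<and>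
     {x \<in> L. \<forall>\<sigma>\<in>carrier (Gal L k). \<sigma> x = x} = k"


section \<open>The \<open>p\<close>-adic integers and \<open>\<int>\<^sub>p\<close>-extensions\<close>

text \<open>
  \<open>\<int>\<^sub>p\<close> is the inverse limit of the rings \<open>\<int>/p\<^sup>n\<close>, whose elements are represented by
  their least nonnegative residues.
\<close>

definition Zp :: "nat \<Rightarrow> (nat \<Rightarrow> int) ring" where
  "Zp p =
    \<lparr>carrier = {x. \<forall>n. 0 \<le> x n \<and> x n < int p ^ n \<and> x (Suc n) mod int p ^ n = x n},
     monoid.mult = (\<lambda>x y n. (x n * y n) mod int p ^ n),
     one = (\<lambda>n. 1 mod int p ^ n),
     ring.zero = (\<lambda>n. 0),
     add = (\<lambda>x y n. (x n + y n) mod int p ^ n)\<rparr>"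

definition Zp_topology :: "nat \<Rightarrow> (nat \<Rightarrow> int) topology" where
  "Zp_topology p =
     subtopology (product_topology (\<lambda>_. discrete_topology UNIV) UNIV) (carrier (Zp p))"

definition Zp_extension :: "nat \<Rightarrow> complex set \<Rightarrow> complex set \<Rightarrow> bool" where
  "Zp_extension p k L \<longleftrightarrow> galois_extension k L \<and>
     (\<exists>\<phi> \<in> iso (Gal L k) (add_monoid (Zp p)).
        homeomorphic_map (krull_topology L k) (Zp_topology p) \<phi>)"

text \<open>
  The cyclotomic \<open>\<int>\<^sub>p\<close>-extension of \<open>k\<close> is \<open>k\<rat>\<^sub>\<infinity>\<close>, where \<open>\<rat>\<^sub>\<infinity>\<close> is the unique
  \<open>\<int>\<^sub>p\<close>-extension of \<open>\<rat>\<close> inside the field generated by all roots of unity of \<open>p\<close>-power order.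
\<close>

definition cyclotomic_Zp_extension :: "nat \<Rightarrow> complex set \<Rightarrow> complex set \<Rightarrow> bool" where
  "cyclotomic_Zp_extension p k L \<longleftrightarrow>
     (\<exists>Q. Zp_extension p \<rat> Q \<and> Q \<subseteq> generate_field CC {\<zeta>. \<exists>n. \<zeta> ^ (p ^ n) = 1} \<and>
          L = compositum k Q)"

definition composite_Zp_extensions :: "nat \<Rightarrow> complex set \<Rightarrow> complex set" where
  "composite_Zp_extensions p k = generate_field CC (k \<union> \<Union> {L. Zp_extension p k L})"

definition conj_aut :: "complex set \<Rightarrow> (complex \<Rightarrow> complex) \<Rightarrow> complex \<Rightarrow> complex" where
  "conj_aut L \<sigma> = (\<lambda>x\<in>L. cnj (\<sigma> (cnj x)))"

text \<open>
  \<open>\<Gamma>\<close> is written multiplicatively, and it is uniquely 2-divisible for odd \<open>p\<close>: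
  \<open>\<sigma> = \<tau>\<^bsup>(1+J)/2\<^esup>\<close> means \<open>\<sigma>\<^sup>2 = \<tau> \<cdot> J\<tau>\<close>.
\<close>

definition Gamma_plus :: "nat \<Rightarrow> complex set \<Rightarrow> (complex \<Rightarrow> complex) set" where
  "Gamma_plus p k =
    (let L = composite_Zp_extensions p k; \<Gamma> = Gal L k
     in {\<sigma> \<in> carrier \<Gamma>. \<exists>\<tau>\<in>carrier \<Gamma>. \<sigma> \<otimes>\<^bsub>\<Gamma>\<^esub> \<sigma> = \<tau> \<otimes>\<^bsub>\<Gamma>\<^esub> conj_aut L \<tau>})"

definition anticyclotomic_composite :: "nat \<Rightarrow> complex set \<Rightarrow> complex set" where
  "anticyclotomic_composite p k =
     {x \<in> composite_Zp_extensions p k. \<forall>\<sigma>\<in>Gamma_plus p k. \<sigma> x = x}"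

definition anticyclotomic_Zp_extension :: "nat \<Rightarrow> complex set \<Rightarrow> complex set \<Rightarrow> bool" where
  "anticyclotomic_Zp_extension p k L \<longleftrightarrow>
     Zp_extension p k L \<and> L \<subseteq> anticyclotomic_composite p k"


section \<open>Completed group rings\<close>

text \<open>Only used for finite \<open>H\<close>, so that every function on \<open>H\<close> is an element.\<close>

definition group_ring :: "'r ring \<Rightarrow> 'h monoid \<Rightarrow> ('h \<Rightarrow> 'r) ring" where
  "group_ring R H =
    \<lparr>carrier = carrier H \<rightarrow>\<^sub>E carrier R,
     monoid.mult = (\<lambda>f g. \<lambda>c\<in>carrier H. \<Oplus>\<^bsub>R\<^esub>a\<in>carrier H. f a \<otimes>\<^bsub>R\<^esub> g (inv\<^bsub>H\<^esub> a \<otimes>\<^bsub>H\<^esub> c)),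
     one = (\<lambda>c\<in>carrier H. if c = \<one>\<^bsub>H\<^esub> then \<one>\<^bsub>R\<^esub> else \<zero>\<^bsub>R\<^esub>),
     ring.zero = (\<lambda>c\<in>carrier H. \<zero>\<^bsub>R\<^esub>),
     add = (\<lambda>f g. \<lambda>c\<in>carrier H. f c \<oplus>\<^bsub>R\<^esub> g c)\<rparr>"

definition open_normal :: "'g monoid \<Rightarrow> 'g topology \<Rightarrow> 'g set set" where
  "open_normal G T = {U. U \<lhd> G \<and> openin T U}"

type_synonym 'g cgr = "'g set \<Rightarrow> 'g set \<Rightarrow> nat \<Rightarrow> int"

text \<open>
  \<open>\<int>\<^sub>p[[G]]\<close> is the inverse limit of \<open>\<int>\<^sub>p[G/U]\<close> over the open normal subgroups \<open>U\<close> of the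
  profinite group \<open>G\<close>: an element \<open>\<mu>\<close> consists of elements \<open>\<mu> U\<close> of \<open>\<int>\<^sub>p[G/U]\<close> such that
  \<open>\<mu> V\<close> maps to \<open>\<mu> U\<close> under \<open>G/V \<rightarrow> G/U\<close> whenever \<open>V \<subseteq> U\<close>.
\<close>

definition completed_group_ring :: "nat \<Rightarrow> 'g monoid \<Rightarrow> 'g topology \<Rightarrow> 'g cgr ring" where
  "completed_group_ring p G T =
    \<lparr>carrier =
       {\<mu> \<in> (\<Pi>\<^sub>E U\<in>open_normal G T. carrier (group_ring (Zp p) (G Mod U))).
         \<forall>U\<in>open_normal G T. \<forall>V\<in>open_normal G T. V \<subseteq> U \<longrightarrow>
           (\<forall>c\<in>rcosets\<^bsub>G\<^esub> U. \<mu> U c = (\<Oplus>\<^bsub>Zp p\<^esub>d\<in>{d \<in> rcosets\<^bsub>G\<^esub> V. d \<subseteq> c}. \<mu> V d))},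
     monoid.mult = (\<lambda>\<mu> \<nu>. \<lambda>U\<in>open_normal G T. \<mu> U \<otimes>\<^bsub>group_ring (Zp p) (G Mod U)\<^esub> \<nu> U),
     one = (\<lambda>U\<in>open_normal G T. \<one>\<^bsub>group_ring (Zp p) (G Mod U)\<^esub>),
     ring.zero = (\<lambda>U\<in>open_normal G T. \<zero>\<^bsub>group_ring (Zp p) (G Mod U)\<^esub>),
     add = (\<lambda>\<mu> \<nu>. \<lambda>U\<in>open_normal G T. \<mu> U \<oplus>\<^bsub>group_ring (Zp p) (G Mod U)\<^esub> \<nu> U)\<rparr>"

definition completed_group_ring_topology ::
    "nat \<Rightarrow> 'g monoid \<Rightarrow> 'g topology \<Rightarrow> 'g cgr topology" where
  "completed_group_ring_topology p G T =
     subtopology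
       (product_topology (\<lambda>U. product_topology (\<lambda>_. Zp_topology p) (rcosets\<^bsub>G\<^esub> U)) (open_normal G T))
       (carrier (completed_group_ring p G T))"

text \<open>The element \<open>a\<cdot>g\<close> of \<open>\<int>\<^sub>p[[G]]\<close>, for \<open>a \<in> \<int>\<^sub>p\<close> and \<open>g \<in> G\<close>.\<close>

definition cgr_single ::
    "nat \<Rightarrow> 'g monoid \<Rightarrow> 'g topology \<Rightarrow> (nat \<Rightarrow> int) \<Rightarrow> 'g \<Rightarrow> 'g cgr" where
  "cgr_single p G T a g =
     (\<lambda>U\<in>open_normal G T. \<lambda>c\<in>rcosets\<^bsub>G\<^esub> U. if g \<in> c then a else \<zero>\<^bsub>Zp p\<^esub>)"

text \<open>
  The map \<open>\<int>\<^sub>p[[A]] \<rightarrow> \<int>\<^sub>p[[G]]\<close> induced by the inclusion of a closed subgroup \<open>A\<close> of \<open>G\<close>: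
  the image of \<open>A/(U \<inter> A) \<rightarrow> G/U\<close> consists of the cosets \<open>c\<close> that meet \<open>A\<close>, and the preimage of
  such a \<open>c\<close> is \<open>c \<inter> A\<close>.
\<close>

definition cgr_incl ::
    "nat \<Rightarrow> 'g monoid \<Rightarrow> 'g topology \<Rightarrow> 'g set \<Rightarrow> 'g cgr \<Rightarrow> 'g cgr" where
  "cgr_incl p G T A \<mu> =
     (\<lambda>U\<in>open_normal G T. \<lambda>c\<in>rcosets\<^bsub>G\<^esub> U.
        if c \<inter> A = {} then \<zero>\<^bsub>Zp p\<^esub> else \<mu> (U \<inter> A) (c \<inter> A))"

abbreviation Iwasawa_algebra where
  "Iwasawa_algebra p L k \<equiv> completed_group_ring p (Gal L k) (krull_topology L k)"

abbreviation Iwasawa_algebra_topology where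
  "Iwasawa_algebra_topology p L k \<equiv>
     completed_group_ring_topology p (Gal L k) (krull_topology L k)"


section \<open>Modules\<close>

text \<open>
  The fields \<^const>\<open>monoid.mult\<close> and \<^const>\<open>monoid.one\<close> of a module record carry no
  information and are left undefined in the constructions below.
\<close>

definition restrict_scalars :: "('r \<Rightarrow> 's) \<Rightarrow> ('s, 'x) module \<Rightarrow> ('r, 'x) module" where
  "restrict_scalars \<phi> M =
    \<lparr>carrier = carrier M, monoid.mult = undefined, one = undefined,
     ring.zero = \<zero>\<^bsub>M\<^esub>, add = add M, smult = (\<lambda>r x. \<phi> r \<odot>\<^bsub>M\<^esub> x)\<rparr>"

definition quotient_module :: "('r, 'x) module \<Rightarrow> 'x set \<Rightarrow> ('r, 'x set) module" where
  "quotient_module M N =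
    \<lparr>carrier = a_rcosets\<^bsub>M\<^esub> N, monoid.mult = undefined, one = undefined,
     ring.zero = N, add = set_add M, smult = (\<lambda>r C. N <+>\<^bsub>M\<^esub> ((\<lambda>x. r \<odot>\<^bsub>M\<^esub> x) ` C))\<rparr>"

definition cyclic_module :: "'r ring \<Rightarrow> ('r, 'x) module \<Rightarrow> bool" where
  "cyclic_module R M \<longleftrightarrow> (\<exists>x\<in>carrier M. carrier M = {r \<odot>\<^bsub>M\<^esub> x | r. r \<in> carrier R})"

definition profinite_space :: "'x topology \<Rightarrow> bool" where
  "profinite_space T \<longleftrightarrow> compact_space T \<and> Hausdorff_space T \<and>
     (\<forall>S. connectedin T S \<longrightarrow> (\<exists>x. S \<subseteq> {x}))"

definition profinite_module ::
    "'r ring \<Rightarrow> 'r topology \<Rightarrow> ('r, 'x) module \<Rightarrow> 'x topology \<Rightarrow> bool" where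
  "profinite_module R TR M T \<longleftrightarrow>
     module R M \<and> topspace T = carrier M \<and> profinite_space T \<and>
     continuous_map (prod_topology T T) T (\<lambda>(x, y). x \<oplus>\<^bsub>M\<^esub> y) \<and>
     continuous_map T T (\<lambda>x. \<ominus>\<^bsub>M\<^esub> x) \<and>
     continuous_map (prod_topology TR T) T (\<lambda>(r, x). r \<odot>\<^bsub>M\<^esub> x)"

text \<open>
  The maximal quotient of a profinite \<open>\<int>\<^sub>p\<close>-module \<open>M\<close> on which the group \<open>H\<close>, acting on \<open>M\<close> by
  \<open>act\<close>, acts trivially.  Quotients of profinite modules are by closed submodules, so this is the
  quotient by the smallest closed submodule containing all \<open>hx - x\<close>.
\<close>

definition coinvariants ::
    "nat \<Rightarrow> 'g set \<Rightarrow> ('g \<Rightarrow> 'x \<Rightarrow> 'x) \<Rightarrow> (nat \<Rightarrow> int, 'x) module \<Rightarrow> 'x topology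
      \<Rightarrow> (nat \<Rightarrow> int, 'x set) module" where
  "coinvariants p H act M T =
     quotient_module M
       (\<Inter> {N. submodule N (Zp p) M \<and> closedin T N \<and>
               (\<forall>h\<in>H. \<forall>x\<in>carrier M. act h x \<ominus>\<^bsub>M\<^esub> x \<in> N)})"

text \<open>
  \<open>M\<^bsub>Gal(L/F)\<^esub>\<close> for a profinite \<open>\<int>\<^sub>p[[Gal(L/k)]]\<close>-module \<open>M\<close> and an intermediate field \<open>F\<close>.
\<close>

definition galois_coinvariants ::
    "nat \<Rightarrow> complex set \<Rightarrow> complex set \<Rightarrow> complex set \<Rightarrow> ((complex \<Rightarrow> complex) cgr, 'x) module
      \<Rightarrow> 'x topology \<Rightarrow> (nat \<Rightarrow> int, 'x set) module" where
  "galois_coinvariants p L k F M T =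
    coinvariants p (carrier (Gal L F))
      (\<lambda>h x. cgr_single p (Gal L k) (krull_topology L k) (\<one>\<^bsub>Zp p\<^esub>) h \<odot>\<^bsub>M\<^esub> x)
      (restrict_scalars (\<lambda>a. cgr_single p (Gal L k) (krull_topology L k) a (\<one>\<^bsub>Gal L k\<^esub>)) M) T"


section \<open>The \<open>p\<close>-rank\<close>

text \<open>
  The tensor product \<open>S \<otimes>\<^sub>R M\<close> along \<open>\<phi> : R \<rightarrow> S\<close>, as an \<open>S\<close>-module: the free abelian group on
  \<open>S \<times> M\<close> modulo the usual relations, with \<open>s(a \<otimes> x) = sa \<otimes> x\<close>.  (The record that is divided out
  below is not an \<open>S\<close>-module itself; its scalar action is additive in \<open>s\<close> only modulo the relations.)
\<close>

definition tensor_relations ::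
    "'r ring \<Rightarrow> 's ring \<Rightarrow> ('r \<Rightarrow> 's) \<Rightarrow> ('r, 'x) module \<Rightarrow> ('s \<times> 'x \<Rightarrow>\<^sub>0 int) set" where
  "tensor_relations R S \<phi> M =
     {frag_of (a \<oplus>\<^bsub>S\<^esub> b, x) - (frag_of (a, x) + frag_of (b, x)) | a b x.
        a \<in> carrier S \<and> b \<in> carrier S \<and> x \<in> carrier M} \<union>
     {frag_of (a, x \<oplus>\<^bsub>M\<^esub> y) - (frag_of (a, x) + frag_of (a, y)) | a x y.
        a \<in> carrier S \<and> x \<in> carrier M \<and> y \<in> carrier M} \<union>
     {frag_of (a \<otimes>\<^bsub>S\<^esub> \<phi> r, x) - frag_of (a, r \<odot>\<^bsub>M\<^esub> x) | a r x.
        a \<in> carrier S \<and> r \<in> carrier R \<and> x \<in> carrier M}"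

definition base_change ::
    "'r ring \<Rightarrow> 's ring \<Rightarrow> ('r \<Rightarrow> 's) \<Rightarrow> ('r, 'x) module
      \<Rightarrow> ('s, ('s \<times> 'x \<Rightarrow>\<^sub>0 int) set) module" where
  "base_change R S \<phi> M =
    (let F = free_Abelian_group (carrier S \<times> carrier M) in
     quotient_module
       \<lparr>carrier = carrier F, monoid.mult = undefined, one = undefined,
        ring.zero = \<one>\<^bsub>F\<^esub>, add = monoid.mult F,
        smult = (\<lambda>s. frag_extend (\<lambda>(a, x). frag_of (s \<otimes>\<^bsub>S\<^esub> a, x)))\<rparr>
       (generate F (tensor_relations R S \<phi> M)))"

definition module_span :: "'r ring \<Rightarrow> ('r, 'x) module \<Rightarrow> 'x set \<Rightarrow> 'x set" where
  "module_span R M B = \<Inter> {N. submodule N R M \<and> B \<subseteq> N}"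

definition vs_basis :: "'r ring \<Rightarrow> ('r, 'x) module \<Rightarrow> 'x set \<Rightarrow> bool" where
  "vs_basis F V B \<longleftrightarrow> B \<subseteq> carrier V \<and> module_span F V B = carrier V \<and>
     (\<forall>b\<in>B. b \<notin> module_span F V (B - {b}))"

text \<open>
  All bases have the same cardinality, so the infimum is the cardinality of any finite basis, and
  it is \<open>\<infinity>\<close> if there is no finite basis.
\<close>

definition vs_dim :: "'r ring \<Rightarrow> ('r, 'x) module \<Rightarrow> enat" where
  "vs_dim F V = (INF B\<in>{B. finite B \<and> vs_basis F V B}. enat (card B))"

text \<open>The map \<open>\<int>\<^sub>p \<rightarrow> \<int>/p\<close> is the projection to the component with index 1.\<close>

definition p_rank :: "nat \<Rightarrow> (nat \<Rightarrow> int, 'x) module \<Rightarrow> enat" where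
  "p_rank p M =
     vs_dim (residue_ring (int p)) (base_change (Zp p) (residue_ring (int p)) (\<lambda>a. a 1) M)"

end

theory Submission
  imports Defs
begin

text \<open>
  Write \<open>G = Gal(K/k)\<close>, \<open>H = Gal(K/k_cy)\<close>, and let \<open>x\<close> generate \<open>M\<close> over \<open>\<int>\<^sub>p[[H]]\<close>.  If \<open>g\<close> topologically
  generates \<open>H\<close>, then \<open>Gal(K/k_inf)\<close> contains \<open>g\<gamma>\<close> for some \<open>\<gamma>\<close> fixing \<open>k_an\<close>, because
  \<open>k_inf \<inter> k_an = k\<close>.  Complex conjugation inverts \<open>g\<close> and centralises \<open>\<gamma>\<close>, so \<open>g\<inverse>\<gamma>\<close> lies in
  the Galois group over the conjugate of \<open>k_inf\<close>.  Let \<open>\<gamma>x = fx\<close> with \<open>f \<in> \<int>\<^sub>p[[H]]\<close>.  In the two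
  coinvariant quotients \<open>gf - 1\<close> and \<open>f - g\<close> kill \<open>x\<close>.  Modulo \<open>p\<close> the ring \<open>\<int>\<^sub>p[[H]]\<close> is local with
  maximal ideal \<open>(g - 1)\<close>.  If \<open>f\<close> does not have augmentation 1 modulo \<open>p\<close>, then \<open>gf - 1\<close> is a unit;
  otherwise \<open>gf - 1 = (g - 1)u\<close> and \<open>f - g = (g - 1)v\<close> with \<open>u - v = f + 1\<close> of augmentation 2, so that
  \<open>u\<close> or \<open>v\<close> is a unit, \<open>p\<close> being odd.  In all cases \<open>g - 1\<close> dies in one of the two quotients modulo \<open>p\<close>,
  and that quotient is spanned by the image of \<open>x\<close>.

  All of this is carried out at finite levels, where \<open>g\<close>, \<open>\<gamma>\<close> and \<open>f\<close> may depend on the level and \<open>f\<close> can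
  be taken to be an integer polynomial in \<open>g\<close>.  The two alternatives are inherited by lower levels,
  hence one of them holds at every level, and it passes to the limit because \<open>M\<close> is compact.
\<close>

text \<open>Z_p[[H]] is never identified with a power series ring. A level is a pair of an open
  normal subgroup V and an exponent n, that is, the ideal of those elements of Z_p[[G]] that vanish
  in (Z/p^n)[G/V]. There the image of Z_p[[H]] is spanned by finitely many powers of one element, so
  the ring argument can be carried out in \<int>[T], with T sent to that element. The obstacle is
  that the submodule divided out in the coinvariants is by definition only a closed Z_p-submodule
  containing all hy - y; stability under G is not part of the definition. Hence the relations are
  applied to Q(g)x for every polynomial Q and not to x alone, and the two ideals of \<int>[T] have
  such a multiplier built in. The two signs under conjugation J have different sources. On
  Gal(k_cy/k) it acts trivially because it restricts to an element of the abelian Galois group of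
  the cyclotomic Z_p-extension of \<rat>. On Gal(k_an/k) it acts by inversion because every \<tau>
  J(\<tau>) lies in Gamma^+.\<close>

section \<open>Subfields of the complex numbers and generated fields\<close>

lemma field_CC: "Ring.field CC"
  by (rule field_from_type_algebra)

lemma CC_simps [simp]:
  "carrier CC = UNIV" "x \<otimes>\<^bsub>CC\<^esub> y = x * y" "x \<oplus>\<^bsub>CC\<^esub> y = x + y" "\<one>\<^bsub>CC\<^esub> = 1" "\<zero>\<^bsub>CC\<^esub> = 0"
  by (simp_all add: ring_of_type_algebra_def)

lemma CC_a_inv [simp]: "\<ominus>\<^bsub>CC\<^esub> x = - x"
proof -
  interpret Ring.field CC by (rule field_CC)
  show ?thesis by (rule minus_equality) auto
qed

lemma CC_m_inv: "x \<noteq> 0 \<Longrightarrow> inv\<^bsub>CC\<^esub> x = inverse x"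
proof -
  assume "x \<noteq> 0"
  interpret Ring.field CC by (rule field_CC)
  show ?thesis using \<open>x \<noteq> 0\<close> by (intro comm_inv_char) auto
qed

lemma CC_pow [simp]: "x [^]\<^bsub>CC\<^esub> (n::nat) = x ^ n"
proof -
  interpret Ring.field CC by (rule field_CC)
  show ?thesis by (induction n) (auto simp: nat_pow_Suc)
qed

text \<open>Translates the record notion into type class operations. Since
  \<open>inverse 0 = 0\<close> for complex numbers, closure under inverses needs no exception at
  0.\<close>

lemma subfield_CC_iff:
  "subfield F CC \<longleftrightarrow> 1 \<in> F \<and> (\<forall>x\<in>F. \<forall>y\<in>F. x + y \<in> F \<and> x * y \<in> F) \<and> (\<forall>x\<in>F. - x \<in> F \<and> inverse x \<in> F)"
  (is "_ \<longleftrightarrow> ?P")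
proof
  interpret Ring.field CC by (rule field_CC)
  assume F: "subfield F CC"
  have 0: "0 \<in> F" using subringE(2)[OF subfieldE(1)[OF F]] by simp
  have inv: "inverse x \<in> F" if "x \<in> F" for x
  proof (cases "x = 0")
    case False
    then show ?thesis using subfield_m_inv(1)[OF F, of x] that CC_m_inv[of x] by simp
  qed (use 0 in auto)
  show ?P using inv subringE(3,5-7)[OF subfieldE(1)[OF F]] by simp
next
  interpret Ring.field CC by (rule field_CC)
  assume P: ?P
  show "subfield F CC"
  proof (rule subfieldI')
    show "subring F CC" by (rule subringI) (use P in auto)
    show "inv\<^bsub>CC\<^esub> k \<in> F" if "k \<in> F - {\<zero>\<^bsub>CC\<^esub>}" for k using that P CC_m_inv[of k] by auto
  qed
qed

lemma subfield_CC_I: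
  assumes "1 \<in> F" "\<And>x y. x \<in> F \<Longrightarrow> y \<in> F \<Longrightarrow> x + y \<in> F" "\<And>x y. x \<in> F \<Longrightarrow> y \<in> F \<Longrightarrow> x * y \<in> F"
    "\<And>x. x \<in> F \<Longrightarrow> - x \<in> F" "\<And>x. x \<in> F \<Longrightarrow> inverse x \<in> F"
  shows "subfield F CC"
  using assms by (auto simp: subfield_CC_iff)

lemma subfield_CC_D:
  assumes "subfield F CC"
  shows "1 \<in> F" "0 \<in> F" "\<And>x y. x \<in> F \<Longrightarrow> y \<in> F \<Longrightarrow> x + y \<in> F" "\<And>x y. x \<in> F \<Longrightarrow> y \<in> F \<Longrightarrow> x * y \<in> F"
    "\<And>x. x \<in> F \<Longrightarrow> - x \<in> F" "\<And>x. x \<in> F \<Longrightarrow> inverse x \<in> F"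
    "\<And>x y. x \<in> F \<Longrightarrow> y \<in> F \<Longrightarrow> x - y \<in> F" "\<And>x y. x \<in> F \<Longrightarrow> y \<in> F \<Longrightarrow> x / y \<in> F"
proof -
  note F = assms[unfolded subfield_CC_iff]
  show "1 \<in> F" and add: "\<And>x y. x \<in> F \<Longrightarrow> y \<in> F \<Longrightarrow> x + y \<in> F"
    and mult: "\<And>x y. x \<in> F \<Longrightarrow> y \<in> F \<Longrightarrow> x * y \<in> F"
    and neg: "\<And>x. x \<in> F \<Longrightarrow> - x \<in> F" and inv: "\<And>x. x \<in> F \<Longrightarrow> inverse x \<in> F"
    using F by auto
  show "0 \<in> F" using add[of 1 "-1"] neg[of 1] F by auto
  show "x - y \<in> F" if "x \<in> F" "y \<in> F" for x y using add[of x "-y"] neg[of y] that by auto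
  show "x / y \<in> F" if "x \<in> F" "y \<in> F" for x y
    using mult[of x "inverse y"] inv[of y] that by (auto simp: divide_inverse)
qed

lemma subfield_CC_sum:
  assumes "subfield F CC" "\<And>i. i \<in> A \<Longrightarrow> f i \<in> F"
  shows "sum f A \<in> F"
  using assms(2) by (induction A rule: infinite_finite_induct) (auto simp: subfield_CC_D[OF assms(1)])

lemma Rats_subset_subfield: 
  assumes "subfield F CC" shows "\<rat> \<subseteq> F"
proof -
  note D = subfield_CC_D[OF assms]
  have nat: "of_nat n \<in> F" for n by (induction n) (use D in auto)
  have int: "of_int i \<in> F" for i by (cases i rule: int_cases2) (use nat D in auto)
  show ?thesis
  proof
    fix x :: complex assume "x \<in> \<rat>"
    then obtain a b where "x = of_int a / of_int b" by (auto elim: Rats_cases')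
    then show "x \<in> F" using int D(8) by auto
  qed
qed

lemma subfield_generate_field: "subfield (generate_field CC A) CC"
  using field.generate_field_is_subfield[OF field_CC] by auto

lemma generate_field_CC_subset:
  "A \<subseteq> E \<Longrightarrow> subfield E CC \<Longrightarrow> generate_field CC A \<subseteq> E"
  using field.generate_field_min_subfield1[OF field_CC] by auto

lemma generate_field_CC_incl: "A \<subseteq> generate_field CC A"
  by (auto intro: generate_field.incl)

section \<open>Polynomials with coefficients in a subfield\<close>

text \<open>Polynomials over a subfield are kept in \<open>complex poly\<close> with a side
  condition, so that degrees, roots and derivatives come from the type-based theory.\<close>

definition coeffs_in :: "complex set \<Rightarrow> complex poly \<Rightarrow> bool" where
  "coeffs_in F P \<longleftrightarrow> (\<forall>i. Polynomial.coeff P i \<in> F)"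

lemma coeffs_in_pCons [simp]: "coeffs_in F (pCons a P) \<longleftrightarrow> a \<in> F \<and> coeffs_in F P"
  by (auto simp: coeffs_in_def coeff_pCons split: nat.splits)

lemma coeffs_in_0: "subfield F CC \<Longrightarrow> coeffs_in F 0"
  by (auto simp: coeffs_in_def subfield_CC_D)

lemma coeffs_in_1: "subfield F CC \<Longrightarrow> coeffs_in F 1"
  by (auto simp: coeffs_in_def subfield_CC_D coeff_1)

lemma coeffs_in_add: "subfield F CC \<Longrightarrow> coeffs_in F P \<Longrightarrow> coeffs_in F Q \<Longrightarrow> coeffs_in F (P + Q)"
  and coeffs_in_minus: "subfield F CC \<Longrightarrow> coeffs_in F P \<Longrightarrow> coeffs_in F (- P)"
  and coeffs_in_diff: "subfield F CC \<Longrightarrow> coeffs_in F P \<Longrightarrow> coeffs_in F Q \<Longrightarrow> coeffs_in F (P - Q)"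
  and coeffs_in_mult: "subfield F CC \<Longrightarrow> coeffs_in F P \<Longrightarrow> coeffs_in F Q \<Longrightarrow> coeffs_in F (P * Q)"
  and coeffs_in_monom: "subfield F CC \<Longrightarrow> c \<in> F \<Longrightarrow> coeffs_in F (Polynomial.monom c n)"
  by (auto simp: coeffs_in_def subfield_CC_D coeff_mult intro!: subfield_CC_sum)

lemma coeffs_in_mono: "F \<subseteq> F' \<Longrightarrow> coeffs_in F P \<Longrightarrow> coeffs_in F' P"
  by (auto simp: coeffs_in_def)

lemma poly_in_subfield:
  assumes "subfield E CC" "coeffs_in E P" "x \<in> E"
  shows "poly P x \<in> E"
  using assms(2) by (induction P) (auto simp: subfield_CC_D[OF assms(1)] assms(3))

text \<open>The lists of HOL-Algebra start with the leading coefficient and those of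
  \<open>Poly\<close> with the constant one, hence \<open>rev\<close>.\<close>

lemma eval_CC: "ring.eval CC p x = poly (Poly (rev p)) x"
proof -
  interpret Ring.field CC by (rule field_CC)
  show ?thesis
    by (induction p) (auto simp: Poly_append poly_monom algebra_simps)
qed

lemma algebraic_CC_iff:
  assumes F: "subfield F CC"
  shows "ring.algebraic CC F x \<longleftrightarrow> (\<exists>P. P \<noteq> 0 \<and> coeffs_in F P \<and> poly P x = 0)"
proof -
  interpret Ring.field CC by (rule field_CC)
  note D = subfield_CC_D[OF F]
  have c: "coeffs_in F (Poly p)" if "set p \<subseteq> F" for p
    using that by (induction p) (auto simp: coeffs_in_0[OF F])
  show ?thesis
  proof
    assume "algebraic F x"
    then obtain p where p: "p \<in> carrier (F[X]\<^bsub>CC\<^esub>)" "p \<noteq> []" "eval p x = \<zero>\<^bsub>CC\<^esub>"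
      using algebraicE[OF subfieldE(1)[OF F], of x] by (auto simp: over_def)
    then have pp: "set p \<subseteq> F" "hd p \<noteq> 0" by (auto simp: univ_poly_def polynomial_def)
    have "Poly (rev p) \<noteq> 0"
    proof
      assume "Poly (rev p) = 0"
      then have "\<forall>x\<in>set (rev p). x = 0" by (auto simp: Poly_eq_0 in_set_replicate) (metis in_set_replicate set_rev)
      then show False using pp(2) p(2) by (metis hd_in_set set_rev)
    qed
    moreover have "coeffs_in F (Poly (rev p))" using c[of "rev p"] pp by auto
    ultimately show "\<exists>P. P \<noteq> 0 \<and> coeffs_in F P \<and> poly P x = 0" using p(3) by (auto simp: eval_CC)
  next
    assume "\<exists>P. P \<noteq> 0 \<and> coeffs_in F P \<and> poly P x = 0"
    then obtain P where P: "P \<noteq> 0" "coeffs_in F P" "poly P x = 0" by auto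
    define p where "p = rev (coeffs P)"
    have "set p \<subseteq> F" using P(2) by (auto simp: p_def coeffs_def coeffs_in_def)
    moreover have "p \<noteq> []" using P(1) by (auto simp: p_def)
    moreover have "hd p \<noteq> 0" using P(1) by (simp add: p_def hd_rev last_coeffs_eq_coeff_degree)
    ultimately have "p \<in> carrier (F[X]\<^bsub>CC\<^esub>)" by (auto simp: univ_poly_def polynomial_def)
    moreover have "eval p x = \<zero>\<^bsub>CC\<^esub>" using P(3) by (simp add: eval_CC p_def)
    ultimately show "algebraic F x" using algebraicI[of p F x] \<open>p \<noteq> []\<close> by (auto simp: over_def)
  qed
qed

text \<open>By \<open>algebraic_CC_iff\<close> this is algebraicity in the sense of HOL-Algebra; the
  name lets the sequel work with \<open>complex poly\<close>.\<close>

definition alg_over :: "complex set \<Rightarrow> complex \<Rightarrow> bool" where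
  "alg_over F x \<longleftrightarrow> (\<exists>P. P \<noteq> 0 \<and> coeffs_in F P \<and> poly P x = 0)"

lemma alg_over_mono: "F \<subseteq> F' \<Longrightarrow> alg_over F x \<Longrightarrow> alg_over F' x"
  unfolding alg_over_def using coeffs_in_mono by blast

lemma subfield_alg_over:
  assumes "subfield F CC" shows "subfield {x. alg_over F x} CC"
  using field.subfield_of_algebraics[OF field_CC assms] algebraic_CC_iff[OF assms]
  by (simp add: alg_over_def over_def)

lemma alg_over_self: "subfield F CC \<Longrightarrow> x \<in> F \<Longrightarrow> alg_over F x"
  unfolding alg_over_def by (rule exI[of _ "[:-x, 1:]"]) (auto simp: subfield_CC_D coeffs_in_0)

lemma alg_over_generate_field:
  assumes "subfield F CC" "\<And>x. x \<in> A \<Longrightarrow> alg_over F x" "y \<in> generate_field CC A"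
  shows "alg_over F y"
  using generate_field_CC_subset[OF _ subfield_alg_over[OF assms(1)], of A] assms(2,3) by auto

text \<open>The usual descent that cancels leading terms. It is carried out over \<open>F\<close>
  because quotient and remainder must again have their coefficients in \<open>F\<close>.\<close>

lemma poly_division_in:
  assumes F: "subfield F CC" and m: "coeffs_in F m" "m \<noteq> 0" and P: "coeffs_in F P"
  shows "\<exists>Q R. coeffs_in F Q \<and> coeffs_in F R \<and> P = m * Q + R \<and> (R = 0 \<or> Polynomial.degree R < Polynomial.degree m)"
  using P
proof (induction "Polynomial.degree P" arbitrary: P rule: less_induct)
  case less
  show ?case
  proof (cases "P = 0 \<or> Polynomial.degree P < Polynomial.degree m")
    case True
    then show ?thesis using less.prems coeffs_in_0[OF F] by (intro exI[of _ 0] exI[of _ P]) auto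
  next
    case False
    define c where "c = Polynomial.lead_coeff P / Polynomial.lead_coeff m"
    define d where "d = Polynomial.degree P - Polynomial.degree m"
    define P' where "P' = P - m * Polynomial.monom c d"
    have c: "c \<in> F" "c \<noteq> 0" using less.prems m False by (auto simp: c_def coeffs_in_def subfield_CC_D[OF F])
    have P': "coeffs_in F P'" unfolding P'_def using less.prems m c F
      by (intro coeffs_in_diff coeffs_in_mult coeffs_in_monom) auto
    have deg: "Polynomial.degree (m * Polynomial.monom c d) = Polynomial.degree P"
      using False m c by (simp add: degree_mult_eq monom_eq_0_iff degree_monom_eq d_def)
    have "Polynomial.coeff (m * Polynomial.monom c d) (Polynomial.degree P) = Polynomial.lead_coeff P"
      using deg lead_coeff_mult[of m "Polynomial.monom c d"] c(2) m(2) by (simp add: degree_monom_eq c_def del: coeff_mult)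
    then have co: "Polynomial.coeff P' (Polynomial.degree P) = 0" by (simp add: P'_def)
    have "\<exists>Q R. coeffs_in F Q \<and> coeffs_in F R \<and> P' = m * Q + R \<and> (R = 0 \<or> Polynomial.degree R < Polynomial.degree m)"
    proof (cases "Polynomial.degree P' < Polynomial.degree P")
      case True then show ?thesis using less.hyps P' by blast
    next
      case F2: False
      have "Polynomial.degree P' \<le> Polynomial.degree P" unfolding P'_def using deg by (intro degree_diff_le) auto
      then have "Polynomial.degree P' = Polynomial.degree P" using F2 by auto
      then have "P' = 0" using co by (metis leading_coeff_0_iff)
      then show ?thesis using coeffs_in_0[OF F] by (intro exI[of _ 0]) auto
    qed
    then obtain Q R where QR: "coeffs_in F Q" "coeffs_in F R" "P' = m * Q + R" "R = 0 \<or> Polynomial.degree R < Polynomial.degree m"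
      by blast
    have "P = m * (Q + Polynomial.monom c d) + R" using QR(3) by (simp add: P'_def algebra_simps)
    moreover have "coeffs_in F (Q + Polynomial.monom c d)" using F c QR by (intro coeffs_in_add coeffs_in_monom)
    ultimately show ?thesis using QR by blast
  qed
qed

text \<open>Divisibility of every polynomial vanishing at \<open>x\<close> takes the place of
  irreducibility: it is what makes P(x) |-> P(y) well defined on F[x]. The polynomial is fixed only
  up to a constant factor.\<close>

definition minpoly :: "complex set \<Rightarrow> complex \<Rightarrow> complex poly \<Rightarrow> bool" where
  "minpoly F x m \<longleftrightarrow> m \<noteq> 0 \<and> coeffs_in F m \<and> poly m x = 0 \<and>
     (\<forall>P. coeffs_in F P \<longrightarrow> poly P x = 0 \<longrightarrow> (\<exists>Q. coeffs_in F Q \<and> P = m * Q))"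

lemma minpoly_exists:
  assumes F: "subfield F CC" and "alg_over F x"
  shows "\<exists>m. minpoly F x m"
proof -
  define S where "S = {P. P \<noteq> 0 \<and> coeffs_in F P \<and> poly P x = 0}"
  have "S \<noteq> {}" using assms(2) by (auto simp: alg_over_def S_def)
  then obtain m where m: "m \<in> S" "\<And>P. P \<in> S \<Longrightarrow> Polynomial.degree m \<le> Polynomial.degree P"
    using ex_has_least_nat[of "\<lambda>P. P \<in> S" _ Polynomial.degree] by blast
  have "\<exists>Q. coeffs_in F Q \<and> P = m * Q" if P: "coeffs_in F P" "poly P x = 0" for P
  proof -
    obtain Q R where QR: "coeffs_in F Q" "coeffs_in F R" "P = m * Q + R" "R = 0 \<or> Polynomial.degree R < Polynomial.degree m"
      using poly_division_in[OF F _ _ P(1), of m] m(1) by (auto simp: S_def)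
    have "poly R x = 0" using P QR(3) m(1) by (auto simp: S_def)
    then have "R = 0" using QR m(2)[of R] by (metis (mono_tags, lifting) S_def leD mem_Collect_eq)
    then show ?thesis using QR by auto
  qed
  then show ?thesis using m(1) by (auto simp: minpoly_def S_def)
qed

lemma minpoly_degree_pos:
  assumes "minpoly F x m" shows "Polynomial.degree m > 0"
proof (rule ccontr)
  assume "\<not> ?thesis"
  then obtain c where "m = [:c:]" by (metis degree_eq_zeroE neq0_conv)
  then show False using assms by (auto simp: minpoly_def)
qed

section \<open>Embeddings\<close>

text \<open>Only the values of \<open>\<sigma>\<close> on \<open>F\<close> count. An embedding of a
  field is thereby an embedding of each of its subfields, without any restriction map.\<close>

definition field_emb :: "complex set \<Rightarrow> (complex \<Rightarrow> complex) \<Rightarrow> bool" where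
  "field_emb F \<sigma> \<longleftrightarrow> \<sigma> 1 = 1 \<and> (\<forall>x\<in>F. \<forall>y\<in>F. \<sigma> (x + y) = \<sigma> x + \<sigma> y \<and> \<sigma> (x * y) = \<sigma> x * \<sigma> y)"

lemma field_emb_subset: "F \<subseteq> F' \<Longrightarrow> field_emb F' \<sigma> \<Longrightarrow> field_emb F \<sigma>"
  by (auto simp: field_emb_def)

lemma field_emb_cong: "subfield F CC \<Longrightarrow> (\<And>x. x \<in> F \<Longrightarrow> \<sigma> x = \<tau> x) \<Longrightarrow> field_emb F \<sigma> \<longleftrightarrow> field_emb F \<tau>"
  by (auto simp: field_emb_def subfield_CC_D)

lemma field_emb_D:
  assumes F: "subfield F CC" and s: "field_emb F \<sigma>"
  shows "\<sigma> 1 = 1" "\<sigma> 0 = 0" "\<And>x y. x \<in> F \<Longrightarrow> y \<in> F \<Longrightarrow> \<sigma> (x + y) = \<sigma> x + \<sigma> y"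
    "\<And>x y. x \<in> F \<Longrightarrow> y \<in> F \<Longrightarrow> \<sigma> (x * y) = \<sigma> x * \<sigma> y" "\<And>x. x \<in> F \<Longrightarrow> \<sigma> (- x) = - \<sigma> x"
    "\<And>x y. x \<in> F \<Longrightarrow> y \<in> F \<Longrightarrow> \<sigma> (x - y) = \<sigma> x - \<sigma> y"
    "\<And>x. x \<in> F \<Longrightarrow> \<sigma> (inverse x) = inverse (\<sigma> x)" "inj_on \<sigma> F"
proof -
  note D = subfield_CC_D[OF F]
  show 1: "\<sigma> 1 = 1" and add: "\<And>x y. x \<in> F \<Longrightarrow> y \<in> F \<Longrightarrow> \<sigma> (x + y) = \<sigma> x + \<sigma> y"
    and mult: "\<And>x y. x \<in> F \<Longrightarrow> y \<in> F \<Longrightarrow> \<sigma> (x * y) = \<sigma> x * \<sigma> y"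
    using s by (auto simp: field_emb_def)
  show 0: "\<sigma> 0 = 0" using add[of 0 0] D by auto
  show neg: "\<sigma> (- x) = - \<sigma> x" if "x \<in> F" for x using add[of x "-x"] that D 0
    by (simp add: eq_neg_iff_add_eq_0 add.commute)
  show diff: "\<sigma> (x - y) = \<sigma> x - \<sigma> y" if "x \<in> F" "y \<in> F" for x y
    using add[of x "-y"] neg[of y] that D by auto
  have inv1: "\<sigma> x * \<sigma> (inverse x) = 1" if "x \<in> F" "x \<noteq> 0" for x
    using mult[of x "inverse x"] that D 1 by auto
  show "\<sigma> (inverse x) = inverse (\<sigma> x)" if "x \<in> F" for x
    by (cases "x = 0") (use inv1[OF that] 0 in \<open>auto simp: inverse_unique\<close>)
  show "inj_on \<sigma> F"
  proof (rule inj_onI)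
    fix x y assume xy: "x \<in> F" "y \<in> F" "\<sigma> x = \<sigma> y"
    then have "\<sigma> (x - y) = 0" using diff by auto
    then have "x - y = 0" using inv1[of "x - y"] D xy by auto
    then show "x = y" by simp
  qed
qed

lemma field_emb_sum:
  assumes F: "subfield F CC" and s: "field_emb F \<sigma>" and "\<And>i. i \<in> A \<Longrightarrow> f i \<in> F"
  shows "\<sigma> (sum f A) = (\<Sum>i\<in>A. \<sigma> (f i))"
  using assms(3)
  by (induction A rule: infinite_finite_induct) (auto simp: field_emb_D[OF F s] subfield_CC_sum[OF F])

lemma subfield_image_emb:
  assumes F: "subfield F CC" and s: "field_emb F \<sigma>"
  shows "subfield (\<sigma> ` F) CC"
  using field_emb_D[OF F s] subfield_CC_D[OF F]
  by (intro subfield_CC_I) (auto simp: image_iff, metis+)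

lemma map_poly_emb:
  assumes F: "subfield F CC" and s: "field_emb F \<sigma>" and P: "coeffs_in F P" and Q: "coeffs_in F Q"
  shows "map_poly \<sigma> (P + Q) = map_poly \<sigma> P + map_poly \<sigma> Q"
    and "map_poly \<sigma> (P * Q) = map_poly \<sigma> P * map_poly \<sigma> Q"
    and "map_poly \<sigma> (- P) = - map_poly \<sigma> P"
  using P Q field_emb_D[OF F s] subfield_CC_D[OF F]
  by (auto simp: poly_eq_iff coeff_map_poly coeffs_in_def coeff_mult field_emb_sum[OF F s])

lemma map_poly_emb_1: "field_emb F \<sigma> \<Longrightarrow> subfield F CC \<Longrightarrow> map_poly \<sigma> 1 = 1"
  by (auto simp: poly_eq_iff coeff_map_poly field_emb_D coeff_1)

lemma map_poly_emb_const: "field_emb F \<sigma> \<Longrightarrow> subfield F CC \<Longrightarrow> map_poly \<sigma> [:c:] = [:\<sigma> c:]"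
  by (auto simp: poly_eq_iff coeff_map_poly field_emb_D coeff_pCons split: nat.splits)

lemma poly_map_poly_emb:
  assumes F: "subfield F CC" and s: "field_emb F \<sigma>" and P: "coeffs_in F P" and x: "x \<in> F"
  shows "\<sigma> (poly P x) = poly (map_poly \<sigma> P) (\<sigma> x)"
  using P
proof (induction P)
  case 0 then show ?case using field_emb_D[OF F s] by auto
next
  case (pCons a P)
  then show ?case using field_emb_D[OF F s] subfield_CC_D[OF F] poly_in_subfield[OF F _ x]
    by (auto simp: map_poly_pCons x)
qed

lemma field_emb_root:
  assumes "subfield F CC" "field_emb F \<sigma>" "coeffs_in k P" "k \<subseteq> F" "\<And>a. a \<in> k \<Longrightarrow> \<sigma> a = a" "0 \<in> k" "x \<in> F" "poly P x = 0"
  shows "poly P (\<sigma> x) = 0"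
proof -
  have "map_poly \<sigma> P = P" using assms by (auto simp: poly_eq_iff coeff_map_poly coeffs_in_def)
  then show ?thesis using poly_map_poly_emb[OF assms(1,2), of P x] assms coeffs_in_mono[of k F P]
    field_emb_D[OF assms(1,2)] by auto
qed

text \<open>Partial embeddings are represented by their graphs, so that Zorn's lemma applies to inclusion.\<close>

definition ring_graph :: "(complex \<times> complex) set \<Rightarrow> bool" where
  "ring_graph G \<longleftrightarrow> (1, 1) \<in> G \<and> (\<forall>a b. (a, b) \<in> G \<longrightarrow> (- a, - b) \<in> G) \<and>
     (\<forall>a b c d. (a, b) \<in> G \<longrightarrow> (c, d) \<in> G \<longrightarrow> (a + c, b + d) \<in> G \<and> (a * c, b * d) \<in> G) \<and>
     (\<forall>b. (0, b) \<in> G \<longrightarrow> b = 0)"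

text \<open>A trivial fibre over 0 suffices: two values over \<open>a\<close> differ by a value over
  \<open>a + - a\<close>.\<close>

lemma ring_graph_fun:
  assumes "ring_graph G" "(a, b) \<in> G" "(a, c) \<in> G" shows "b = c"
proof -
  have "(- a, - c) \<in> G" using assms unfolding ring_graph_def by blast
  then have "(a + - a, b + - c) \<in> G" using assms unfolding ring_graph_def by blast
  then show ?thesis using assms(1) by (auto simp: ring_graph_def)
qed

lemma ring_graph_emb:
  assumes "ring_graph G"
  shows "\<exists>\<tau>. field_emb (fst ` G) \<tau> \<and> (\<forall>a b. (a, b) \<in> G \<longrightarrow> \<tau> a = b)"
proof -
  define \<tau> where "\<tau> a = (THE b. (a, b) \<in> G)" for a
  have \<tau>: "\<tau> a = b" if "(a, b) \<in> G" for a b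
    unfolding \<tau>_def using ring_graph_fun[OF assms] that by (intro the_equality) auto
  have "field_emb (fst ` G) \<tau>"
    using assms by (auto simp: field_emb_def ring_graph_def \<tau>)
  then show ?thesis using \<tau> by blast
qed

text \<open>One step of a simple extension: the graph consists of the pairs (P(x), P^\<tau>(y)) with
  P over \<open>D\<close>. If P(x) = 0, then \<open>m\<close> divides P in D[X], and P^\<tau>(y) = 0
  since y is a root of m^\<tau>.\<close>

lemma ring_graph_step:
  assumes D: "subfield D CC" and t: "field_emb D \<tau>" and m: "minpoly D x m"
    and y: "poly (map_poly \<tau> m) y = 0" and E: "subfield E CC" "D \<subseteq> E" "x \<in> E"
  shows "\<exists>G. ring_graph G \<and> (\<forall>a\<in>D. (a, \<tau> a) \<in> G) \<and> (x, y) \<in> G \<and> fst ` G \<subseteq> E"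
proof -
  define G where "G = {(poly P x, poly (map_poly \<tau> P) y) | P. coeffs_in D P}"
  note DD = subfield_CC_D[OF D] and tt = field_emb_D[OF D t]
  have "(1, 1) \<in> G" unfolding G_def using map_poly_emb_1[OF t D] coeffs_in_1[OF D]
    by (auto intro!: exI[of _ 1])
  moreover have "(a, \<tau> a) \<in> G" if "a \<in> D" for a unfolding G_def
    using map_poly_emb_const[OF t D, of a] that coeffs_in_0[OF D]
    by (auto intro!: exI[of _ "[:a:]"])
  moreover have "(x, y) \<in> G" unfolding G_def
    using map_poly_pCons[of \<tau> 0 "[:1:]"] DD tt map_poly_emb_const[OF t D, of 1] coeffs_in_0[OF D]
    by (auto intro!: exI[of _ "[:0,1:]"])
  moreover have "(- a, - b) \<in> G" if ab: "(a, b) \<in> G" for a b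
  proof -
    obtain P where "coeffs_in D P" "a = poly P x" "b = poly (map_poly \<tau> P) y" using ab unfolding G_def by blast
    then show ?thesis unfolding G_def using map_poly_emb(3)[OF D t] coeffs_in_minus[OF D]
      by (auto intro!: exI[of _ "-P"])
  qed
  moreover have "(a + c, b + d) \<in> G \<and> (a * c, b * d) \<in> G" if ab: "(a, b) \<in> G" "(c, d) \<in> G" for a b c d
  proof -
    obtain P where P: "coeffs_in D P" "a = poly P x" "b = poly (map_poly \<tau> P) y" using ab unfolding G_def by blast
    obtain Q where Q: "coeffs_in D Q" "c = poly Q x" "d = poly (map_poly \<tau> Q) y" using ab unfolding G_def by blast
    have "(a + c, b + d) \<in> G" unfolding G_def using P Q map_poly_emb(1)[OF D t P(1) Q(1)] coeffs_in_add[OF D P(1) Q(1)]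
      by (auto intro!: exI[of _ "P + Q"])
    moreover have "(a * c, b * d) \<in> G" unfolding G_def using P Q map_poly_emb(2)[OF D t P(1) Q(1)] coeffs_in_mult[OF D P(1) Q(1)]
      by (auto intro!: exI[of _ "P * Q"])
    ultimately show ?thesis by blast
  qed
  moreover have "b = 0" if ab: "(0, b) \<in> G" for b
  proof -
    obtain P where P: "coeffs_in D P" "0 = poly P x" "b = poly (map_poly \<tau> P) y" using ab unfolding G_def by blast
    then obtain Q where "coeffs_in D Q" "P = m * Q" using m by (auto simp: minpoly_def)
    then show ?thesis using P(3) y map_poly_emb(2)[OF D t, of m Q] m by (auto simp: minpoly_def)
  qed
  moreover have "fst ` G \<subseteq> E" using poly_in_subfield[OF E(1) _ E(3)] coeffs_in_mono[OF E(2)] by (auto simp: G_def)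
  ultimately show ?thesis unfolding ring_graph_def by blast
qed

text \<open>The inverse of x is read off from an equation a + x P(x) = 0 with a nonzero in
  \<open>F\<close>; while the constant term vanishes, a factor x is cancelled. It is needed because
  the domain of a maximal graph is at first only known to be a ring.\<close>

lemma subring_algebraic_subfield:
  assumes F: "subfield F CC" "F \<subseteq> D" and D: "1 \<in> D" "\<And>x y. x \<in> D \<Longrightarrow> y \<in> D \<Longrightarrow> x + y \<in> D"
    "\<And>x y. x \<in> D \<Longrightarrow> y \<in> D \<Longrightarrow> x * y \<in> D" "\<And>x. x \<in> D \<Longrightarrow> - x \<in> D" and alg: "\<And>x. x \<in> D \<Longrightarrow> alg_over F x"
  shows "subfield D CC"
proof (rule subfield_CC_I)
  fix x assume x: "x \<in> D"
  have inv: "inverse x \<in> D" if "P \<noteq> 0" "coeffs_in F P" "poly P x = 0" "x \<noteq> 0" for P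
    using that
  proof (induction P)
    case (pCons a P)
    show ?case
    proof (cases "a = 0")
      case True then show ?thesis using pCons by auto
    next
      case False
      have "poly Q x \<in> D" if "coeffs_in F Q" for Q
        using that subfield_CC_D[OF F(1)] F(2) D(2,3) x by (induction Q) auto
      then have 1: "poly P x \<in> D" using pCons by auto
      have "a = - (x * poly P x)" using pCons.prems by (simp add: eq_neg_iff_add_eq_0)
      then have "inverse x = (- inverse a) * poly P x" using False pCons.prems by (simp add: field_simps)
      moreover have "- inverse a \<in> D" using pCons.prems F subfield_CC_D[OF F(1)] by auto
      ultimately show ?thesis using 1 D(3) by metis
    qed
  qed auto
  show "inverse x \<in> D"
    using alg[OF x] inv x by (cases "x = 0") (auto simp: alg_over_def)
qed (use D in auto)

text \<open>Zorn's lemma yields a maximal graph inside \<open>E\<close>. If its domain missed some x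
  in \<open>E\<close>, the image of the minimal polynomial of x would have a root in the
  algebraically closed field of complex numbers, and \<open>ring_graph_step\<close> would enlarge
  the graph.\<close>

lemma extend_ring_graph:
  assumes F: "subfield F CC" and E: "subfield E CC" "\<And>x. x \<in> E \<Longrightarrow> alg_over F x"
    and G: "ring_graph G" "F \<subseteq> fst ` G" "fst ` G \<subseteq> E"
  shows "\<exists>\<tau>. field_emb E \<tau> \<and> (\<forall>a b. (a, b) \<in> G \<longrightarrow> \<tau> a = b)"
proof -
  define A where "A = {H. ring_graph H \<and> G \<subseteq> H \<and> fst ` H \<subseteq> E}"
  have "\<exists>M\<in>A. \<forall>Z1\<in>A. M \<subseteq> Z1 \<longrightarrow> Z1 = M"
  proof (rule subset_Zorn_nonempty)
    show "A \<noteq> {}" using G by (auto simp: A_def)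
    fix C assume C: "C \<noteq> {}" "subset.chain A C"
    then have CA: "C \<subseteq> A" and ch: "\<And>Z1 Z2. Z1 \<in> C \<Longrightarrow> Z2 \<in> C \<Longrightarrow> Z1 \<subseteq> Z2 \<or> Z2 \<subseteq> Z1"
      by (auto simp: subset_chain_def)
    have rg: "ring_graph Z1" if "Z1 \<in> C" for Z1 using CA that by (auto simp: A_def)
    have "(a + c, b + d) \<in> \<Union>C \<and> (a * c, b * d) \<in> \<Union>C" if that_: "(a, b) \<in> \<Union>C" "(c, d) \<in> \<Union>C" for a b c d
    proof -
      obtain Z1 Z2 where ZZ: "Z1 \<in> C" "(a, b) \<in> Z1" "Z2 \<in> C" "(c, d) \<in> Z2" using that_ by auto
      then obtain Z where Z: "Z \<in> C" "(a, b) \<in> Z" "(c, d) \<in> Z" using ch[of Z1 Z2] by blast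
      then have "(a + c, b + d) \<in> Z \<and> (a * c, b * d) \<in> Z" using rg[OF Z(1)] unfolding ring_graph_def by blast
      then show ?thesis using Z by blast
    qed
    moreover have "(1, 1) \<in> \<Union>C" using C(1) rg by (auto simp: ring_graph_def)
    moreover have "(- a, - b) \<in> \<Union>C" if "(a, b) \<in> \<Union>C" for a b using that rg unfolding ring_graph_def by blast
    moreover have "b = 0" if "(0, b) \<in> \<Union>C" for b using that rg unfolding ring_graph_def by blast
    ultimately have "ring_graph (\<Union>C)" unfolding ring_graph_def by blast
    moreover have "G \<subseteq> \<Union>C" "fst ` \<Union>C \<subseteq> E" using C(1) CA by (auto simp: A_def)
    ultimately show "\<Union>C \<in> A" by (auto simp: A_def)
  qed
  then obtain M where M: "ring_graph M" "G \<subseteq> M" "fst ` M \<subseteq> E" and max: "\<And>Z1. Z1 \<in> A \<Longrightarrow> M \<subseteq> Z1 \<Longrightarrow> Z1 = M"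
    by (auto simp: A_def)
  obtain \<tau> where \<tau>: "field_emb (fst ` M) \<tau>" "\<And>a b. (a, b) \<in> M \<Longrightarrow> \<tau> a = b" using ring_graph_emb[OF M(1)] by blast
  have FM: "F \<subseteq> fst ` M" using G(2) image_mono[OF M(2), of fst] by (rule order_trans)
  have D: "subfield (fst ` M) CC"
  proof (rule subring_algebraic_subfield[OF F FM])
    have mem: "a \<in> fst ` M \<longleftrightarrow> (\<exists>b. (a, b) \<in> M)" for a by force
    show "1 \<in> fst ` M" using M unfolding ring_graph_def mem by blast
    show "x + y \<in> fst ` M" if "x \<in> fst ` M" "y \<in> fst ` M" for x y
      using that M(1) unfolding ring_graph_def mem by blast
    show "x * y \<in> fst ` M" if "x \<in> fst ` M" "y \<in> fst ` M" for x y
      using that M(1) unfolding ring_graph_def mem by blast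
    show "- x \<in> fst ` M" if "x \<in> fst ` M" for x
      using that M(1) unfolding ring_graph_def mem by blast
    show "alg_over F x" if "x \<in> fst ` M" for x using that E(2) M by auto
  qed
  have "E \<subseteq> fst ` M"
  proof
    fix x assume x: "x \<in> E"
    have "alg_over (fst ` M) x" by (rule alg_over_mono[OF FM E(2)[OF x]])
    then obtain m where m: "minpoly (fst ` M) x m" using minpoly_exists[OF D] by blast
    have inj: "inj_on \<tau> (fst ` M)" and z: "\<tau> 0 = 0" using field_emb_D[OF D \<tau>(1)] by auto
    have "Polynomial.degree (map_poly \<tau> m) = Polynomial.degree m"
    proof (rule map_poly_degree_eq)
      have "Polynomial.lead_coeff m \<in> fst ` M" "0 \<in> fst ` M" "Polynomial.lead_coeff m \<noteq> 0"
        using m subfield_CC_D(2)[OF D] unfolding minpoly_def coeffs_in_def by auto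
      then show "\<tau> (Polynomial.lead_coeff m) \<noteq> 0" using inj_onD[OF inj] z by metis
    qed
    then have "Polynomial.degree (map_poly \<tau> m) > 0" using minpoly_degree_pos[OF m] by simp
    then obtain y where "poly (map_poly \<tau> m) y = 0"
      using fundamental_theorem_of_algebra[of "map_poly \<tau> m"] by (metis constant_degree less_irrefl)
    then obtain G' where G': "ring_graph G'" "\<forall>a\<in>fst ` M. (a, \<tau> a) \<in> G'" "(x, y) \<in> G'" "fst ` G' \<subseteq> E"
      using ring_graph_step[OF D \<tau>(1) m _ E(1) M(3) x] by metis
    have "M \<subseteq> G'" using G'(2) \<tau>(2) by force
    then have "G' = M" using max[of G'] G' M by (auto simp: A_def)
    then show "x \<in> fst ` M" using G'(3) by force
  qed
  then have "fst ` M = E" using M by auto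
  then show ?thesis using \<tau> M by auto
qed

lemma extend_emb:
  assumes F: "subfield F CC" and s: "field_emb F \<sigma>" and E: "subfield E CC" "F \<subseteq> E" "\<And>x. x \<in> E \<Longrightarrow> alg_over F x"
  shows "\<exists>\<tau>. field_emb E \<tau> \<and> (\<forall>a\<in>F. \<tau> a = \<sigma> a)"
proof -
  define G where "G = (\<lambda>a. (a, \<sigma> a)) ` F"
  have fG: "fst ` G = F" by (force simp: G_def)
  have "ring_graph G" unfolding ring_graph_def G_def
    using subfield_CC_D[OF F] field_emb_D[OF F s] by (auto simp: image_iff)
  then show ?thesis using extend_ring_graph[OF F E(1,3), of G] fG E(2) by (auto simp: G_def)
qed

text \<open>The element x is sent to another root of its minimal polynomial m = (T - x) q. The
  factor q is not constant because x is not in \<open>F\<close>, and q(x) = m'(x) is nonzero because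
  m' is nonzero of smaller degree than m, so that m cannot divide it. Hence a root of q differs from
  x.\<close>

lemma exists_moving_emb:
  assumes F: "subfield F CC" and E: "subfield E CC" "F \<subseteq> E" "\<And>x. x \<in> E \<Longrightarrow> alg_over F x" and x: "x \<in> E" "x \<notin> F"
  shows "\<exists>\<tau>. field_emb E \<tau> \<and> (\<forall>a\<in>F. \<tau> a = a) \<and> \<tau> x \<noteq> x"
proof -
  obtain m where m: "minpoly F x m" using minpoly_exists[OF F] E x by blast
  note D = subfield_CC_D[OF F]
  have id: "field_emb F (\<lambda>x. x)" by (auto simp: field_emb_def)
  have mz: "m \<noteq> 0" "coeffs_in F m" "poly m x = 0" using m by (auto simp: minpoly_def)
  obtain q where q: "m = [:- x, 1:] * q" using mz by (auto simp: poly_eq_0_iff_dvd)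
  have q0: "q \<noteq> 0" using q mz by auto
  have "Polynomial.degree q > 0"
  proof (rule ccontr)
    assume "\<not> ?thesis"
    then obtain c where c: "q = [:c:]" by (metis degree_eq_zeroE neq0_conv)
    then have "c \<in> F" "- (c * x) \<in> F" "c \<noteq> 0" using mz q q0 by (auto simp: mult.commute)
    then have "c * x \<in> F" using D(5)[of "- (c * x)"] by simp
    then have "c * x / c \<in> F" using \<open>c \<in> F\<close> by (rule D(8))
    then show False using \<open>c \<noteq> 0\<close> x by auto
  qed
  then obtain y where qy: "poly q y = 0"
    using fundamental_theorem_of_algebra[of q] by (metis constant_degree less_irrefl)
  have "poly (pderiv m) x \<noteq> 0"
  proof
    assume "poly (pderiv m) x = 0"
    moreover have "coeffs_in F (pderiv m)" 
      unfolding coeffs_in_def coeff_pderiv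
    proof (intro allI D(4))
      show "of_nat (Suc n) \<in> F" for n using Rats_subset_subfield[OF F] Rats_of_nat by (rule subsetD)
      show "Polynomial.coeff m (Suc n) \<in> F" for n using mz(2) by (simp add: coeffs_in_def)
    qed
    ultimately obtain Q where Q: "pderiv m = m * Q" using m by (auto simp: minpoly_def)
    have "pderiv m \<noteq> 0" using minpoly_degree_pos[OF m] by (simp add: pderiv_eq_0_iff)
    then have "Polynomial.degree (pderiv m) \<ge> Polynomial.degree m" using Q by (auto simp: degree_mult_eq)
    then show False using minpoly_degree_pos[OF m] by (simp add: degree_pderiv)
  qed
  then have "poly q x \<noteq> 0" unfolding q pderiv_mult by (simp add: pderiv_pCons)
  then have "poly m y = 0 \<and> y \<noteq> x" using qy by (auto simp: q)
  then obtain y where y: "poly m y = 0" "y \<noteq> x" by blast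
  have "map_poly (\<lambda>x. x) m = m" by (simp add: poly_eq_iff coeff_map_poly)
  then obtain G where G: "ring_graph G" "\<forall>a\<in>F. (a, a) \<in> G" "(x, y) \<in> G" "fst ` G \<subseteq> E"
    using ring_graph_step[OF F id m _ E(1,2) x(1), of y] y by metis
  have "F \<subseteq> fst ` G" using G(2) by force
  then obtain \<tau> where "field_emb E \<tau>" "\<And>a b. (a, b) \<in> G \<Longrightarrow> \<tau> a = b" using extend_ring_graph[OF F E(1,3) G(1) _ G(4)] by blast
  then show ?thesis using G y by blast
qed

section \<open>Galois groups as groups of embeddings\<close>

lemma Gal_carrier_iff:
  assumes "subfield L CC"
  shows "\<sigma> \<in> carrier (Gal L k) \<longleftrightarrow>
    \<sigma> \<in> extensional L \<and> field_emb L \<sigma> \<and> \<sigma> ` L = L \<and> (\<forall>x\<in>k. \<sigma> x = x)"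
proof -
  have "inj_on \<sigma> L" if "field_emb L \<sigma>" using field_emb_D[OF assms that] by auto
  then show ?thesis
    unfolding Gal_def ring_iso_def ring_hom_def field_emb_def bij_betw_def by auto
qed

lemma Gal_D:
  assumes "subfield L CC" "\<sigma> \<in> carrier (Gal L k)"
  shows "field_emb L \<sigma>" "\<sigma> ` L = L" "\<And>x. x \<in> L \<Longrightarrow> \<sigma> x \<in> L" "\<And>x. x \<in> k \<Longrightarrow> \<sigma> x = x" "\<sigma> \<in> extensional L"
    "inj_on \<sigma> L"
  using assms(2) field_emb_D(8)[OF assms(1)] unfolding Gal_carrier_iff[OF assms(1)] by auto

lemma Gal_mult: "\<sigma> \<otimes>\<^bsub>Gal L k\<^esub> \<tau> = compose L \<sigma> \<tau>"
  and Gal_one: "\<one>\<^bsub>Gal L k\<^esub> = (\<lambda>x\<in>L. x)"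
  by (simp_all add: Gal_def)

lemma Gal_mult_apply: "x \<in> L \<Longrightarrow> (\<sigma> \<otimes>\<^bsub>Gal L k\<^esub> \<tau>) x = \<sigma> (\<tau> x)"
  by (simp add: Gal_mult compose_eq)

lemma field_emb_compose:
  assumes "field_emb L \<tau>" "\<tau> ` L \<subseteq> E" "field_emb E \<sigma>"
  shows "field_emb L (\<lambda>x. \<sigma> (\<tau> x))"
  using assms by (auto simp: field_emb_def image_subset_iff)

lemma field_emb_restrict:
  assumes "subfield L CC" shows "field_emb L (restrict \<sigma> L) \<longleftrightarrow> field_emb L \<sigma>"
  by (rule field_emb_cong[OF assms]) auto

lemma group_Gal:
  assumes L: "subfield L CC" and k: "k \<subseteq> L"
  shows "group (Gal L k)"
proof (rule groupI)
  note D = Gal_D[OF L]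
  show "\<one>\<^bsub>Gal L k\<^esub> \<in> carrier (Gal L k)"
    unfolding Gal_one Gal_carrier_iff[OF L] using k by (auto simp: field_emb_def subfield_CC_D[OF L])
  show m: "\<sigma> \<otimes>\<^bsub>Gal L k\<^esub> \<tau> \<in> carrier (Gal L k)" if st: "\<sigma> \<in> carrier (Gal L k)" "\<tau> \<in> carrier (Gal L k)" for \<sigma> \<tau>
  proof -
    have "field_emb L (compose L \<sigma> \<tau>)"
      using field_emb_compose[OF D(1)[OF st(2)] _ D(1)[OF st(1)]] D(2)[OF st(2)] field_emb_restrict[OF L]
      by (simp add: compose_def)
    moreover have "compose L \<sigma> \<tau> ` L = L"
    proof -
      have "compose L \<sigma> \<tau> ` L = \<sigma> ` (\<tau> ` L)" by (auto simp: compose_def image_iff)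
      then show ?thesis using D(2)[OF st(1)] D(2)[OF st(2)] by simp
    qed
    moreover have "compose L \<sigma> \<tau> x = x" if "x \<in> k" for x
      using D(4)[OF st(1) that] D(4)[OF st(2) that] that k by (auto simp: compose_def)
    ultimately show ?thesis unfolding Gal_carrier_iff[OF L] Gal_mult by (auto simp: compose_def)
  qed
  show "\<sigma> \<otimes>\<^bsub>Gal L k\<^esub> \<tau> \<otimes>\<^bsub>Gal L k\<^esub> \<rho> = \<sigma> \<otimes>\<^bsub>Gal L k\<^esub> (\<tau> \<otimes>\<^bsub>Gal L k\<^esub> \<rho>)"
    if "\<sigma> \<in> carrier (Gal L k)" "\<tau> \<in> carrier (Gal L k)" "\<rho> \<in> carrier (Gal L k)" for \<sigma> \<tau> \<rho>
    unfolding Gal_mult using D(3)[OF that(3)] by (auto simp: compose_def)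
  show "\<one>\<^bsub>Gal L k\<^esub> \<otimes>\<^bsub>Gal L k\<^esub> \<sigma> = \<sigma>" if "\<sigma> \<in> carrier (Gal L k)" for \<sigma>
    unfolding Gal_mult Gal_one using D(3,5)[OF that] by (auto simp: compose_def extensional_def)
  show "\<exists>\<tau>\<in>carrier (Gal L k). \<tau> \<otimes>\<^bsub>Gal L k\<^esub> \<sigma> = \<one>\<^bsub>Gal L k\<^esub>" if s: "\<sigma> \<in> carrier (Gal L k)" for \<sigma>
  proof -
    define \<tau> where "\<tau> = (\<lambda>x\<in>L. inv_into L \<sigma> x)"
    have ts: "\<tau> (\<sigma> x) = x" if "x \<in> L" for x using D(3,6)[OF s] that by (simp add: \<tau>_def)
    have st: "\<sigma> (\<tau> x) = x" "\<tau> x \<in> L" if "x \<in> L" for x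
      using D(2)[OF s] that by (auto simp: \<tau>_def f_inv_into_f inv_into_into)
    have "\<tau> (x + y) = \<tau> x + \<tau> y \<and> \<tau> (x * y) = \<tau> x * \<tau> y" if xy: "x \<in> L" "y \<in> L" for x y
    proof -
      have "\<sigma> (\<tau> x + \<tau> y) = x + y" "\<sigma> (\<tau> x * \<tau> y) = x * y"
        using field_emb_D(3,4)[OF L D(1)[OF s], of "\<tau> x" "\<tau> y"] st xy by auto
      then show ?thesis using ts[of "\<tau> x + \<tau> y"] ts[of "\<tau> x * \<tau> y"] subfield_CC_D[OF L] st xy by auto
    qed
    moreover have "\<tau> 1 = 1" using ts[of 1] subfield_CC_D[OF L] field_emb_D(1)[OF L D(1)[OF s]] by auto
    ultimately have "field_emb L \<tau>" by (auto simp: field_emb_def)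
    moreover have "\<tau> ` L = L" using ts st D(3)[OF s] by (auto simp: image_iff) metis
    moreover have "\<forall>x\<in>k. \<tau> x = x" using ts D(4)[OF s] k by (metis subsetD)
    ultimately have "\<tau> \<in> carrier (Gal L k)" unfolding Gal_carrier_iff[OF L] by (auto simp: \<tau>_def)
    moreover have "\<tau> \<otimes>\<^bsub>Gal L k\<^esub> \<sigma> = \<one>\<^bsub>Gal L k\<^esub>" unfolding Gal_mult Gal_one using ts by (auto simp: compose_def)
    ultimately show ?thesis by blast
  qed
qed

lemma Gal_inv:
  assumes L: "subfield L CC" "k \<subseteq> L" and s: "\<sigma> \<in> carrier (Gal L k)"
  shows "x \<in> L \<Longrightarrow> (inv\<^bsub>Gal L k\<^esub> \<sigma>) (\<sigma> x) = x" "x \<in> L \<Longrightarrow> \<sigma> ((inv\<^bsub>Gal L k\<^esub> \<sigma>) x) = x"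
proof -
  interpret group "Gal L k" by (rule group_Gal[OF L])
  have "(inv\<^bsub>Gal L k\<^esub> \<sigma> \<otimes>\<^bsub>Gal L k\<^esub> \<sigma>) x = x" "(\<sigma> \<otimes>\<^bsub>Gal L k\<^esub> inv\<^bsub>Gal L k\<^esub> \<sigma>) x = x" if "x \<in> L"
    using that s by (simp_all add: Gal_one)
  then show "x \<in> L \<Longrightarrow> (inv\<^bsub>Gal L k\<^esub> \<sigma>) (\<sigma> x) = x" "x \<in> L \<Longrightarrow> \<sigma> ((inv\<^bsub>Gal L k\<^esub> \<sigma>) x) = x"
    by (simp_all add: Gal_mult_apply)
qed

lemma Gal_mono: 
  assumes "subfield L CC" "k \<subseteq> F" shows "carrier (Gal L F) \<subseteq> carrier (Gal L k)"
  using assms(2) unfolding Gal_carrier_iff[OF assms(1)] subset_iff by blast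

lemma subgroup_Gal:
  assumes L: "subfield L CC" and "k \<subseteq> F" "F \<subseteq> L"
  shows "subgroup (carrier (Gal L F)) (Gal L k)"
proof -
  interpret G: group "Gal L k" using group_Gal[OF L] assms by auto
  interpret H: group "Gal L F" using group_Gal[OF L] assms by auto
  show ?thesis
  proof (rule G.subgroupI)
    show "carrier (Gal L F) \<subseteq> carrier (Gal L k)" by (rule Gal_mono[OF L assms(2)])
    show "carrier (Gal L F) \<noteq> {}" using H.one_closed by blast
    show "a \<otimes>\<^bsub>Gal L k\<^esub> b \<in> carrier (Gal L F)" if "a \<in> carrier (Gal L F)" "b \<in> carrier (Gal L F)" for a b
      using H.m_closed[OF that] by (simp add: Gal_mult)
    show "inv\<^bsub>Gal L k\<^esub> a \<in> carrier (Gal L F)" if a: "a \<in> carrier (Gal L F)" for a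
    proof -
      have "inv\<^bsub>Gal L k\<^esub> a = inv\<^bsub>Gal L F\<^esub> a"
      proof (rule G.inv_equality)
        show "inv\<^bsub>Gal L F\<^esub> a \<otimes>\<^bsub>Gal L k\<^esub> a = \<one>\<^bsub>Gal L k\<^esub>" using H.l_inv[OF a] by (simp add: Gal_mult Gal_one)
      qed (use a Gal_mono[OF L assms(2)] H.inv_closed in blast)+
      then show ?thesis using H.inv_closed[OF a] by simp
    qed
  qed
qed

section \<open>Orbits and density\<close>

lemma coeffs_in_prod:
  assumes "subfield F CC" "\<And>i. i \<in> A \<Longrightarrow> coeffs_in F (f i)"
  shows "coeffs_in F (prod f A)"
  using assms(2) by (induction A rule: infinite_finite_induct) (auto simp: coeffs_in_1[OF assms(1)] coeffs_in_mult[OF assms(1)])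

lemma map_poly_emb_prod:
  assumes F: "subfield F CC" and s: "field_emb F \<sigma>" and "\<And>i. i \<in> A \<Longrightarrow> coeffs_in F (f i)"
  shows "map_poly \<sigma> (prod f A) = (\<Prod>i\<in>A. map_poly \<sigma> (f i))"
  using assms(3) by (induction A rule: infinite_finite_induct)
    (auto simp: map_poly_emb_1[OF s F] map_poly_emb(2)[OF F s] coeffs_in_prod[OF F])

lemma finite_conjugates:
  assumes "alg_over k x" "k \<subseteq> F" "subfield k CC" "subfield F CC" "x \<in> F"
  shows "finite {\<sigma> x | \<sigma>. field_emb F \<sigma> \<and> (\<forall>a\<in>k. \<sigma> a = a)}"
proof -
  obtain P where P: "P \<noteq> 0" "coeffs_in k P" "poly P x = 0" using assms by (auto simp: alg_over_def)
  have "poly P (\<sigma> x) = 0" if "field_emb F \<sigma>" "\<forall>a\<in>k. \<sigma> a = a" for \<sigma>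
    using field_emb_root[OF assms(4) that(1) P(2) assms(2) _ _ assms(5) P(3)] that(2) subfield_CC_D[OF assms(3)] by blast
  then have "{\<sigma> x | \<sigma>. field_emb F \<sigma> \<and> (\<forall>a\<in>k. \<sigma> a = a)} \<subseteq> {y. poly P y = 0}" by blast
  then show ?thesis using poly_roots_finite[OF P(1)] finite_subset by blast
qed

text \<open>Artin's argument: the product of T - y over the orbit of x under \<open>R\<close> is
  invariant under \<open>R\<close>, so its coefficients lie in \<open>k\<close>, and \<tau>(x) is
  again one of its roots. \<open>R\<close> is any family closed under composition, which allows
  Galois groups of larger fields to act on \<open>L\<close> without being restricted.\<close>

lemma emb_orbit:
  assumes k: "subfield k CC" and L: "subfield L CC" "k \<subseteq> L" and x: "x \<in> L" "alg_over k x"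
    and R: "\<And>\<sigma>. \<sigma> \<in> R \<Longrightarrow> field_emb L \<sigma> \<and> \<sigma> ` L \<subseteq> L \<and> (\<forall>a\<in>k. \<sigma> a = a)"
    and R1: "\<exists>\<sigma>\<in>R. \<sigma> x = x" and Rm: "\<And>\<sigma> \<tau>. \<sigma> \<in> R \<Longrightarrow> \<tau> \<in> R \<Longrightarrow> \<exists>\<rho>\<in>R. \<rho> x = \<sigma> (\<tau> x)"
    and fixd: "\<And>y. y \<in> L \<Longrightarrow> (\<And>\<sigma>. \<sigma> \<in> R \<Longrightarrow> \<sigma> y = y) \<Longrightarrow> y \<in> k"
    and t: "field_emb L \<tau>" "\<And>a. a \<in> k \<Longrightarrow> \<tau> a = a"
  shows "\<exists>\<sigma>\<in>R. \<sigma> x = \<tau> x"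
proof -
  define Orb where "Orb = (\<lambda>\<sigma>. \<sigma> x) ` R"
  have fin: "finite Orb"
    by (rule finite_subset[OF _ finite_conjugates[OF x(2) L(2) k L(1) x(1)]]) (use R in \<open>auto simp: Orb_def\<close>)
  have OL: "Orb \<subseteq> L" using R x by (auto simp: Orb_def)
  define P where "P = (\<Prod>y\<in>Orb. [:- y, 1:])"
  have lin: "coeffs_in L [:- y, 1:]" if "y \<in> Orb" for y
    using that OL subfield_CC_D[OF L(1)] coeffs_in_0[OF L(1)] by auto
  have PL: "coeffs_in L P" unfolding P_def by (rule coeffs_in_prod[OF L(1) lin])
  have "map_poly \<sigma> P = P" if s: "\<sigma> \<in> R" for \<sigma>
  proof -
    have e: "field_emb L \<sigma>" using R[OF s] by auto
    have inj: "inj_on \<sigma> Orb" using field_emb_D(8)[OF L(1) e] OL by (rule inj_on_subset)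
    have "\<sigma> ` Orb \<subseteq> Orb"
    proof
      fix z assume "z \<in> \<sigma> ` Orb"
      then obtain \<rho> where "\<rho> \<in> R" "z = \<sigma> (\<rho> x)" by (auto simp: Orb_def)
      then show "z \<in> Orb" using Rm[OF s, of \<rho>] unfolding Orb_def by (metis imageI)
    qed
    then have im: "\<sigma> ` Orb = Orb" using endo_inj_surj[OF fin _ inj] by blast
    have "map_poly \<sigma> P = (\<Prod>y\<in>Orb. map_poly \<sigma> [:- y, 1:])" unfolding P_def
      by (rule map_poly_emb_prod[OF L(1) e lin])
    also have "\<dots> = (\<Prod>y\<in>Orb. [:- \<sigma> y, 1:])"
    proof (rule prod.cong[OF refl])
      fix y assume "y \<in> Orb"
      then show "map_poly \<sigma> [:- y, 1:] = [:- \<sigma> y, 1:]"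
        using OL field_emb_D[OF L(1) e] by (auto simp: poly_eq_iff coeff_map_poly coeff_pCons split: nat.splits)
    qed
    also have "\<dots> = (\<Prod>y\<in>\<sigma> ` Orb. [:- y, 1:])" by (subst prod.reindex[OF inj]) simp
    finally show ?thesis using im by (simp add: P_def)
  qed
  note inv = this
  have Pk: "coeffs_in k P" unfolding coeffs_in_def
  proof
    fix i show "Polynomial.coeff P i \<in> k"
    proof (rule fixd)
      show "Polynomial.coeff P i \<in> L" using PL by (auto simp: coeffs_in_def)
      fix \<sigma> assume s: "\<sigma> \<in> R"
      then have "\<sigma> 0 = 0" using R[OF s] field_emb_D(2)[OF L(1)] by auto
      then have "Polynomial.coeff (map_poly \<sigma> P) i = \<sigma> (Polynomial.coeff P i)" by (simp add: coeff_map_poly)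
      then show "\<sigma> (Polynomial.coeff P i) = Polynomial.coeff P i" using inv[OF s] by simp
    qed
  qed
  have "x \<in> Orb" using R1 unfolding Orb_def by (metis imageI)
  then have "poly P x = 0" using fin by (auto simp: P_def poly_prod)
  then have "poly P (\<tau> x) = 0"
    using field_emb_root[OF L(1) t(1) Pk L(2)] t(2) subfield_CC_D[OF k] x(1) by blast
  then have "\<tau> x \<in> Orb" using fin by (auto simp: P_def poly_prod)
  then show ?thesis by (auto simp: Orb_def)
qed

text \<open>For each element of \<open>L\<close>, an injective self-map over \<open>k\<close>
  permutes the finitely many roots in \<open>L\<close> of an equation of that element.\<close>

lemma emb_image_eq:
  assumes k: "subfield k CC" and L: "subfield L CC" "k \<subseteq> L" "\<And>x. x \<in> L \<Longrightarrow> alg_over k x"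
    and t: "field_emb L \<tau>" "\<And>a. a \<in> k \<Longrightarrow> \<tau> a = a" "\<tau> ` L \<subseteq> L"
  shows "\<tau> ` L = L"
proof
  show "L \<subseteq> \<tau> ` L"
  proof
    fix x assume x: "x \<in> L"
    obtain P where P: "P \<noteq> 0" "coeffs_in k P" "poly P x = 0" using L(3)[OF x] by (auto simp: alg_over_def)
    define Z where "Z = {y \<in> L. poly P y = 0}"
    have fin: "finite Z" unfolding Z_def by (rule finite_subset[OF _ poly_roots_finite[OF P(1)]]) auto
    have "\<tau> ` Z \<subseteq> Z" using field_emb_root[OF L(1) t(1) P(2) L(2)] t subfield_CC_D[OF k] by (auto simp: Z_def)
    moreover have "inj_on \<tau> Z" using field_emb_D(8)[OF L(1) t(1)] by (rule inj_on_subset) (auto simp: Z_def)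
    ultimately have "\<tau> ` Z = Z" using endo_inj_surj[OF fin] by blast
    then show "x \<in> \<tau> ` L" using x P by (auto simp: Z_def)
  qed
qed (rule t(3))

text \<open>The primitive element argument, relative to one fixed embedding \<tau>: the old element
  \<theta> and a new x are merged into x + c \<theta>, where c is a natural number outside a finite
  set of bad values.\<close>

lemma separating_element:
  assumes k: "subfield k CC" and L: "subfield L CC" "k \<subseteq> L" "\<And>x. x \<in> L \<Longrightarrow> alg_over k x"
    and S: "finite S" "S \<subseteq> L" and t: "field_emb L \<tau>" "\<And>a. a \<in> k \<Longrightarrow> \<tau> a = a"
  shows "\<exists>\<theta>\<in>L. \<forall>\<sigma>. field_emb L \<sigma> \<longrightarrow> (\<forall>a\<in>k. \<sigma> a = a) \<longrightarrow> \<sigma> \<theta> = \<tau> \<theta> \<longrightarrow> (\<forall>s\<in>S. \<sigma> s = \<tau> s)"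
  using S
proof (induction S)
  case empty then show ?case using subfield_CC_D[OF L(1)] by auto
next
  case (insert x S)
  then obtain \<theta> where th: "\<theta> \<in> L"
    "\<And>\<sigma>. field_emb L \<sigma> \<Longrightarrow> \<forall>a\<in>k. \<sigma> a = a \<Longrightarrow> \<sigma> \<theta> = \<tau> \<theta> \<Longrightarrow> \<forall>s\<in>S. \<sigma> s = \<tau> s" by auto
  have x: "x \<in> L" using insert by auto
  define C where "C y = {\<sigma> y | \<sigma>. field_emb L \<sigma> \<and> (\<forall>a\<in>k. \<sigma> a = a)}" for y
  have fin: "finite (C y)" if "y \<in> L" for y unfolding C_def
    by (rule finite_conjugates[OF L(3)[OF that] L(2) k L(1) that])
  \<comment> \<open>The values of c for which an embedding may agree with \<tau> at x + c \<theta>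
    although it differs from \<tau> at \<theta>. For \<open>b = \<tau> \<theta>\<close> the quotient
    is 0 by convention, which only enlarges \<open>B\<close>.\<close>
  define B where "B = (\<lambda>(a, b). (a - \<tau> x) / (\<tau> \<theta> - b)) ` (C x \<times> C \<theta>)"
  have "finite B" unfolding B_def using fin x th by auto
  moreover have "infinite (range (of_nat :: nat \<Rightarrow> complex))"
    by (rule range_inj_infinite) (rule inj_of_nat)
  ultimately have "\<not> range (of_nat :: nat \<Rightarrow> complex) \<subseteq> B" using finite_subset by blast
  then obtain c :: nat where c: "of_nat c \<notin> B" by auto
  have cL: "of_nat c \<in> L" using Rats_subset_subfield[OF L(1)] Rats_of_nat by (rule subsetD)
  define \<eta> where "\<eta> = x + of_nat c * \<theta>"
  have fc: "\<sigma> (of_nat n) = of_nat n" if "field_emb L \<sigma>" for \<sigma> n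
  proof (induction n)
    case 0 then show ?case using field_emb_D(2)[OF L(1) that] by simp
  next
    case (Suc n)
    have "of_nat n \<in> L" using Rats_subset_subfield[OF L(1)] Rats_of_nat by (rule subsetD)
    then show ?case using field_emb_D(1,3)[OF L(1) that] Suc subfield_CC_D[OF L(1)] by auto
  qed
  have fe: "\<sigma> \<eta> = \<sigma> x + of_nat c * \<sigma> \<theta>" if "field_emb L \<sigma>" for \<sigma>
    using field_emb_D[OF L(1) that] subfield_CC_D[OF L(1)] x th(1) cL fc[OF that] by (simp add: \<eta>_def)
  have "\<forall>s\<in>insert x S. \<sigma> s = \<tau> s" if s: "field_emb L \<sigma>" "\<forall>a\<in>k. \<sigma> a = a" "\<sigma> \<eta> = \<tau> \<eta>" for \<sigma>
  proof -
    have eq: "\<sigma> x + of_nat c * \<sigma> \<theta> = \<tau> x + of_nat c * \<tau> \<theta>" using s(3) fe[OF s(1)] fe[OF t(1)] by simp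
    have th_eq: "\<sigma> \<theta> = \<tau> \<theta>"
    proof (rule ccontr)
      assume ne: "\<sigma> \<theta> \<noteq> \<tau> \<theta>"
      have "of_nat c * (\<tau> \<theta> - \<sigma> \<theta>) = \<sigma> x - \<tau> x" using eq by (simp add: algebra_simps)
      then have "of_nat c = (\<sigma> x - \<tau> x) / (\<tau> \<theta> - \<sigma> \<theta>)" using ne by (simp add: field_simps)
      moreover have "\<sigma> x \<in> C x" "\<sigma> \<theta> \<in> C \<theta>" using s by (auto simp: C_def)
      ultimately have "of_nat c \<in> B" by (auto simp: B_def)
      then show False using c by simp
    qed
    then show ?thesis using th(2)[OF s(1,2)] eq by auto
  qed
  moreover have "\<eta> \<in> L" unfolding \<eta>_def using subfield_CC_D[OF L(1)] x th cL by auto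
  ultimately show ?case by blast
qed

text \<open>A separating element of \<open>S\<close> reduces agreement on \<open>S\<close> to agreement at one point, where the orbit
  polynomial applies.\<close>

lemma emb_density:
  assumes k: "subfield k CC" and L: "subfield L CC" "k \<subseteq> L" "\<And>x. x \<in> L \<Longrightarrow> alg_over k x"
    and R: "\<And>\<sigma>. \<sigma> \<in> R \<Longrightarrow> field_emb L \<sigma> \<and> \<sigma> ` L \<subseteq> L \<and> (\<forall>a\<in>k. \<sigma> a = a)"
    and R1: "\<exists>\<sigma>\<in>R. \<forall>x\<in>L. \<sigma> x = x"
    and Rm: "\<And>\<sigma> \<tau>. \<sigma> \<in> R \<Longrightarrow> \<tau> \<in> R \<Longrightarrow> \<exists>\<rho>\<in>R. \<forall>x\<in>L. \<rho> x = \<sigma> (\<tau> x)"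
    and fixd: "\<And>y. y \<in> L \<Longrightarrow> (\<And>\<sigma>. \<sigma> \<in> R \<Longrightarrow> \<sigma> y = y) \<Longrightarrow> y \<in> k"
    and t: "field_emb L \<tau>" "\<And>a. a \<in> k \<Longrightarrow> \<tau> a = a" and S: "finite S" "S \<subseteq> L"
  shows "\<exists>\<sigma>\<in>R. \<forall>s\<in>S. \<sigma> s = \<tau> s"
proof -
  obtain \<theta> where th: "\<theta> \<in> L" "\<And>\<sigma>. field_emb L \<sigma> \<Longrightarrow> \<forall>a\<in>k. \<sigma> a = a \<Longrightarrow> \<sigma> \<theta> = \<tau> \<theta> \<Longrightarrow> \<forall>s\<in>S. \<sigma> s = \<tau> s"
    using separating_element[OF k L S t] by blast
  have "\<exists>\<sigma>\<in>R. \<sigma> \<theta> = \<tau> \<theta>"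
    by (rule emb_orbit[OF k L(1,2) th(1) L(3)[OF th(1)] R _ _ fixd t]) (use R1 Rm th(1) in blast)+
  then show ?thesis using th R by blast
qed

section \<open>Normal extensions\<close>

text \<open>Normality is expressed by embeddings instead of polynomials, because in this form it can
  be checked on the generators of a composite field.\<close>

definition normal_over :: "complex set \<Rightarrow> complex set \<Rightarrow> bool" where
  "normal_over k L \<longleftrightarrow> (\<forall>\<sigma>. field_emb L \<sigma> \<longrightarrow> (\<forall>a\<in>k. \<sigma> a = a) \<longrightarrow> \<sigma> ` L = L)"

lemma normal_overD: "normal_over k L \<Longrightarrow> field_emb L \<sigma> \<Longrightarrow> (\<And>a. a \<in> k \<Longrightarrow> \<sigma> a = a) \<Longrightarrow> \<sigma> ` L = L"
  by (auto simp: normal_over_def)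

lemma normal_over_mono: "normal_over k L \<Longrightarrow> k \<subseteq> F \<Longrightarrow> normal_over F L"
  by (auto simp: normal_over_def)

lemma galois_extension_D:
  assumes "galois_extension k L"
  shows "subfield k CC" "subfield L CC" "k \<subseteq> L" "\<And>x. x \<in> L \<Longrightarrow> alg_over k x"
    "\<And>x. x \<in> L \<Longrightarrow> (\<And>\<sigma>. \<sigma> \<in> carrier (Gal L k) \<Longrightarrow> \<sigma> x = x) \<Longrightarrow> x \<in> k"
  using assms algebraic_CC_iff[of k] unfolding galois_extension_def alg_over_def by auto

text \<open>By the orbit argument, any embedding over \<open>k\<close> agrees at a given x with some
  element of the Galois group, so its values stay in \<open>L\<close>.\<close>

lemma galois_normal_over:
  assumes "galois_extension k L"
  shows "normal_over k L"
  unfolding normal_over_def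
proof (intro allI impI)
  note G = galois_extension_D[OF assms]
  interpret group "Gal L k" by (rule group_Gal[OF G(2,3)])
  fix \<tau> assume t: "field_emb L \<tau>" "\<forall>a\<in>k. \<tau> a = a"
  have "\<tau> x \<in> L" if x: "x \<in> L" for x
  proof -
    have "\<exists>\<sigma>\<in>carrier (Gal L k). \<sigma> x = \<tau> x"
    proof (rule emb_orbit[OF G(1,2,3) x G(4)[OF x]])
      show "field_emb L \<sigma> \<and> \<sigma> ` L \<subseteq> L \<and> (\<forall>a\<in>k. \<sigma> a = a)" if "\<sigma> \<in> carrier (Gal L k)" for \<sigma>
        using Gal_D[OF G(2) that] by auto
      show "\<exists>\<sigma>\<in>carrier (Gal L k). \<sigma> x = x" using x by (intro bexI[OF _ one_closed]) (simp add: Gal_one)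
      show "\<exists>\<rho>\<in>carrier (Gal L k). \<rho> x = \<sigma> (\<tau> x)" if "\<sigma> \<in> carrier (Gal L k)" "\<tau> \<in> carrier (Gal L k)" for \<sigma> \<tau>
        using x by (intro bexI[OF _ m_closed[OF that]]) (simp add: Gal_mult_apply)
    qed (use G(5) t in auto)
    then show ?thesis using Gal_D(3)[OF G(2) _ x] by metis
  qed
  then show "\<tau> ` L = L" using emb_image_eq[OF G(1-4) t(1)] t(2) by blast
qed

lemma restrict_Gal:
  assumes "subfield L CC" "normal_over k L" "L \<subseteq> E" "k \<subseteq> L" "field_emb E \<sigma>" "\<And>a. a \<in> k \<Longrightarrow> \<sigma> a = a"
  shows "restrict \<sigma> L \<in> carrier (Gal L k)"
proof -
  have e: "field_emb L \<sigma>" using field_emb_subset assms by blast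
  then have "field_emb L (restrict \<sigma> L)" using field_emb_restrict[OF assms(1)] by simp
  then show ?thesis using normal_overD[OF assms(2) e] assms by (auto simp: Gal_carrier_iff)
qed

text \<open>An automorphism extends to an embedding of \<open>E\<close>, which normality turns into
  an automorphism of \<open>E\<close>.\<close>

lemma lift_Gal:
  assumes k: "subfield k CC" "k \<subseteq> L" and L: "subfield L CC" "L \<subseteq> E"
    and E: "subfield E CC" "normal_over k E" "\<And>x. x \<in> E \<Longrightarrow> alg_over k x" and s: "\<sigma> \<in> carrier (Gal L k)"
  shows "\<exists>\<tau>\<in>carrier (Gal E k). \<forall>x\<in>L. \<tau> x = \<sigma> x"
proof -
  obtain \<tau> where t: "field_emb E \<tau>" "\<forall>a\<in>L. \<tau> a = \<sigma> a"
    using extend_emb[OF L(1) Gal_D(1)[OF L(1) s] E(1) L(2) alg_over_mono[OF k(2) E(3)]] by blast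
  have "restrict \<tau> E \<in> carrier (Gal E k)"
    using k(2) L(2) t(2) Gal_D(4)[OF L(1) s] by (intro restrict_Gal[OF E(1,2) subset_refl _ t(1)]) (auto simp: subset_iff)
  then show ?thesis using t L(2) by (intro bexI[of _ "restrict \<tau> E"]) auto
qed

text \<open>The half of the Galois correspondence used below: an embedding that moves x exists as
  soon as x is outside \<open>F\<close>, and normality makes it an element of
  \<open>Gal L F\<close>.\<close>

lemma fixed_imp_base:
  assumes F: "subfield F CC" "F \<subseteq> L" and L: "subfield L CC" "normal_over F L" "\<And>x. x \<in> L \<Longrightarrow> alg_over F x"
    and x: "x \<in> L" "\<And>\<sigma>. \<sigma> \<in> carrier (Gal L F) \<Longrightarrow> \<sigma> x = x"
  shows "x \<in> F"
proof (rule ccontr)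
  assume "x \<notin> F"
  then obtain \<tau> where t: "field_emb L \<tau>" "\<forall>a\<in>F. \<tau> a = a" "\<tau> x \<noteq> x"
    using exists_moving_emb[OF F(1) L(1) F(2) L(3) x(1)] by blast
  have "restrict \<tau> L \<in> carrier (Gal L F)" by (rule restrict_Gal[OF L(1,2) subset_refl F(2) t(1)]) (use t in auto)
  then show False using x t(3) by fastforce
qed

lemma emb_eq_on_generate_field:
  assumes "field_emb (generate_field CC A) \<sigma>" "field_emb (generate_field CC A) \<tau>"
    "\<And>a. a \<in> A \<Longrightarrow> \<sigma> a = \<tau> a" and x: "x \<in> generate_field CC A"
  shows "\<sigma> x = \<tau> x"
proof -
  note S = field_emb_D[OF subfield_generate_field assms(1)] and T = field_emb_D[OF subfield_generate_field assms(2)]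
  show ?thesis using x
    by (induction rule: generate_field.induct) (simp_all add: S T assms(3) CC_m_inv)
qed

lemma image_generate_field:
  assumes s: "field_emb (generate_field CC A) \<sigma>"
  shows "\<sigma> ` generate_field CC A = generate_field CC (\<sigma> ` A)"
proof
  note S = field_emb_D[OF subfield_generate_field s]
  note D = subfield_CC_D[OF subfield_generate_field[of "\<sigma> ` A"]]
  have "\<sigma> x \<in> generate_field CC (\<sigma> ` A)" if "x \<in> generate_field CC A" for x
    using that
    by (induction rule: generate_field.induct) (auto simp: S D CC_m_inv intro: generate_field.incl)
  then show "\<sigma> ` generate_field CC A \<subseteq> generate_field CC (\<sigma> ` A)" by auto
  show "generate_field CC (\<sigma> ` A) \<subseteq> \<sigma> ` generate_field CC A"
    by (rule generate_field_CC_subset[OF image_mono[OF generate_field_CC_incl] subfield_image_emb[OF subfield_generate_field s]])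
qed

lemma normal_over_generate_field:
  assumes "\<And>\<sigma>. field_emb (generate_field CC A) \<sigma> \<Longrightarrow> (\<And>a. a \<in> k \<Longrightarrow> \<sigma> a = a) \<Longrightarrow> \<sigma> ` A = A"
  shows "normal_over k (generate_field CC A)"
  unfolding normal_over_def using image_generate_field assms by auto

section \<open>Complex conjugation\<close>

lemma field_emb_cnj: "field_emb F cnj"
  by (simp add: field_emb_def)

lemma cnj_image_image [simp]: "cnj ` cnj ` L = L"
  by (simp add: image_image)

lemma mem_cnj_image: "x \<in> cnj ` L \<longleftrightarrow> cnj x \<in> L"
  by (metis complex_cnj_cnj image_iff)

lemma subfield_cnj_image: "subfield L CC \<Longrightarrow> subfield (cnj ` L) CC"
  by (rule subfield_image_emb[OF _ field_emb_cnj])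

lemma conj_aut_apply: "x \<in> L \<Longrightarrow> conj_aut L \<sigma> x = cnj (\<sigma> (cnj x))"
  by (simp add: conj_aut_def)

text \<open>Both fields are replaced by their conjugates because neither is assumed stable:
  \<open>k_inf\<close> will be a base field here, and an arbitrary Z_p-extension will be the top
  field.\<close>

lemma conj_aut_Gal:
  assumes L: "subfield L CC" "k \<subseteq> L" and s: "\<sigma> \<in> carrier (Gal L k)"
  shows "conj_aut (cnj ` L) \<sigma> \<in> carrier (Gal (cnj ` L) (cnj ` k))"
proof -
  note D = Gal_D[OF L(1) s] and L' = subfield_cnj_image[OF L(1)]
  have "field_emb (cnj ` L) (\<lambda>x. cnj (\<sigma> (cnj x)))"
    using D(1) by (auto simp: field_emb_def)
  then have 1: "field_emb (cnj ` L) (conj_aut (cnj ` L) \<sigma>)"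
    unfolding conj_aut_def field_emb_restrict[OF L'] .
  have "conj_aut (cnj ` L) \<sigma> ` cnj ` L = (\<lambda>x. cnj (\<sigma> (cnj x))) ` cnj ` L"
    by (intro image_cong refl conj_aut_apply)
  also have "\<dots> = cnj ` \<sigma> ` L" by (simp add: image_image)
  finally have 2: "conj_aut (cnj ` L) \<sigma> ` cnj ` L = cnj ` L" using D(2) by simp
  have 3: "conj_aut (cnj ` L) \<sigma> x = x" if "x \<in> cnj ` k" for x
    using that L(2) D(4)[of "cnj x"] by (subst conj_aut_apply) (auto simp: mem_cnj_image)
  show ?thesis unfolding Gal_carrier_iff[OF L'] using 1 2 3 by (simp add: conj_aut_def)
qed

lemma conj_aut_conj_aut:
  assumes "\<sigma> \<in> extensional L"
  shows "conj_aut L (conj_aut (cnj ` L) \<sigma>) = \<sigma>"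
proof
  fix x show "conj_aut L (conj_aut (cnj ` L) \<sigma>) x = \<sigma> x"
    using assms by (cases "x \<in> L") (auto simp: conj_aut_def extensional_def mem_cnj_image)
qed

lemma conj_aut_mult:
  assumes L: "subfield L CC" and t: "\<tau> \<in> carrier (Gal L k)"
  shows "conj_aut (cnj ` L) (\<sigma> \<otimes>\<^bsub>Gal L k\<^esub> \<tau>) = conj_aut (cnj ` L) \<sigma> \<otimes>\<^bsub>Gal (cnj ` L) k'\<^esub> conj_aut (cnj ` L) \<tau>"
proof
  fix x show "conj_aut (cnj ` L) (\<sigma> \<otimes>\<^bsub>Gal L k\<^esub> \<tau>) x = (conj_aut (cnj ` L) \<sigma> \<otimes>\<^bsub>Gal (cnj ` L) k'\<^esub> conj_aut (cnj ` L) \<tau>) x"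
    using Gal_D(3)[OF L t] 
    by (cases "x \<in> cnj ` L") (auto simp: conj_aut_def Gal_mult compose_def mem_cnj_image)
qed

lemma conj_aut_iso:
  assumes L: "subfield L CC" "k \<subseteq> L"
  shows "conj_aut (cnj ` L) \<in> iso (Gal L k) (Gal (cnj ` L) (cnj ` k))"
proof -
  note L' = subfield_cnj_image[OF L(1)] image_mono[OF L(2), of cnj]
  have "bij_betw (conj_aut (cnj ` L)) (carrier (Gal L k)) (carrier (Gal (cnj ` L) (cnj ` k)))"
  proof (rule bij_betw_byWitness[where f' = "conj_aut L"])
    show "\<forall>a\<in>carrier (Gal L k). conj_aut L (conj_aut (cnj ` L) a) = a"
      using conj_aut_conj_aut Gal_D(5)[OF L(1)] by blast
    show "\<forall>a\<in>carrier (Gal (cnj ` L) (cnj ` k)). conj_aut (cnj ` L) (conj_aut L a) = a"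
      using conj_aut_conj_aut[of _ "cnj ` L"] Gal_D(5)[OF L'(1)] by auto
    show "conj_aut (cnj ` L) ` carrier (Gal L k) \<subseteq> carrier (Gal (cnj ` L) (cnj ` k))"
      using conj_aut_Gal[OF L] by auto
    show "conj_aut L ` carrier (Gal (cnj ` L) (cnj ` k)) \<subseteq> carrier (Gal L k)"
      using conj_aut_Gal[OF L'] by auto
  qed
  then show ?thesis using conj_aut_mult[OF L(1)] conj_aut_Gal[OF L] by (auto simp: iso_def hom_def)
qed

section \<open>Conjugation as a homeomorphism for the Krull topology\<close>

lemma topspace_krull [simp]: "subfield L CC \<Longrightarrow> topspace (krull_topology L k) = carrier (Gal L k)"
  using Gal_D(3,5)[of L _ k] by (auto simp: krull_topology_def PiE_def Pi_def)

lemma continuous_map_krull_eval: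
  "x \<in> L \<Longrightarrow> continuous_map (krull_topology L k) (discrete_topology L) (\<lambda>\<sigma>. \<sigma> x)"
  unfolding krull_topology_def
  by (intro continuous_map_from_subtopology) (rule continuous_map_product_projection)

lemma continuous_map_conj_aut:
  assumes L: "subfield L CC" "k \<subseteq> L"
  shows "continuous_map (krull_topology L k) (krull_topology (cnj ` L) (cnj ` k)) (conj_aut (cnj ` L))"
  unfolding krull_topology_def[of "cnj ` L"] continuous_map_in_subtopology continuous_map_componentwise
proof (intro conjI ballI)
  show "conj_aut (cnj ` L) ` topspace (krull_topology L k) \<subseteq> extensional (cnj ` L)"
    by (auto simp: conj_aut_def)
  show "conj_aut (cnj ` L) \<in> topspace (krull_topology L k) \<rightarrow> carrier (Gal (cnj ` L) (cnj ` k))"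
    using conj_aut_Gal[OF L] L by auto
  fix x assume x: "x \<in> cnj ` L"
  have "continuous_map (krull_topology L k) (discrete_topology (cnj ` L)) (cnj \<circ> (\<lambda>\<sigma>. \<sigma> (cnj x)))"
    by (rule continuous_map_compose[OF continuous_map_krull_eval]) (use x in \<open>auto simp: mem_cnj_image\<close>)
  then show "continuous_map (krull_topology L k) (discrete_topology (cnj ` L)) (\<lambda>\<sigma>. conj_aut (cnj ` L) \<sigma> x)"
    using x by (simp add: conj_aut_apply o_def)
qed

lemma homeomorphic_map_conj_aut:
  assumes L: "subfield L CC" "k \<subseteq> L"
  shows "homeomorphic_map (krull_topology L k) (krull_topology (cnj ` L) (cnj ` k)) (conj_aut (cnj ` L))"
proof (rule homeomorphic_maps_imp_map)
  note L' = subfield_cnj_image[OF L(1)] image_mono[OF L(2), of cnj]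
  show "homeomorphic_maps (krull_topology L k) (krull_topology (cnj ` L) (cnj ` k)) (conj_aut (cnj ` L)) (conj_aut L)"
    unfolding homeomorphic_maps_def
    using continuous_map_conj_aut[OF L] continuous_map_conj_aut[OF L'] conj_aut_conj_aut[of _ L] conj_aut_conj_aut[of _ "cnj ` L"]
      Gal_D(5)[OF L(1)] Gal_D(5)[OF L'(1)] L L' by (simp add: subfield_cnj_image)
qed

lemma coeffs_in_cnj: "coeffs_in F P \<Longrightarrow> coeffs_in (cnj ` F) (map_poly cnj P)"
  by (auto simp: coeffs_in_def coeff_map_poly)

lemma alg_over_cnj:
  assumes "alg_over F x" shows "alg_over (cnj ` F) (cnj x)"
proof -
  obtain P where P: "P \<noteq> 0" "coeffs_in F P" "poly P x = 0" using assms by (auto simp: alg_over_def)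
  have "map_poly cnj P \<noteq> 0" using P(1) by (auto simp: poly_eq_iff coeff_map_poly)
  moreover have "poly (map_poly cnj P) (cnj x) = 0" 
  proof -
    have "poly (map_poly cnj P) (cnj x) = cnj (poly P x)" by (induction P) (auto simp: map_poly_pCons)
    then show ?thesis using P(3) by simp
  qed
  ultimately show ?thesis using coeffs_in_cnj[OF P(2)] unfolding alg_over_def by blast
qed

lemma galois_extension_I:
  assumes "subfield k CC" "subfield L CC" "k \<subseteq> L" "\<And>x. x \<in> L \<Longrightarrow> alg_over k x"
    "\<And>x. x \<in> L \<Longrightarrow> (\<And>\<sigma>. \<sigma> \<in> carrier (Gal L k) \<Longrightarrow> \<sigma> x = x) \<Longrightarrow> x \<in> k"
  shows "galois_extension k L"
proof -
  have "{x \<in> L. \<forall>\<sigma>\<in>carrier (Gal L k). \<sigma> x = x} = k" using assms(3,5) Gal_D(4)[OF assms(2)] by blast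
  then show ?thesis using assms algebraic_CC_iff[OF assms(1)] unfolding galois_extension_def alg_over_def by auto
qed

lemma galois_extension_cnj:
  assumes "galois_extension k L"
  shows "galois_extension (cnj ` k) (cnj ` L)"
proof -
  note G = galois_extension_D[OF assms]
  show ?thesis
  proof (rule galois_extension_I)
    show "alg_over (cnj ` k) x" if "x \<in> cnj ` L" for x using that alg_over_cnj[OF G(4)] by auto
    fix x assume x: "x \<in> cnj ` L" "\<And>\<sigma>. \<sigma> \<in> carrier (Gal (cnj ` L) (cnj ` k)) \<Longrightarrow> \<sigma> x = x"
    have "cnj x \<in> k"
    proof (rule G(5))
      fix \<sigma> assume s: "\<sigma> \<in> carrier (Gal L k)"
      have "conj_aut (cnj ` L) \<sigma> x = x" by (rule x(2)[OF conj_aut_Gal[OF G(2,3) s]])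
      then show "\<sigma> (cnj x) = cnj x" using x(1) by (simp add: conj_aut_apply) (metis complex_cnj_cnj)
    qed (use x in \<open>auto simp: mem_cnj_image\<close>)
    then show "x \<in> cnj ` k" by (simp add: mem_cnj_image)
  qed (use G in \<open>auto intro: subfield_cnj_image\<close>)
qed

text \<open>The isomorphism with \<open>Zp p\<close> is transported along \<open>conj_aut\<close>.
  Conjugation therefore permutes the Z_p-extensions of \<open>k\<close>, so that their composite is
  stable under it.\<close>

lemma Zp_extension_cnj:
  assumes "Zp_extension p k L" "cnj ` k = k"
  shows "Zp_extension p k (cnj ` L)"
proof -
  have g: "galois_extension k L" using assms by (simp add: Zp_extension_def)
  note G = galois_extension_D[OF g]
  note G' = galois_extension_D[OF galois_extension_cnj[OF g]]
  obtain \<phi> where p: "\<phi> \<in> iso (Gal L k) (add_monoid (Zp p))" "homeomorphic_map (krull_topology L k) (Zp_topology p) \<phi>"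
    using assms by (auto simp: Zp_extension_def)
  have i: "conj_aut L \<in> iso (Gal (cnj ` L) k) (Gal L k)" 
    using conj_aut_iso[OF G'(2,3)] assms(2) by simp
  have h: "homeomorphic_map (krull_topology (cnj ` L) k) (krull_topology L k) (conj_aut L)"
    using homeomorphic_map_conj_aut[OF G'(2,3)] assms(2) by simp
  have "\<phi> \<circ> conj_aut L \<in> iso (Gal (cnj ` L) k) (add_monoid (Zp p))" by (rule iso_set_trans[OF i p(1)])
  moreover have "homeomorphic_map (krull_topology (cnj ` L) k) (Zp_topology p) (\<phi> \<circ> conj_aut L)"
    by (rule homeomorphic_map_compose[OF h p(2)])
  ultimately show ?thesis using galois_extension_cnj[OF g] assms(2) unfolding Zp_extension_def by auto
qed

section \<open>Stability of a CM-field under complex conjugation\<close>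

lemma CC_set_add: "A <+>\<^bsub>CC\<^esub> B = {a + b | a b. a \<in> A \<and> b \<in> B}"
  by (auto simp: set_add_def set_mult_def)

lemma CC_line_extension: "ring.line_extension CC F v E = {a * v + e | a e. a \<in> F \<and> e \<in> E}"
proof -
  interpret Ring.field CC by (rule field_CC)
  show ?thesis unfolding line_extension_def CC_set_add by (auto simp: r_coset_def)
qed

text \<open>The condition \<open>totally_real\<close>, applied to the inclusion of \<open>F\<close>,
  places \<open>F\<close> inside \<real>. So \<open>k\<close> is quadratic over a real field, and
  the conjugate of a non-real x is the other root of a quadratic equation over that field.\<close>

lemma CM_field_cnj:
  assumes "CM_field k"
  shows "subfield k CC" "cnj ` k = k"
proof -
  interpret Ring.field CC by (rule field_CC)
  obtain F where F: "F \<subseteq> k" "number_field F" "totally_real F" "dimension 2 F k" and k: "number_field k"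
    using assms by (auto simp: CM_field_def)
  show sk: "subfield k CC" using k by (simp add: number_field_def)
  have sF: "subfield F CC" using F by (simp add: number_field_def)
  note D = subfield_CC_D[OF sF]
  have "(\<lambda>x. x) \<in> ring_hom (sub_ring F) CC" by (auto simp: ring_hom_def)
  then have real: "F \<subseteq> \<real>" using F(3) unfolding totally_real_def by (metis image_ident)
  obtain v E1 where v: "dimension 1 F E1" "k = line_extension F v E1"
    using F(4) by (cases rule: dimension.cases) (auto simp: numeral_2_eq_2)
  obtain w E0 where w: "dimension 0 F E0" "E1 = line_extension F w E0"
    using v(1) by (cases rule: dimension.cases) auto
  have "E0 = {0}" using w(1) by (cases rule: dimension.cases) auto
  then have kvw: "k = {a * v + b * w | a b. a \<in> F \<and> b \<in> F}" 
    unfolding v(2) w(2) CC_line_extension by auto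
  have "cnj x \<in> k" if x: "x \<in> k" for x
  proof (cases "x \<in> \<real>")
    case True then show ?thesis using x by (simp add: Reals_cnj_iff)
  next
    case False
    note Dk = subfield_CC_D[OF sk]
    obtain a b where ab: "1 = a * v + b * w" "a \<in> F" "b \<in> F" using Dk(1) kvw by blast
    obtain c d where cd: "x = c * v + d * w" "c \<in> F" "d \<in> F" using x kvw by blast
    obtain e f where ef: "x * x = e * v + f * w" "e \<in> F" "f \<in> F" using Dk(4)[OF x x] kvw by blast
    \<comment> \<open>\<open>1, x\<close> is a basis of \<open>k\<close> over the real field \<open>F\<close>, so \<open>x\<^sup>2 = sx + q\<close> and \<open>cnj x = s - x\<close>.\<close>
    define t where "t = a * d - b * c"
    \<comment> \<open>Cramer's rule: \<open>t\<close> is the determinant of the coordinates of 1 and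
      \<open>x\<close> with respect to \<open>v\<close>, \<open>w\<close>.\<close>
    have "t * v = d * (a * v + b * w) - b * (c * v + d * w)" by (simp add: t_def algebra_simps)
    then have 1: "t * v = d - b * x" by (simp flip: ab(1) cd(1))
    have "t * w = a * (c * v + d * w) - c * (a * v + b * w)" by (simp add: t_def algebra_simps)
    then have 2: "t * w = a * x - c" by (simp flip: ab(1) cd(1))
    have t: "t \<noteq> 0"
    proof
      assume "t = 0"
      then have e1: "d = b * x" "c = a * x" using 1 2 by auto
      have "a \<noteq> 0 \<or> b \<noteq> 0" using ab(1) by auto
      then have "x = c / a \<or> x = d / b" using e1 by auto
      then have "x \<in> F" using D(8) ab cd by auto
      then show False using False real by auto
    qed
    define s where "s = (f * a - e * b) / t"
    define q where "q = (e * d - f * c) / t"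
    have sq: "s \<in> F" "q \<in> F" unfolding s_def q_def t_def using D ab cd ef by auto
    have "t * (x * x) = e * (t * v) + f * (t * w)" by (simp add: ef(1) algebra_simps)
    then have "t * (x * x) = (f * a - e * b) * x + (e * d - f * c)" unfolding 1 2 by (simp add: algebra_simps)
    then have xx: "x * x = s * x + q" using t by (simp add: s_def q_def field_simps)
    have cs: "cnj s = s" "cnj q = q" using sq real by (auto simp: Reals_cnj_iff subset_iff)
    have "cnj x * cnj x = s * cnj x + q" using arg_cong[OF xx, of cnj] cs by simp
    moreover have "(x - cnj x) * (x + cnj x - s) = x * x - cnj x * cnj x - s * (x - cnj x)"
      by (simp add: algebra_simps)
    ultimately have "(x - cnj x) * (x + cnj x - s) = 0" using xx by (simp add: algebra_simps)
    moreover have "x - cnj x \<noteq> 0" using False by (auto simp: Reals_cnj_iff)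
    ultimately have "x + cnj x - s = 0" using mult_eq_0_iff by blast
    then have "cnj x = s - x" by (simp add: algebra_simps)
    then show ?thesis using Dk(7)[of s x] sq(1) F(1) x by auto
  qed
  note c = this
  have "cnj x \<in> k \<longleftrightarrow> x \<in> k" for x using c[of x] c[of "cnj x"] by auto
  then show "cnj ` k = k" by (auto simp: mem_cnj_image)
qed

section \<open>Zp-extensions\<close>

lemma Zp_add: "(x \<oplus>\<^bsub>Zp p\<^esub> y) n = (x n + y n) mod int p ^ n"
  by (simp add: Zp_def)

lemma Zp_carrierD: "x \<in> carrier (Zp p) \<Longrightarrow> 0 \<le> x n" "x \<in> carrier (Zp p) \<Longrightarrow> x n < int p ^ n"
  "x \<in> carrier (Zp p) \<Longrightarrow> x (Suc n) mod int p ^ n = x n"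
  by (auto simp: Zp_def)

lemma Zp_mod_le:
  assumes "x \<in> carrier (Zp p)" "m \<le> n" shows "x n mod int p ^ m = x m"
  using assms(2)
proof (induction n rule: dec_induct)
  case base then show ?case using Zp_carrierD[OF assms(1)] by (simp add: mod_pos_pos_trivial)
next
  case (step n)
  have "x (Suc n) mod int p ^ m = (x (Suc n) mod int p ^ n) mod int p ^ m"
    using step by (simp add: mod_mod_cancel le_imp_power_dvd)
  then show ?case using step Zp_carrierD(3)[OF assms(1)] by simp
qed

text \<open>A basic open set restricts only finitely many components, and vanishing of the component
  m forces all lower ones to vanish.\<close>

lemma Zp_topology_nbhd_0:
  assumes "openin (Zp_topology p) U" "(\<lambda>n. 0) \<in> U"
  shows "\<exists>m. \<forall>x\<in>carrier (Zp p). x m = 0 \<longrightarrow> x \<in> U"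
proof -
  obtain W where W: "openin (product_topology (\<lambda>_. discrete_topology UNIV) UNIV) W" "U = W \<inter> carrier (Zp p)"
    using assms(1) by (auto simp: Zp_topology_def openin_subtopology)
  then obtain B where B: "finite {i. B i \<noteq> UNIV}" "(\<lambda>n. 0) \<in> Pi\<^sub>E UNIV B" "Pi\<^sub>E UNIV B \<subseteq> W"
    using assms(2) unfolding openin_product_topology_alt by fastforce
  define m where "m = Max (insert 0 {i. B i \<noteq> UNIV})"
  have "x \<in> U" if x: "x \<in> carrier (Zp p)" "x m = 0" for x
  proof -
    have "x i \<in> B i" for i
    proof (cases "B i = UNIV")
      case False
      then have "i \<le> m" using B(1) by (auto simp: m_def)
      then have "x i = 0" using Zp_mod_le[OF x(1), of i m] x(2) by simp
      then show ?thesis using B(2) by (auto simp: PiE_def Pi_def)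
    qed auto
    then have "x \<in> Pi\<^sub>E UNIV B" by auto
    then show ?thesis using B(3) W(2) x(1) by auto
  qed
  then show ?thesis by blast
qed

lemma krull_open_stabilizer:
  assumes L: "subfield L CC" and S: "finite S" "S \<subseteq> L"
  shows "openin (krull_topology L k) {\<sigma> \<in> carrier (Gal L k). \<forall>s\<in>S. \<sigma> s = s}"
proof -
  have 1: "openin (krull_topology L k) {\<sigma> \<in> topspace (krull_topology L k). \<sigma> s \<in> {s}}" if "s \<in> S" for s
    using that S by (intro openin_continuous_map_preimage[OF continuous_map_krull_eval]) auto
  have "openin (krull_topology L k) ((\<Inter>s\<in>S. {\<sigma> \<in> topspace (krull_topology L k). \<sigma> s \<in> {s}}) \<inter> topspace (krull_topology L k))"
    using S(1) 1 by (intro openin_INT)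
  also have "(\<Inter>s\<in>S. {\<sigma> \<in> topspace (krull_topology L k). \<sigma> s \<in> {s}}) \<inter> topspace (krull_topology L k)
    = {\<sigma> \<in> carrier (Gal L k). \<forall>s\<in>S. \<sigma> s = s}" using L by auto
  finally show ?thesis .
qed

lemma krull_open_contains_stabilizer:
  assumes L: "subfield L CC" and V: "openin (krull_topology L k) V" "(\<lambda>x\<in>L. x) \<in> V"
  shows "\<exists>S. finite S \<and> S \<subseteq> L \<and> (\<forall>\<sigma>\<in>carrier (Gal L k). (\<forall>s\<in>S. \<sigma> s = s) \<longrightarrow> \<sigma> \<in> V)"
proof -
  obtain W where W: "openin (product_topology (\<lambda>_. discrete_topology L) L) W" "V = W \<inter> carrier (Gal L k)"
    using V(1) by (auto simp: krull_topology_def openin_subtopology)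
  then obtain B where B: "finite {i \<in> L. B i \<noteq> L}" "(\<lambda>x\<in>L. x) \<in> Pi\<^sub>E L B" "Pi\<^sub>E L B \<subseteq> W"
    using V(2) unfolding openin_product_topology_alt by fastforce
  define S where "S = {i \<in> L. B i \<noteq> L}"
  have "\<sigma> \<in> V" if s: "\<sigma> \<in> carrier (Gal L k)" "\<forall>s\<in>S. \<sigma> s = s" for \<sigma>
  proof -
    have "\<sigma> i \<in> B i" if i: "i \<in> L" for i
    proof (cases "B i = L")
      case False
      then have "\<sigma> i = i" using s(2) i by (auto simp: S_def)
      moreover have "i \<in> B i" using B(2) i by (auto simp: PiE_def Pi_def)
      ultimately show ?thesis by simp
    qed (use Gal_D(3)[OF L s(1)] i in auto)
    then have "\<sigma> \<in> Pi\<^sub>E L B" using Gal_D(5)[OF L s(1)] by (auto simp: PiE_def)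
    then show ?thesis using B(3) W(2) s(1) by auto
  qed
  then show ?thesis using B(1) unfolding S_def by (intro exI[of _ S]) (auto simp: S_def)
qed

text \<open>The character is the component m of the isomorphism with Z_p, where m is chosen such
  that p^m Z_p lies in the image of the stabiliser of \<open>S\<close>. It reduces the Z_p-extension
  at this level to arithmetic of residues modulo p^m.\<close>

lemma Zp_extension_char:
  assumes Z: "Zp_extension p k L" and S: "finite S" "S \<subseteq> L" and p: "p > 0"
  obtains \<psi> :: "(complex \<Rightarrow> complex) \<Rightarrow> int" and m :: nat where
    "\<And>\<sigma> \<tau>. \<sigma> \<in> carrier (Gal L k) \<Longrightarrow> \<tau> \<in> carrier (Gal L k) \<Longrightarrow> \<psi> (\<sigma> \<otimes>\<^bsub>Gal L k\<^esub> \<tau>) = (\<psi> \<sigma> + \<psi> \<tau>) mod int p ^ m"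
    "\<And>\<sigma>. \<sigma> \<in> carrier (Gal L k) \<Longrightarrow> 0 \<le> \<psi> \<sigma> \<and> \<psi> \<sigma> < int p ^ m"
    "\<And>\<sigma> s. \<sigma> \<in> carrier (Gal L k) \<Longrightarrow> \<psi> \<sigma> = 0 \<Longrightarrow> s \<in> S \<Longrightarrow> \<sigma> s = s"
proof -
  have g: "galois_extension k L" using Z by (simp add: Zp_extension_def)
  note G = galois_extension_D[OF g]
  obtain \<phi> where f: "\<phi> \<in> iso (Gal L k) (add_monoid (Zp p))" "homeomorphic_map (krull_topology L k) (Zp_topology p) \<phi>"
    using Z by (auto simp: Zp_extension_def)
  interpret group "Gal L k" by (rule group_Gal[OF G(2,3)])
  define St where "St = {\<sigma> \<in> carrier (Gal L k). \<forall>s\<in>S. \<sigma> s = s}"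
  have bij: "bij_betw \<phi> (carrier (Gal L k)) (carrier (Zp p))" 
    and hom: "\<And>\<sigma> \<tau>. \<sigma> \<in> carrier (Gal L k) \<Longrightarrow> \<tau> \<in> carrier (Gal L k) \<Longrightarrow> \<phi> (\<sigma> \<otimes>\<^bsub>Gal L k\<^esub> \<tau>) = \<phi> \<sigma> \<oplus>\<^bsub>Zp p\<^esub> \<phi> \<tau>"
    using f(1) by (auto simp: iso_def hom_def)
  have car: "\<phi> \<sigma> \<in> carrier (Zp p)" if "\<sigma> \<in> carrier (Gal L k)" for \<sigma> using bij that by (auto simp: bij_betw_def)
  have one: "\<phi> \<one>\<^bsub>Gal L k\<^esub> = (\<lambda>n. 0)"
  proof
    fix n
    let ?x = "\<phi> \<one>\<^bsub>Gal L k\<^esub> n"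
    have "?x = (?x + ?x) mod int p ^ n" using hom[OF one_closed one_closed] by (metis Zp_add one_closed r_one)
    then have "(?x + ?x) mod int p ^ n = (?x + 0) mod int p ^ n" 
      using Zp_carrierD[OF car[OF one_closed], of n] by (simp add: mod_pos_pos_trivial)
    then have "?x mod int p ^ n = 0" by (simp add: mod_eq_dvd_iff mod_eq_0_iff_dvd)
    then show "?x = 0" using Zp_carrierD[OF car[OF one_closed], of n] by (simp add: mod_pos_pos_trivial)
  qed
  have "openin (Zp_topology p) (\<phi> ` St)"
    using homeomorphic_map_openness[OF f(2), of St] krull_open_stabilizer[OF G(2) S] topspace_krull[OF G(2)] by (auto simp: St_def)
  moreover have "(\<lambda>n. 0) \<in> \<phi> ` St"
  proof
    show "(\<lambda>n. 0) = \<phi> \<one>\<^bsub>Gal L k\<^esub>" using one by simp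
    show "\<one>\<^bsub>Gal L k\<^esub> \<in> St" unfolding St_def using S one_closed by (auto simp: Gal_one)
  qed
  ultimately have "\<exists>m. \<forall>x\<in>carrier (Zp p). x m = 0 \<longrightarrow> x \<in> \<phi> ` St" by (rule Zp_topology_nbhd_0)
  then obtain m where m: "\<And>x. x \<in> carrier (Zp p) \<Longrightarrow> x m = 0 \<Longrightarrow> x \<in> \<phi> ` St" by auto
  show thesis
  proof (rule that[of "\<lambda>\<sigma>. \<phi> \<sigma> m" m])
    fix \<sigma> s assume s: "\<sigma> \<in> carrier (Gal L k)" "\<phi> \<sigma> m = 0" "s \<in> S"
    then obtain \<tau> where "\<tau> \<in> St" "\<phi> \<sigma> = \<phi> \<tau>" using m[OF car[OF s(1)] s(2)] by (elim imageE)
    then have "\<sigma> = \<tau>" using inj_onD[OF bij_betw_imp_inj_on[OF bij] _ s(1)] by (simp add: St_def)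
    then show "\<sigma> s = s" using \<open>\<tau> \<in> St\<close> s by (auto simp: St_def)
  next
    fix \<sigma> \<tau> assume "\<sigma> \<in> carrier (Gal L k)" "\<tau> \<in> carrier (Gal L k)"
    then show "\<phi> (\<sigma> \<otimes>\<^bsub>Gal L k\<^esub> \<tau>) m = (\<phi> \<sigma> m + \<phi> \<tau> m) mod int p ^ m" by (simp only: hom Zp_add)
  next
    fix \<sigma> assume "\<sigma> \<in> carrier (Gal L k)"
    then have "\<phi> \<sigma> \<in> carrier (Zp p)" by (rule car)
    then show "0 \<le> \<phi> \<sigma> m \<and> \<phi> \<sigma> m < int p ^ m" by (intro conjI Zp_carrierD(1,2))
  qed
qed

lemma Zp_extension_comm:
  assumes Z: "Zp_extension p k L" and s: "\<sigma> \<in> carrier (Gal L k)" "\<tau> \<in> carrier (Gal L k)" and x: "x \<in> L"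
  shows "\<sigma> (\<tau> x) = \<tau> (\<sigma> x)"
proof -
  have g: "galois_extension k L" using Z by (simp add: Zp_extension_def)
  note G = galois_extension_D[OF g]
  interpret group "Gal L k" by (rule group_Gal[OF G(2,3)])
  obtain \<phi> where f: "\<phi> \<in> iso (Gal L k) (add_monoid (Zp p))"
    using Z by (auto simp: Zp_extension_def)
  have "\<phi> (\<sigma> \<otimes>\<^bsub>Gal L k\<^esub> \<tau>) = \<phi> (\<tau> \<otimes>\<^bsub>Gal L k\<^esub> \<sigma>)"
    using f s by (auto simp: iso_def hom_def Zp_def add.commute)
  then have "\<sigma> \<otimes>\<^bsub>Gal L k\<^esub> \<tau> = \<tau> \<otimes>\<^bsub>Gal L k\<^esub> \<sigma>"
    using f s m_closed by (auto simp: iso_def bij_betw_def inj_on_def)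
  then show ?thesis using x by (metis Gal_mult_apply)
qed

section \<open>The composite of all Zp-extensions\<close>

lemma Zp_extension_D:
  assumes "Zp_extension p k L"
  shows "subfield k CC" "subfield L CC" "k \<subseteq> L" "\<And>x. x \<in> L \<Longrightarrow> alg_over k x" "normal_over k L"
  using assms galois_extension_D[of k L] galois_normal_over[of k L] by (auto simp: Zp_extension_def)

text \<open>Each property is tested on the Z_p-extensions that generate the composite: they are
  algebraic and normal, have abelian groups, and are permuted by conjugation.\<close>

lemma composite_Zp_extensions_facts:
  fixes p k defines "E \<equiv> composite_Zp_extensions p k"
  assumes k: "subfield k CC"
  shows "subfield E CC" "k \<subseteq> E" "\<And>L. Zp_extension p k L \<Longrightarrow> L \<subseteq> E" "\<And>x. x \<in> E \<Longrightarrow> alg_over k x"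
    "normal_over k E" 
    "\<And>\<sigma> \<tau> x. \<sigma> \<in> carrier (Gal E k) \<Longrightarrow> \<tau> \<in> carrier (Gal E k) \<Longrightarrow> x \<in> E \<Longrightarrow> \<sigma> (\<tau> x) = \<tau> (\<sigma> x)"
    "cnj ` k = k \<Longrightarrow> cnj ` E = E"
proof -
  define A where "A = k \<union> \<Union> {L. Zp_extension p k L}"
  have E: "E = generate_field CC A" by (simp add: E_def composite_Zp_extensions_def A_def)
  show sE: "subfield E CC" unfolding E by (rule subfield_generate_field)
  have AE: "A \<subseteq> E" unfolding E by (rule generate_field_CC_incl)
  show kE: "k \<subseteq> E" and LE: "\<And>L. Zp_extension p k L \<Longrightarrow> L \<subseteq> E" using AE by (auto simp: A_def)
  have "alg_over k x" if "x \<in> A" for x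
    using that alg_over_self[OF k] Zp_extension_D(4) by (auto simp: A_def)
  then show "\<And>x. x \<in> E \<Longrightarrow> alg_over k x" unfolding E by (rule alg_over_generate_field[OF k])
  show norm: "normal_over k E" unfolding E
  proof (rule normal_over_generate_field)
    fix \<sigma> assume s: "field_emb (generate_field CC A) \<sigma>" "\<And>a. a \<in> k \<Longrightarrow> \<sigma> a = a"
    have "\<sigma> ` L = L" if L: "Zp_extension p k L" for L
      using normal_overD[OF Zp_extension_D(5)[OF L] field_emb_subset[OF LE[OF L]] s(2)] s(1) E by auto
    moreover have "\<sigma> ` k = k" using s(2) by (auto simp: image_iff)
    ultimately show "\<sigma> ` A = A" by (auto simp: A_def image_Un image_Union)
  qed
  show "\<sigma> (\<tau> x) = \<tau> (\<sigma> x)" if s: "\<sigma> \<in> carrier (Gal E k)" and t: "\<tau> \<in> carrier (Gal E k)" and x: "x \<in> E" for \<sigma> \<tau> x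
  proof -
    note S = Gal_D[OF sE s] and T = Gal_D[OF sE t]
    have st: "field_emb (generate_field CC A) (\<lambda>x. \<sigma> (\<tau> x))" 
      using field_emb_compose[OF T(1) _ S(1)] T(2) E by auto
    have ts: "field_emb (generate_field CC A) (\<lambda>x. \<tau> (\<sigma> x))" 
      using field_emb_compose[OF S(1) _ T(1)] S(2) E by auto
    show ?thesis
    proof (rule emb_eq_on_generate_field[OF st ts])
      show "x \<in> generate_field CC A" using x E by simp
      fix a assume "a \<in> A"
      then consider "a \<in> k" | L where "Zp_extension p k L" "a \<in> L" by (auto simp: A_def)
      then show "\<sigma> (\<tau> a) = \<tau> (\<sigma> a)"
      proof cases
        case 1 then show ?thesis using S(4) T(4) by simp
      next
        case 2
        note Z = Zp_extension_D[OF 2(1)]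
        have rs: "restrict \<sigma> L \<in> carrier (Gal L k)" by (rule restrict_Gal[OF Z(2,5) LE[OF 2(1)] Z(3) S(1) S(4)])
        have rt: "restrict \<tau> L \<in> carrier (Gal L k)" by (rule restrict_Gal[OF Z(2,5) LE[OF 2(1)] Z(3) T(1) T(4)])
        have "restrict \<sigma> L (restrict \<tau> L a) = restrict \<tau> L (restrict \<sigma> L a)"
          by (rule Zp_extension_comm[OF 2(1) rs rt 2(2)])
        then show ?thesis using Gal_D(3)[OF Z(2) rs 2(2)] Gal_D(3)[OF Z(2) rt 2(2)] 2(2) by simp
      qed
    qed
  qed
  show "cnj ` E = E" if ck: "cnj ` k = k"
  proof -
    have "cnj ` A \<subseteq> A" 
    proof
      fix y assume "y \<in> cnj ` A"
      then consider "y \<in> cnj ` k" | L where "Zp_extension p k L" "y \<in> cnj ` L" by (auto simp: A_def)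
      then show "y \<in> A" 
      proof cases
        case 2 
        then have "Zp_extension p k (cnj ` L)" using Zp_extension_cnj ck by blast
        then show ?thesis using 2(2) by (auto simp: A_def)
      qed (use ck in \<open>auto simp: A_def\<close>)
    qed
    then have "cnj ` A = A" using image_mono[of "cnj ` A" A cnj] by auto
    then show ?thesis using image_generate_field[OF field_emb_cnj, of A] E by simp
  qed
qed

section \<open>The action of complex conjugation\<close>

text \<open>Conjugation J acts by inversion on Gal(L/k), since \<tau> J(\<tau>) lies in Gamma^+ for
  every \<tau> and so fixes \<open>L\<close>. For \<tau> in Gal(E/L) the same relation shows that
  \<tau> fixes the conjugates of the elements of \<open>L\<close>, which gives the stability of
  \<open>L\<close>.\<close>

lemma anticyclotomic_conj:
  assumes k: "cnj ` k = k" and an: "anticyclotomic_Zp_extension p k L"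
  shows "cnj ` L = L" "\<And>\<sigma> x. \<sigma> \<in> carrier (Gal L k) \<Longrightarrow> x \<in> L \<Longrightarrow> cnj (\<sigma> (cnj (\<sigma> x))) = x"
proof -
  define E where "E = composite_Zp_extensions p k"
  have Z: "Zp_extension p k L" and Lan: "L \<subseteq> anticyclotomic_composite p k" 
    using an by (auto simp: anticyclotomic_Zp_extension_def)
  note D = Zp_extension_D[OF Z]
  note F = composite_Zp_extensions_facts[OF D(1), where p = p, folded E_def]
  note cE = F(7)[OF k] and LE = F(3)[OF Z]
  interpret G: group "Gal E k" by (rule group_Gal[OF F(1,2)])
  have ca: "conj_aut E \<tau> \<in> carrier (Gal E k)" if "\<tau> \<in> carrier (Gal E k)" for \<tau>
    using conj_aut_Gal[OF F(1,2) that] cE k by simp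
  text \<open>The square of \<open>\<tau>\<^bsup>1+J\<^esup>\<close> is \<open>(\<tau>\<^sup>2)\<^bsup>1+J\<^esup>\<close>, so \<open>\<tau>\<^bsup>1+J\<^esup>\<close> lies in \<open>\<Gamma>\<^sup>+\<close>, with witness \<open>\<tau>\<^sup>2\<close>.\<close>
  have fix1: "\<tau> (cnj (\<tau> (cnj x))) = x" if t: "\<tau> \<in> carrier (Gal E k)" and x: "x \<in> L" for \<tau> x
  proof -
    have comm: "a \<otimes>\<^bsub>Gal E k\<^esub> b = b \<otimes>\<^bsub>Gal E k\<^esub> a" if "a \<in> carrier (Gal E k)" "b \<in> carrier (Gal E k)" for a b
      using F(6)[OF that] by (auto simp: Gal_mult compose_def)
    let ?c = "conj_aut E \<tau>"
    have "conj_aut E (\<tau> \<otimes>\<^bsub>Gal E k\<^esub> \<tau>) = ?c \<otimes>\<^bsub>Gal E k\<^esub> ?c"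
      using conj_aut_mult[OF F(1) t, of \<tau> k] cE by simp
    moreover have "(\<tau> \<otimes>\<^bsub>Gal E k\<^esub> ?c) \<otimes>\<^bsub>Gal E k\<^esub> (\<tau> \<otimes>\<^bsub>Gal E k\<^esub> ?c) = (\<tau> \<otimes>\<^bsub>Gal E k\<^esub> \<tau>) \<otimes>\<^bsub>Gal E k\<^esub> (?c \<otimes>\<^bsub>Gal E k\<^esub> ?c)"
      using t ca[OF t] comm by (metis G.m_assoc G.m_closed)
    ultimately have "\<tau> \<otimes>\<^bsub>Gal E k\<^esub> ?c \<in> Gamma_plus p k"
      unfolding Gamma_plus_def Let_def E_def[symmetric] using t ca[OF t] G.m_closed
      by (intro CollectI conjI bexI[of _ "\<tau> \<otimes>\<^bsub>Gal E k\<^esub> \<tau>"]) auto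
    then have "(\<tau> \<otimes>\<^bsub>Gal E k\<^esub> ?c) x = x" using Lan x by (auto simp: anticyclotomic_composite_def)
    then show ?thesis using x LE by (simp add: Gal_mult_apply conj_aut_apply subset_iff)
  qed
  have cL: "cnj y \<in> L" if y: "y \<in> L" for y
  proof (rule fixed_imp_base[OF D(2) LE F(1)])
    show "normal_over L E" by (rule normal_over_mono[OF F(5) D(3)])
    show "alg_over L x" if "x \<in> E" for x by (rule alg_over_mono[OF D(3) F(4)[OF that]])
    show cy: "cnj y \<in> E" using y LE cE by (auto simp: mem_cnj_image)
    fix \<tau> assume t: "\<tau> \<in> carrier (Gal E L)"
    then have tk: "\<tau> \<in> carrier (Gal E k)" using Gal_mono[OF F(1) D(3)] by blast
    \<comment> \<open>Since \<tau> fixes \<open>y\<close>, the outer \<tau> can be cancelled from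
      the relation \<open>fix1\<close>.\<close>
    have "\<tau> (cnj (\<tau> (cnj y))) = \<tau> y" using fix1[OF tk y] Gal_D(4)[OF F(1) t y] by simp
    moreover have "cnj (\<tau> (cnj y)) \<in> E" using Gal_D(3)[OF F(1) t cy] cE by (auto simp: mem_cnj_image)
    ultimately have "cnj (\<tau> (cnj y)) = y" using inj_onD[OF Gal_D(6)[OF F(1) t]] y LE by blast
    then show "\<tau> (cnj y) = cnj y" by (metis complex_cnj_cnj)
  qed
  then show cLL: "cnj ` L = L" by (metis complex_cnj_cnj mem_cnj_image subsetI subset_antisym)
  fix \<sigma> x assume s: "\<sigma> \<in> carrier (Gal L k)" and x: "x \<in> L"
  obtain \<tau> where t: "\<tau> \<in> carrier (Gal E k)" "\<forall>x\<in>L. \<tau> x = \<sigma> x"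
    using lift_Gal[OF D(1,3,2) LE F(1,5,4) s] by blast
  have sx: "cnj (\<sigma> x) \<in> L" "cnj x \<in> L" using cL Gal_D(3)[OF D(2) s] x by auto
  have "\<tau> (cnj (\<tau> (cnj (cnj x)))) = cnj x" by (rule fix1[OF t(1) sx(2)])
  then show "cnj (\<sigma> (cnj (\<sigma> x))) = x" using t(2) x sx by simp
qed

text \<open>\<open>L\<close> is generated by \<open>k\<close> and a Z_p-extension Q of \<rat>. On Q
  conjugation is itself an element of the abelian group Gal(Q/\<rat>) and commutes with \<sigma>; on
  the conjugation-stable field \<open>k\<close> the map \<sigma> is the identity. The statement is
  about embeddings, so that elements of Gal(K/k) need not be restricted.\<close>

lemma cyclotomic_conj:
  assumes k: "subfield k CC" "cnj ` k = k" and cy: "cyclotomic_Zp_extension p k L"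
  shows "subfield L CC" "k \<subseteq> L" "\<And>x. x \<in> L \<Longrightarrow> alg_over k x" "normal_over k L" "cnj ` L = L"
    "\<And>\<sigma> x. field_emb L \<sigma> \<Longrightarrow> (\<And>a. a \<in> k \<Longrightarrow> \<sigma> a = a) \<Longrightarrow> x \<in> L \<Longrightarrow> cnj (\<sigma> (cnj x)) = \<sigma> x"
proof -
  obtain Q where Q: "Zp_extension p \<rat> Q" "L = generate_field CC (k \<union> Q)"
    using cy by (auto simp: cyclotomic_Zp_extension_def compositum_def)
  note D = Zp_extension_D[OF Q(1)]
  show sL: "subfield L CC" unfolding Q(2) by (rule subfield_generate_field)
  have kQL: "k \<union> Q \<subseteq> L" unfolding Q(2) by (rule generate_field_CC_incl)
  then show kL: "k \<subseteq> L" by auto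
  have QL: "Q \<subseteq> L" using kQL by auto
  have Qk: "\<rat> \<subseteq> k" by (rule Rats_subset_subfield[OF k(1)])
  have "alg_over k x" if "x \<in> k \<union> Q" for x
    using that alg_over_self[OF k(1)] alg_over_mono[OF Qk] D(4) by auto
  then show "\<And>x. x \<in> L \<Longrightarrow> alg_over k x" unfolding Q(2) by (rule alg_over_generate_field[OF k(1)])
  have ratfix: "\<sigma> a = a" if "\<And>a. a \<in> k \<Longrightarrow> \<sigma> a = a" "a \<in> \<rat>" for \<sigma> :: "complex \<Rightarrow> complex" and a
    using that Qk by auto
  show "normal_over k L" unfolding Q(2)
  proof (rule normal_over_generate_field)
    fix \<sigma> assume s: "field_emb (generate_field CC (k \<union> Q)) \<sigma>" "\<And>a. a \<in> k \<Longrightarrow> \<sigma> a = a"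
    have "\<sigma> ` Q = Q" using normal_overD[OF D(5) field_emb_subset[OF QL]] s ratfix[of \<sigma>] Q(2) by blast
    moreover have "\<sigma> ` k = k" using s(2) by (auto simp: image_iff)
    ultimately show "\<sigma> ` (k \<union> Q) = k \<union> Q" by (simp add: image_Un)
  qed
  have cnjrat: "cnj a = a" if "a \<in> \<rat>" for a using that by (auto elim: Rats_cases')
  have cQ: "cnj ` Q = Q" by (rule normal_overD[OF D(5) field_emb_cnj cnjrat])
  show cL: "cnj ` L = L" unfolding Q(2) by (subst image_generate_field[OF field_emb_cnj]) (simp add: image_Un cQ k(2))
  fix \<sigma> x assume s: "field_emb L \<sigma>" "\<And>a. a \<in> k \<Longrightarrow> \<sigma> a = a" and x: "x \<in> L"
  have cs: "field_emb L (\<lambda>x. cnj (\<sigma> (cnj x)))"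
    using s(1) cL unfolding field_emb_def by (auto simp: mem_cnj_image) (metis complex_cnj_add complex_cnj_mult complex_cnj_cnj mem_cnj_image)+
  show "cnj (\<sigma> (cnj x)) = \<sigma> x"
  proof (rule emb_eq_on_generate_field[OF cs[unfolded Q(2)] s(1)[unfolded Q(2)] _ x[unfolded Q(2)]])
    fix a assume "a \<in> k \<union> Q"
    then consider "a \<in> k" | "a \<in> Q" by auto
    then show "cnj (\<sigma> (cnj a)) = \<sigma> a"
    proof cases
      case 1
      then have "cnj a \<in> k" using k(2) by (metis imageI)
      then show ?thesis using s(2)[of a] s(2)[of "cnj a"] 1 by simp
    next
      case 2
      have rs: "restrict \<sigma> Q \<in> carrier (Gal Q \<rat>)" by (rule restrict_Gal[OF D(2,5) QL D(3) s(1) ratfix[OF s(2)]])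
      have rc: "restrict cnj Q \<in> carrier (Gal Q \<rat>)" by (rule restrict_Gal[OF D(2,5) subset_refl D(3) field_emb_cnj cnjrat])
      have "restrict \<sigma> Q (restrict cnj Q a) = restrict cnj Q (restrict \<sigma> Q a)"
        by (rule Zp_extension_comm[OF Q(1) rs rc 2])
      then show ?thesis using Gal_D(3)[OF D(2) rs 2] Gal_D(3)[OF D(2) rc 2] 2 by simp
    qed
  qed
qed

section \<open>Finite levels\<close>

text \<open>An element is built by finitely many field operations; this is what makes the levels of
  a composite depend on finitely many generators only.\<close>

lemma generate_field_finite:
  assumes "x \<in> generate_field CC A"
  shows "\<exists>B. finite B \<and> B \<subseteq> A \<and> x \<in> generate_field CC B"
  using assms
proof (induction rule: generate_field.induct)
  case one then show ?case using generate_field.one[of CC "{}"] by (intro exI[of _ "{}"]) auto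
next
  case (incl h) then show ?case by (intro exI[of _ "{h}"]) (auto intro: generate_field.incl)
next
  case (a_inv h) then show ?case using generate_field.a_inv by metis
next
  case (m_inv h) then show ?case using generate_field.m_inv by metis
next
  case (eng_add h1 h2)
  then obtain B1 B2 where B: "finite B1" "B1 \<subseteq> A" "h1 \<in> generate_field CC B1" "finite B2" "B2 \<subseteq> A" "h2 \<in> generate_field CC B2" by blast
  have "generate_field CC B1 \<subseteq> generate_field CC (B1 \<union> B2)" "generate_field CC B2 \<subseteq> generate_field CC (B1 \<union> B2)"
    by (rule generate_field_CC_subset[OF order_trans[OF _ generate_field_CC_incl] subfield_generate_field]; blast)+
  then show ?case using B generate_field.eng_add[of h1 CC "B1 \<union> B2" h2] by (intro exI[of _ "B1 \<union> B2"]) auto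
next
  case (eng_mult h1 h2)
  then obtain B1 B2 where B: "finite B1" "B1 \<subseteq> A" "h1 \<in> generate_field CC B1" "finite B2" "B2 \<subseteq> A" "h2 \<in> generate_field CC B2" by blast
  have "generate_field CC B1 \<subseteq> generate_field CC (B1 \<union> B2)" "generate_field CC B2 \<subseteq> generate_field CC (B1 \<union> B2)"
    by (rule generate_field_CC_subset[OF order_trans[OF _ generate_field_CC_incl] subfield_generate_field]; blast)+
  then show ?case using B generate_field.eng_mult[of h1 CC "B1 \<union> B2" h2] by (intro exI[of _ "B1 \<union> B2"]) auto
qed

lemma generate_field_finite_set:
  assumes "finite S" "S \<subseteq> generate_field CC A"
  shows "\<exists>B. finite B \<and> B \<subseteq> A \<and> S \<subseteq> generate_field CC B"
proof -
  have "\<forall>s\<in>S. \<exists>B. finite B \<and> B \<subseteq> A \<and> s \<in> generate_field CC B" using assms(2) generate_field_finite by blast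
  then obtain B where B: "\<And>s. s \<in> S \<Longrightarrow> finite (B s) \<and> B s \<subseteq> A \<and> s \<in> generate_field CC (B s)" by metis
  have "s \<in> generate_field CC (\<Union>s\<in>S. B s)" if "s \<in> S" for s
  proof -
    have "generate_field CC (B s) \<subseteq> generate_field CC (\<Union>s\<in>S. B s)"
      by (rule generate_field_CC_subset[OF order_trans[OF _ generate_field_CC_incl] subfield_generate_field]) (use that in blast)
    then show ?thesis using B[OF that] by blast
  qed
  then show ?thesis using B assms(1) by (intro exI[of _ "\<Union>s\<in>S. B s"]) auto
qed

lemma Gal_fix_generate_field:
  assumes L: "subfield L CC" and s: "\<sigma> \<in> carrier (Gal L k)" and B: "B \<subseteq> L" "\<And>b. b \<in> B \<Longrightarrow> \<sigma> b = b" and x: "x \<in> generate_field CC B"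
  shows "\<sigma> x = x"
proof (rule emb_eq_on_generate_field[OF _ _ _ x])
  show "field_emb (generate_field CC B) \<sigma>"
    by (rule field_emb_subset[OF generate_field_CC_subset[OF B(1) L] Gal_D(1)[OF L s]])
  show "field_emb (generate_field CC B) (\<lambda>x. x)" by (simp add: field_emb_def)
qed (rule B(2))

text \<open>A substitute at one level for a topological generator of \<open>H\<close>: the integers
  whose residues are values of the character on \<open>H\<close> form a subgroup of \<int>, and
  \<open>g\<close> is a preimage of its least positive element. Exponents are natural numbers
  because they will become degrees of polynomials.\<close>

lemma (in group) cyclic_image:
  fixes \<psi> :: "'a \<Rightarrow> int"
  assumes H: "subgroup H G" and q: "q > 0"
    and hom: "\<And>a b. a \<in> carrier G \<Longrightarrow> b \<in> carrier G \<Longrightarrow> \<psi> (a \<otimes> b) = (\<psi> a + \<psi> b) mod q"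
    and rng: "\<And>a. a \<in> carrier G \<Longrightarrow> 0 \<le> \<psi> a \<and> \<psi> a < q"
  shows "\<exists>g\<in>H. (\<forall>h\<in>H. \<exists>i::nat. \<psi> (h \<otimes> inv (g [^] i)) = 0) \<and> \<psi> (g [^] nat q) = 0"
proof -
  have md: "\<psi> a mod q = \<psi> a" if "a \<in> carrier G" for a using rng[OF that] by (simp add: mod_pos_pos_trivial)
  have one: "\<psi> \<one> = 0"
  proof -
    have "\<psi> \<one> = (\<psi> \<one> + \<psi> \<one>) mod q" using hom[of \<one> \<one>] by simp
    then have "(\<psi> \<one> + \<psi> \<one>) mod q = (\<psi> \<one> + 0) mod q" using md[of \<one>] by simp
    then have "\<psi> \<one> mod q = 0" by (simp add: mod_eq_dvd_iff mod_eq_0_iff_dvd)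
    then show ?thesis using md by simp
  qed
  have pow: "\<psi> (a [^] n) = (int n * \<psi> a) mod q" if "a \<in> carrier G" for a and n :: nat
  proof (induction n)
    case 0 then show ?case using one by simp
  next
    case (Suc n)
    have "\<psi> (a [^] Suc n) = ((int n * \<psi> a) mod q + \<psi> a) mod q"
      using hom[of "a [^] n" a] that Suc by (simp add: nat_pow_Suc)
    also have "\<dots> = (int n * \<psi> a + \<psi> a) mod q" by (rule mod_add_left_eq)
    finally show ?case by (simp add: algebra_simps)
  qed
  have diff: "\<psi> (a \<otimes> inv b) = (\<psi> a - \<psi> b) mod q" if "a \<in> carrier G" "b \<in> carrier G" for a b
  proof -
    have "\<psi> a = (\<psi> (a \<otimes> inv b) + \<psi> b) mod q" using hom[of "a \<otimes> inv b" b] that by (simp add: m_assoc)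
    then have "(\<psi> a - \<psi> b) mod q = (\<psi> (a \<otimes> inv b) + \<psi> b - \<psi> b) mod q" by (metis mod_diff_left_eq)
    then show ?thesis using md[of "a \<otimes> inv b"] that by simp
  qed
  note HG = subgroup.mem_carrier[OF H]
  define I where "I z \<longleftrightarrow> (\<exists>h\<in>H. \<psi> h = z mod q)" for z
  have Idiff: "I (x - y)" if "I x" "I y" for x y
  proof -
    obtain a b where "a \<in> H" "b \<in> H" "\<psi> a = x mod q" "\<psi> b = y mod q" using \<open>I x\<close> \<open>I y\<close> by (auto simp: I_def)
    then show ?thesis unfolding I_def using diff[of a b] HG subgroup.m_closed[OF H] subgroup.m_inv_closed[OF H]
      by (intro bexI[of _ "a \<otimes> inv b"]) (auto simp: mod_diff_eq)
  qed
  have I0: "I 0" unfolding I_def using one subgroup.one_closed[OF H] by (intro bexI[of _ \<one>]) auto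
  have Iadd: "I (x + y)" if "I x" "I y" for x y using Idiff[OF \<open>I x\<close> Idiff[OF I0 \<open>I y\<close>]] by simp
  have Imult: "I (int n * x)" if "I x" for n x
    by (induction n) (use I0 Iadd that in \<open>auto simp: algebra_simps\<close>)
  \<comment> \<open>The modulus \<open>q\<close> itself belongs to the subgroup, so a least positive
    element exists even when the character is zero on \<open>H\<close>.\<close>
  have "I (int (nat q)) \<and> nat q > 0" using q one subgroup.one_closed[OF H] by (auto simp: I_def intro!: bexI[of _ \<one>])
  then obtain d where d: "I (int d)" "d > 0" and least: "\<And>e. I (int e) \<Longrightarrow> e > 0 \<Longrightarrow> d \<le> e"
    using exists_least_iff[of "\<lambda>d. I (int d) \<and> d > 0"] by (metis not_le_imp_less)
  obtain g where g: "g \<in> H" "\<psi> g = int d mod q" using d by (auto simp: I_def)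
  have "\<exists>i::nat. \<psi> (h \<otimes> inv (g [^] i)) = 0" if h: "h \<in> H" for h
  proof -
    have r: "0 \<le> \<psi> h" "I (\<psi> h)" using rng HG h md by (auto simp: I_def)
    define i where "i = nat (\<psi> h) div d"
    define e where "e = nat (\<psi> h) mod d"
    have "int (nat (\<psi> h)) = int i * int d + int e" unfolding i_def e_def by (metis div_mult_mod_eq of_nat_add of_nat_mult)
    then have e: "\<psi> h = int i * int d + int e" using r by simp
    have "I (int e)" using Idiff[OF r(2) Imult[OF d(1), of i]] e by simp
    moreover have "e < d" using d by (simp add: e_def)
    ultimately have "e = 0" using least[of e] by auto
    then have "\<psi> h = int i * int d" using e by simp
    moreover have "\<psi> (g [^] i) = (int i * int d) mod q" using pow[of g i] g HG by (simp add: mod_mult_right_eq)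
    ultimately have "\<psi> (h \<otimes> inv (g [^] i)) = 0" using diff[of h "g [^] i"] h g HG by (simp add: mod_diff_right_eq)
    then show ?thesis by blast
  qed
  moreover have "\<psi> (g [^] nat q) = 0" using pow[of g "nat q"] g HG q by simp
  ultimately show ?thesis using g by blast
qed


section \<open>The fields of the theorem and the finite levels of Gal(K/k)\<close>

locale iwasawa_setting =
  fixes p :: nat and k k_cy k_an k_inf K :: "complex set"
  assumes CM: "CM_field k" and p: "Factorial_Ring.prime p" "odd p"
    and cy: "cyclotomic_Zp_extension p k k_cy" and an: "anticyclotomic_Zp_extension p k k_an"
    and K: "K = compositum k_cy k_an"
    and inf: "Zp_extension p k k_inf" "k_inf \<subseteq> K" "k_inf \<inter> k_an = k"
begin

lemmas k_sub = CM_field_cnj(1)[OF CM] and k_cnj = CM_field_cnj(2)[OF CM]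
lemmas cy_facts = cyclotomic_conj[OF k_sub k_cnj cy]

lemma an_Zp: "Zp_extension p k k_an" using an by (simp add: anticyclotomic_Zp_extension_def)
lemmas an_facts = Zp_extension_D[OF an_Zp]
lemmas an_conj = anticyclotomic_conj[OF k_cnj an]
lemmas inf_facts = Zp_extension_D[OF inf(1)]

lemma K_gen: "K = generate_field CC (k_cy \<union> k_an)" using K by (simp add: compositum_def)
lemma K_sub: "subfield K CC" unfolding K_gen by (rule subfield_generate_field)
lemma cy_K: "k_cy \<subseteq> K" and an_K: "k_an \<subseteq> K" unfolding K_gen using generate_field_CC_incl by blast+
lemma k_K: "k \<subseteq> K" using cy_K cy_facts(2) by blast

lemma K_alg: "x \<in> K \<Longrightarrow> alg_over k x"
  unfolding K_gen by (rule alg_over_generate_field[OF k_sub]) (use cy_facts(3) an_facts(4) in auto)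

lemma K_normal: "normal_over k K"
  unfolding K_gen
proof (rule normal_over_generate_field)
  fix \<sigma> assume s: "field_emb (generate_field CC (k_cy \<union> k_an)) \<sigma>" "\<And>a. a \<in> k \<Longrightarrow> \<sigma> a = a"
  then have e: "field_emb K \<sigma>" by (simp add: K_gen)
  show "\<sigma> ` (k_cy \<union> k_an) = k_cy \<union> k_an"
    using normal_overD[OF cy_facts(4) field_emb_subset[OF cy_K e] s(2)]
      normal_overD[OF an_facts(5) field_emb_subset[OF an_K e] s(2)] by (simp add: image_Un)
qed

lemma K_cnj: "cnj ` K = K"
  unfolding K_gen by (subst image_generate_field[OF field_emb_cnj]) (simp add: image_Un cy_facts(5) an_conj(1))

lemma Gal_cy:
  assumes "\<sigma> \<in> carrier (Gal K k)" "x \<in> k_cy" shows "\<sigma> x \<in> k_cy"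
proof -
  have "\<sigma> ` k_cy = k_cy"
    by (rule normal_overD[OF cy_facts(4) field_emb_subset[OF cy_K Gal_D(1)[OF K_sub assms(1)]] Gal_D(4)[OF K_sub assms(1)]])
  then show ?thesis using assms(2) by blast
qed

lemma Gal_an:
  assumes "\<sigma> \<in> carrier (Gal K k)" "x \<in> k_an" shows "\<sigma> x \<in> k_an"
proof -
  have "\<sigma> ` k_an = k_an"
    by (rule normal_overD[OF an_facts(5) field_emb_subset[OF an_K Gal_D(1)[OF K_sub assms(1)]] Gal_D(4)[OF K_sub assms(1)]])
  then show ?thesis using assms(2) by blast
qed

lemma restrict_an: "\<sigma> \<in> carrier (Gal K k) \<Longrightarrow> restrict \<sigma> k_an \<in> carrier (Gal k_an k)"
  by (rule restrict_Gal[OF an_facts(2,5) an_K an_facts(3) Gal_D(1)[OF K_sub] Gal_D(4)[OF K_sub]])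

lemma an_comm:
  assumes "\<sigma> \<in> carrier (Gal K k)" "\<tau> \<in> carrier (Gal K k)" "x \<in> k_an"
  shows "\<sigma> (\<tau> x) = \<tau> (\<sigma> x)"
  using Zp_extension_comm[OF an_Zp restrict_an[OF assms(1)] restrict_an[OF assms(2)] assms(3)] Gal_an assms by simp

text \<open>An element of \<open>k_an\<close> fixed by Gal(K/k_inf) lies in
  \<open>k_inf \<inter> k_an = k\<close>, so the restrictions of Gal(K/k_inf) to \<open>k_an\<close>
  have fixed field \<open>k\<close> and are dense.\<close>

lemma inf_approx:
  assumes s: "\<sigma> \<in> carrier (Gal K k)" and S: "finite S" "S \<subseteq> k_an"
  shows "\<exists>h\<in>carrier (Gal K k_inf). \<forall>s\<in>S. h s = \<sigma> s"
proof (rule emb_density[OF an_facts(1-4) _ _ _ _ field_emb_subset[OF an_K Gal_D(1)[OF K_sub s]] Gal_D(4)[OF K_sub s] S])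
  note mono = subsetD[OF Gal_mono[OF K_sub inf_facts(3)]]
  interpret H: group "Gal K k_inf" by (rule group_Gal[OF K_sub inf(2)])
  show "field_emb k_an \<tau> \<and> \<tau> ` k_an \<subseteq> k_an \<and> (\<forall>a\<in>k. \<tau> a = a)" if "\<tau> \<in> carrier (Gal K k_inf)" for \<tau>
    using field_emb_subset[OF an_K Gal_D(1)[OF K_sub that]] Gal_an[OF mono[OF that]] Gal_D(4)[OF K_sub mono[OF that]] by auto
  show "\<exists>\<sigma>\<in>carrier (Gal K k_inf). \<forall>x\<in>k_an. \<sigma> x = x"
    using an_K by (intro bexI[OF _ H.one_closed]) (auto simp: Gal_one)
  show "\<exists>\<rho>\<in>carrier (Gal K k_inf). \<forall>x\<in>k_an. \<rho> x = \<sigma> (\<tau> x)"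
    if "\<sigma> \<in> carrier (Gal K k_inf)" "\<tau> \<in> carrier (Gal K k_inf)" for \<sigma> \<tau>
    using an_K by (intro bexI[OF _ H.m_closed[OF that]]) (auto simp: Gal_mult_apply)
  fix y assume y: "y \<in> k_an" "\<And>\<sigma>. \<sigma> \<in> carrier (Gal K k_inf) \<Longrightarrow> \<sigma> y = y"
  have "y \<in> k_inf"
  proof (rule fixed_imp_base[OF inf_facts(2) inf(2) K_sub])
    show "normal_over k_inf K" by (rule normal_over_mono[OF K_normal inf_facts(3)])
    show "alg_over k_inf x" if "x \<in> K" for x by (rule alg_over_mono[OF inf_facts(3) K_alg[OF that]])
  qed (use y an_K in auto)
  then show "y \<in> k" using y(1) inf(3) by auto
qed

text \<open>Generators are sorted into those in \<open>k_cy\<close> and those in \<open>k_an\<close>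
  because conjugation acts differently on the two Galois groups.\<close>

lemma open_contains_stabilizer:
  assumes V: "openin (krull_topology K k) V" "(\<lambda>x\<in>K. x) \<in> V"
  obtains B1 B2 where "finite B1" "finite B2" "B1 \<subseteq> k_cy" "B2 \<subseteq> k_an"
    "\<And>\<sigma>. \<sigma> \<in> carrier (Gal K k) \<Longrightarrow> \<forall>b\<in>B1 \<union> B2. \<sigma> b = b \<Longrightarrow> \<sigma> \<in> V"
proof -
  obtain S where S: "finite S" "S \<subseteq> K" "\<And>\<sigma>. \<sigma> \<in> carrier (Gal K k) \<Longrightarrow> \<forall>s\<in>S. \<sigma> s = s \<Longrightarrow> \<sigma> \<in> V"
    using krull_open_contains_stabilizer[OF K_sub V] by blast
  obtain B where B: "finite B" "B \<subseteq> k_cy \<union> k_an" "S \<subseteq> generate_field CC B"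
    using generate_field_finite_set[OF S(1) S(2)[unfolded K_gen]] by blast
  have BK: "B \<subseteq> K" using B cy_K an_K by auto
  show thesis
  proof (rule that[of "B \<inter> k_cy" "B \<inter> k_an"])
    fix \<sigma> assume s: "\<sigma> \<in> carrier (Gal K k)" and f: "\<forall>b\<in>B \<inter> k_cy \<union> B \<inter> k_an. \<sigma> b = b"
    then have "\<sigma> b = b" if "b \<in> B" for b using that B(2) by auto
    then have "\<forall>x\<in>S. \<sigma> x = x" using Gal_fix_generate_field[OF K_sub s BK] B(3) by auto
    then show "\<sigma> \<in> V" by (rule S(3)[OF s])
  qed (use B in auto)
qed

text \<open>The restriction of the inverse of \<sigma> to a finite set \<open>S\<close> determines
  the coset of \<sigma>, and takes only finitely many values because elements of \<open>S\<close>
  have finitely many conjugates. The inverse is used because the cosets are right cosets.\<close>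

lemma finite_index:
  assumes V: "openin (krull_topology K k) V" "subgroup V (Gal K k)"
  shows "finite (rcosets\<^bsub>Gal K k\<^esub> V)"
proof -
  interpret G: group "Gal K k" by (rule group_Gal[OF K_sub k_K])
  have "(\<lambda>x\<in>K. x) \<in> V" using subgroup.one_closed[OF V(2)] by (simp add: Gal_one)
  then obtain S where S: "finite S" "S \<subseteq> K" "\<And>\<sigma>. \<sigma> \<in> carrier (Gal K k) \<Longrightarrow> \<forall>s\<in>S. \<sigma> s = s \<Longrightarrow> \<sigma> \<in> V"
    using krull_open_contains_stabilizer[OF K_sub V(1)] by blast
  define C where "C y = {\<sigma> y | \<sigma>. field_emb K \<sigma> \<and> (\<forall>a\<in>k. \<sigma> a = a)}" for y
  have fin: "finite (\<Pi>\<^sub>E s\<in>S. C s)"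
    using S(1,2) finite_conjugates[OF K_alg k_K k_sub K_sub] by (intro finite_PiE) (auto simp: C_def)
  define f where "f \<sigma> = restrict (inv\<^bsub>Gal K k\<^esub> \<sigma>) S" for \<sigma> :: "complex \<Rightarrow> complex"
  have fC: "f ` carrier (Gal K k) \<subseteq> (\<Pi>\<^sub>E s\<in>S. C s)"
    unfolding f_def C_def using Gal_D(1,4)[OF K_sub G.inv_closed] by auto
  have eq: "V #>\<^bsub>Gal K k\<^esub> \<sigma> = V #>\<^bsub>Gal K k\<^esub> \<tau>" if st: "\<sigma> \<in> carrier (Gal K k)" "\<tau> \<in> carrier (Gal K k)" "f \<sigma> = f \<tau>" for \<sigma> \<tau>
  proof -
    have "(\<sigma> \<otimes>\<^bsub>Gal K k\<^esub> inv\<^bsub>Gal K k\<^esub> \<tau>) s = s" if s: "s \<in> S" for s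
    proof -
      have "(inv\<^bsub>Gal K k\<^esub> \<tau>) s = (inv\<^bsub>Gal K k\<^esub> \<sigma>) s" using st(3) s unfolding f_def by (metis restrict_apply')
      moreover have "s \<in> K" using s S(2) by auto
      ultimately show ?thesis using Gal_inv(2)[OF K_sub k_K st(1)] by (simp add: Gal_mult_apply)
    qed
    then have "\<sigma> \<otimes>\<^bsub>Gal K k\<^esub> inv\<^bsub>Gal K k\<^esub> \<tau> \<in> V" using S(3) st by auto
    then have "\<sigma> \<in> V #>\<^bsub>Gal K k\<^esub> \<tau>"
      using st by (auto simp: r_coset_def G.m_assoc intro!: bexI[of _ "\<sigma> \<otimes>\<^bsub>Gal K k\<^esub> inv\<^bsub>Gal K k\<^esub> \<tau>"])
    then show ?thesis using G.repr_independence[OF _ st(2) V(2)] by simp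
  qed
  have "rcosets\<^bsub>Gal K k\<^esub> V \<subseteq> (\<lambda>y. V #>\<^bsub>Gal K k\<^esub> (SOME \<sigma>. \<sigma> \<in> carrier (Gal K k) \<and> f \<sigma> = y)) ` f ` carrier (Gal K k)"
  proof
    fix c assume "c \<in> rcosets\<^bsub>Gal K k\<^esub> V"
    then obtain \<sigma> where s: "\<sigma> \<in> carrier (Gal K k)" "c = V #>\<^bsub>Gal K k\<^esub> \<sigma>" by (auto simp: RCOSETS_def)
    define \<tau> where "\<tau> = (SOME \<tau>. \<tau> \<in> carrier (Gal K k) \<and> f \<tau> = f \<sigma>)"
    have "\<tau> \<in> carrier (Gal K k) \<and> f \<tau> = f \<sigma>" unfolding \<tau>_def by (rule someI[of _ \<sigma>]) (use s in auto)
    then have "c = V #>\<^bsub>Gal K k\<^esub> \<tau>" using eq[of \<tau> \<sigma>] s by simp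
    then show "c \<in> (\<lambda>y. V #>\<^bsub>Gal K k\<^esub> (SOME \<sigma>. \<sigma> \<in> carrier (Gal K k) \<and> f \<sigma> = y)) ` f ` carrier (Gal K k)"
      unfolding \<tau>_def using s(1) by blast
  qed
  then show ?thesis using finite_surj finite_subset[OF fC fin] by blast
qed

text \<open>The finite-level form of g\<gamma> and g^-1 \<gamma>: \<open>h1\<close> agrees with
  \<open>g\<close> on the finite set \<open>B2\<close> in \<open>k_an\<close>,
  \<open>\<gamma>\<close> is g^-1 h1, and \<open>h2\<close> is the complex conjugate of
  \<open>h1\<close>. That g h2 \<gamma>^-1 lies in \<open>V\<close> is tested on \<open>B1\<close>
  in \<open>k_cy\<close> and on \<open>B2\<close> separately.\<close>

lemma level:
  assumes V: "openin (krull_topology K k) V" "subgroup V (Gal K k)"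
  shows "\<exists>g\<in>carrier (Gal K k_cy). \<exists>\<gamma>\<in>carrier (Gal K k). \<exists>h1\<in>carrier (Gal K k_inf). \<exists>h2\<in>carrier (Gal K (cnj ` k_inf)). \<exists>m::nat.
    (\<forall>h\<in>carrier (Gal K k_cy). \<exists>i::nat. h \<otimes>\<^bsub>Gal K k\<^esub> inv\<^bsub>Gal K k\<^esub> (g [^]\<^bsub>Gal K k\<^esub> i) \<in> V) \<and>
    g [^]\<^bsub>Gal K k\<^esub> (p ^ m) \<in> V \<and> h1 = g \<otimes>\<^bsub>Gal K k\<^esub> \<gamma> \<and> (g \<otimes>\<^bsub>Gal K k\<^esub> h2) \<otimes>\<^bsub>Gal K k\<^esub> inv\<^bsub>Gal K k\<^esub> \<gamma> \<in> V"
proof -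
  let ?G = "Gal K k"
  interpret G: group ?G by (rule group_Gal[OF K_sub k_K])
  have "(\<lambda>x\<in>K. x) \<in> V" using subgroup.one_closed[OF V(2)] by (simp add: Gal_one)
  then obtain B1 B2 where B: "finite B1" "finite B2" "B1 \<subseteq> k_cy" "B2 \<subseteq> k_an"
    "\<And>\<sigma>. \<sigma> \<in> carrier ?G \<Longrightarrow> \<forall>b\<in>B1 \<union> B2. \<sigma> b = b \<Longrightarrow> \<sigma> \<in> V"
    using open_contains_stabilizer[OF V(1)] by blast
  have p0: "p > 0" using p(1) prime_gt_0_nat by auto
  obtain \<psi> m where psi:
    "\<And>\<sigma> \<tau>. \<sigma> \<in> carrier (Gal k_an k) \<Longrightarrow> \<tau> \<in> carrier (Gal k_an k) \<Longrightarrow> \<psi> (\<sigma> \<otimes>\<^bsub>Gal k_an k\<^esub> \<tau>) = (\<psi> \<sigma> + \<psi> \<tau>) mod int p ^ m"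
    "\<And>\<sigma>. \<sigma> \<in> carrier (Gal k_an k) \<Longrightarrow> 0 \<le> \<psi> \<sigma> \<and> \<psi> \<sigma> < int p ^ m"
    "\<And>\<sigma> s. \<sigma> \<in> carrier (Gal k_an k) \<Longrightarrow> \<psi> \<sigma> = 0 \<Longrightarrow> s \<in> B2 \<Longrightarrow> \<sigma> s = s"
    using Zp_extension_char[OF an_Zp B(2,4) p0] by blast
  define \<eta> where "\<eta> \<sigma> = \<psi> (restrict \<sigma> k_an)" for \<sigma>
  have eta: "\<eta> (\<sigma> \<otimes>\<^bsub>?G\<^esub> \<tau>) = (\<eta> \<sigma> + \<eta> \<tau>) mod int p ^ m" if st: "\<sigma> \<in> carrier ?G" "\<tau> \<in> carrier ?G" for \<sigma> \<tau>
  proof -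
    have "restrict (\<sigma> \<otimes>\<^bsub>?G\<^esub> \<tau>) k_an = restrict \<sigma> k_an \<otimes>\<^bsub>Gal k_an k\<^esub> restrict \<tau> k_an"
    proof
      fix x show "restrict (\<sigma> \<otimes>\<^bsub>?G\<^esub> \<tau>) k_an x = (restrict \<sigma> k_an \<otimes>\<^bsub>Gal k_an k\<^esub> restrict \<tau> k_an) x"
        using an_K Gal_an[OF st(2), of x] by (cases "x \<in> k_an") (auto simp: Gal_mult compose_def)
    qed
    then show ?thesis using psi(1)[OF restrict_an[OF st(1)] restrict_an[OF st(2)]] by (simp add: \<eta>_def)
  qed
  have rng: "0 \<le> \<eta> \<sigma> \<and> \<eta> \<sigma> < int p ^ m" if "\<sigma> \<in> carrier ?G" for \<sigma>
    unfolding \<eta>_def by (rule psi(2)[OF restrict_an[OF that]])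
  have ker: "\<sigma> b = b" if "\<sigma> \<in> carrier ?G" "\<eta> \<sigma> = 0" "b \<in> B2" for \<sigma> b
    using psi(3)[OF restrict_an[OF that(1)] that(2)[unfolded \<eta>_def] that(3)] B(4) that(3) by auto
  note subH = subgroup_Gal[OF K_sub cy_facts(2) cy_K]
  obtain g where g: "g \<in> carrier (Gal K k_cy)"
    "\<And>h. h \<in> carrier (Gal K k_cy) \<Longrightarrow> \<exists>i::nat. \<eta> (h \<otimes>\<^bsub>?G\<^esub> inv\<^bsub>?G\<^esub> (g [^]\<^bsub>?G\<^esub> i)) = 0" "\<eta> (g [^]\<^bsub>?G\<^esub> nat (int p ^ m)) = 0"
    using G.cyclic_image[OF subH _ eta rng] p0 by (metis of_nat_0_less_iff zero_less_power)
  \<comment> \<open>Elements of Gal(K/k_cy) fix \<open>B1\<close> anyway, so vanishing of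
    \<open>\<eta>\<close> suffices for membership in \<open>V\<close>.\<close>
  have HV: "h \<in> V" if h: "h \<in> carrier (Gal K k_cy)" "\<eta> h = 0" for h
  proof (rule B(5))
    show hG: "h \<in> carrier ?G" using subgroup.mem_carrier[OF subH h(1)] .
    show "\<forall>b\<in>B1 \<union> B2. h b = b" using ker[OF hG h(2)] Gal_D(4)[OF K_sub h(1)] B(3) by blast
  qed
  interpret H: group "Gal K k_cy" by (rule group_Gal[OF K_sub cy_K])
  have powH: "g [^]\<^bsub>?G\<^esub> n \<in> carrier (Gal K k_cy)" for n :: nat
    using subgroup.one_closed[OF subH] subgroup.m_closed[OF subH _ g(1)] by (induction n) (auto simp: nat_pow_Suc)
  have a: "\<exists>i::nat. h \<otimes>\<^bsub>?G\<^esub> inv\<^bsub>?G\<^esub> (g [^]\<^bsub>?G\<^esub> i) \<in> V" if h: "h \<in> carrier (Gal K k_cy)" for h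
    using g(2)[OF h] HV subgroup.m_closed[OF subH h subgroup.m_inv_closed[OF subH powH]] by blast
  have b: "g [^]\<^bsub>?G\<^esub> (p ^ m) \<in> V" using HV[OF powH, of "p ^ m"] g(3) by (simp add: nat_power_eq)
  have gG: "g \<in> carrier ?G" using subgroup.mem_carrier[OF subH g(1)] .
  obtain h1 where h1: "h1 \<in> carrier (Gal K k_inf)" "\<And>s. s \<in> B2 \<Longrightarrow> h1 s = g s" using inf_approx[OF gG B(2,4)] by blast
  have h1G: "h1 \<in> carrier ?G" using h1(1) Gal_mono[OF K_sub inf_facts(3)] by blast
  define h2 where "h2 = conj_aut K h1"
  have h2: "h2 \<in> carrier (Gal K (cnj ` k_inf))" using conj_aut_Gal[OF K_sub inf(2) h1(1)] by (simp add: h2_def K_cnj)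
  have h2G: "h2 \<in> carrier ?G" using conj_aut_Gal[OF K_sub k_K h1G] by (simp add: h2_def K_cnj k_cnj)
  \<comment> \<open>\<open>\<gamma>\<close> fixes \<open>B2\<close>, though possibly not all of
    \<open>k_an\<close>; this is enough at the level \<open>V\<close>.\<close>
  define \<gamma> where "\<gamma> = inv\<^bsub>?G\<^esub> g \<otimes>\<^bsub>?G\<^esub> h1"
  have gamma: "\<gamma> \<in> carrier ?G" "h1 = g \<otimes>\<^bsub>?G\<^esub> \<gamma>" using gG h1G by (auto simp: \<gamma>_def G.m_assoc[symmetric])
  have h1_app: "h1 x = g (\<gamma> x)" if "x \<in> K" for x using that by (simp add: gamma(2) Gal_mult_apply)
  define v where "v = (g \<otimes>\<^bsub>?G\<^esub> h2) \<otimes>\<^bsub>?G\<^esub> inv\<^bsub>?G\<^esub> \<gamma>"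
  have vG: "v \<in> carrier ?G" using gG h2G gamma by (simp add: v_def)
  have "v b = b" if b: "b \<in> B1 \<union> B2" for b
  proof -
    define w where "w = (inv\<^bsub>?G\<^esub> \<gamma>) b"
    have bK: "b \<in> K" using b B(3,4) cy_K an_K by auto
    have wK: "w \<in> K" unfolding w_def using Gal_D(3)[OF K_sub G.inv_closed[OF gamma(1)] bK] .
    have gw: "\<gamma> w = b" unfolding w_def by (rule Gal_inv(2)[OF K_sub k_K gamma(1) bK])
    have hw: "h1 w = g b" using h1_app[OF wK] gw by simp
    have vb: "v b = g (h2 w)" unfolding v_def w_def using bK wK[unfolded w_def] by (simp add: Gal_mult_apply)
    show ?thesis
    proof (cases "b \<in> B2")
      case True
      then have ban: "b \<in> k_an" using B(4) by auto
      \<comment> \<open>On \<open>k_an\<close> the automorphism \<open>h2\<close> is inverse to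
        \<open>h1\<close>, which agrees with \<open>g\<close> at \<open>b\<close>; so g h2 fixes
        \<open>b\<close>, as the two factors commute there.\<close>
      have "h1 w = h1 b" using hw h1(2)[OF True] by simp
      then have wb: "w = b" using inj_onD[OF Gal_D(6)[OF K_sub h1G]] wK bK by blast
      have "h2 (g b) = cnj (h1 (cnj (h1 b)))" using h1(2)[OF True] Gal_D(3)[OF K_sub gG bK] by (simp add: h2_def conj_aut_apply)
      also have "\<dots> = b"
      proof -
        have "cnj (h1 b) \<in> k_an" using Gal_an[OF h1G ban] an_conj(1) by (metis imageI)
        then show ?thesis using an_conj(2)[OF restrict_an[OF h1G] ban] ban by simp
      qed
      finally have "h2 (g b) = b" .
      then show ?thesis using vb wb an_comm[OF gG h2G ban] by simp
    next
      case False
      then have bcy: "b \<in> k_cy" using b B(3) by auto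
      have wcy: "w \<in> k_cy" unfolding w_def by (rule Gal_cy[OF G.inv_closed[OF gamma(1)] bcy])
      \<comment> \<open>On \<open>k_cy\<close> conjugation commutes with \<open>h1\<close>, and
        \<open>g\<close> acts trivially.\<close>
      have "h2 w = h1 w"
        using cy_facts(6)[OF field_emb_subset[OF cy_K Gal_D(1)[OF K_sub h1G]] Gal_D(4)[OF K_sub h1G] wcy] wK
        by (simp add: h2_def conj_aut_apply)
      then show ?thesis using vb hw Gal_D(4)[OF K_sub g(1) bcy] by simp
    qed
  qed
  then have "v \<in> V" using B(5)[OF vG] by blast
  then show ?thesis using g(1) gamma h1(1) h2 a b unfolding v_def by blast
qed

end

section \<open>An ideal of integer polynomials\<close>

text \<open>The inner binomial coefficients are divisible by p, and \<open>(- 1) ^ p = - 1\<close>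
  for odd p.\<close>

lemma prime_dvd_pow_minus_1:
  fixes a :: "int poly"
  assumes p: "Factorial_Ring.prime p" "odd p"
  shows "of_nat p dvd (a - 1) ^ p - (a ^ p - 1)"
proof -
  have p0: "p > 0" using p(1) prime_gt_0_nat by auto
  have "(a - 1) ^ p = (\<Sum>k\<le>p. of_nat (p choose k) * a ^ k * (- 1) ^ (p - k))"
    using binomial_ring[of a "-1" p] by simp
  also have "{..p} = insert 0 (insert p {0<..<p})" using p0 by auto
  also have "(\<Sum>k\<in>insert 0 (insert p {0<..<p}). of_nat (p choose k) * a ^ k * (- 1) ^ (p - k))
    = a ^ p - 1 + (\<Sum>k\<in>{0<..<p}. of_nat (p choose k) * a ^ k * (- 1) ^ (p - k))"
    using p0 p(2) by simp
  finally have "(a - 1) ^ p - (a ^ p - 1) = (\<Sum>k\<in>{0<..<p}. of_nat (p choose k) * a ^ k * (- 1) ^ (p - k))" by simp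
  moreover have "of_nat p dvd (of_nat (p choose k) :: int poly)" if "k \<in> {0<..<p}" for k
      proof -
    have "p dvd p choose k" by (rule dvd_choose_prime) (use that p in auto)
    then show ?thesis by (metis dvdE dvd_triv_left of_nat_mult)
  qed
  ultimately show ?thesis by (auto intro!: dvd_sum dvd_mult2)
qed

text \<open>Iterates the previous congruence, using that x - y divides x^p - y^p. It makes T - 1
  nilpotent modulo p and T^(p^m) - 1.\<close>

lemma prime_power_dvd_pow_minus_1:
  fixes a :: "int poly"
  assumes p: "Factorial_Ring.prime p" "odd p"
  shows "of_nat p dvd (a - 1) ^ (p ^ m) - (a ^ (p ^ m) - 1)"
proof (induction m)
  case (Suc m)
  have "(a - 1) ^ p ^ m - (a ^ p ^ m - 1) dvd ((a - 1) ^ p ^ m) ^ p - (a ^ p ^ m - 1) ^ p"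
    by (simp add: power_diff_sumr2)
  then have 1: "of_nat p dvd ((a - 1) ^ p ^ m) ^ p - (a ^ p ^ m - 1) ^ p" using Suc dvd_trans by blast
  have 2: "of_nat p dvd (a ^ p ^ m - 1) ^ p - ((a ^ p ^ m) ^ p - 1)" by (rule prime_dvd_pow_minus_1[OF p])
  have "((a - 1) ^ p ^ m) ^ p - (a ^ p ^ m - 1) ^ p + ((a ^ p ^ m - 1) ^ p - ((a ^ p ^ m) ^ p - 1))
    = (a - 1) ^ p ^ Suc m - (a ^ p ^ Suc m - 1)"
    by (simp add: power_mult[symmetric] mult.commute)
  then show ?case using dvd_add[OF 1 2] by metis
qed simp

text \<open>In \<int>[T]/(p, d^n) with d = T - 1, a polynomial u with u(1) prime to p is a unit, so
  ud in the ideal should give d. Only the constant u(1) is inverted, modulo p: this gives d + d^2 C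
  w in the ideal, which lowers a power of d in the ideal by one exponent at a time, starting from
  d^n.\<close>

lemma ideal_descent:
  fixes I :: "int poly \<Rightarrow> bool" and d u :: "int poly"
  assumes p: "Factorial_Ring.prime p"
    and add: "\<And>x y. I x \<Longrightarrow> I y \<Longrightarrow> I (x + y)" and mult: "\<And>x y. I x \<Longrightarrow> I (y * x)"
    and Ip: "I (of_nat p)" and nil: "I ([:-1, 1:] ^ n)"
    and u: "I (u * [:-1, 1:])" "\<not> int p dvd poly u 1"
  shows "I [:-1, 1:]"
proof -
  define d :: "int poly" where "d = [:-1, 1:]"
  define U where "U = [:poly u 1:]"
  have "poly (u - U) 1 = 0" by (simp add: U_def)
  then obtain w where "u - U = d * w" unfolding poly_eq_0_iff_dvd d_def by (elim dvdE)
  then have w: "u = U + d * w" by (simp add: algebra_simps)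
  have "coprime (poly u 1) (int p)" using u(2) p
    by (metis coprime_commute prime_imp_coprime prime_nat_int_transfer)
  then obtain c where "[poly u 1 * c = 1] (mod int p)" using cong_solve_coprime_int by blast
  then have "int p dvd poly u 1 * c - 1" by (simp add: cong_iff_dvd_diff)
  then obtain k where "poly u 1 * c - 1 = int p * k" by (elim dvdE)
  then have k: "poly u 1 * c = 1 + int p * k" by simp
  define C where "C = [:c:]"
  define D where "D = [:k:]"
  have CU: "C * U = 1 + of_nat p * D"
    using k by (simp add: C_def D_def U_def of_nat_poly one_pCons mult.commute)
  have "C * (u * d) = (C * U) * d + d ^ 2 * (C * w)"
    unfolding w by (simp only: algebra_simps power2_eq_square)
  then have "d + d ^ 2 * (C * w) = C * (u * d) + (- (d * D)) * of_nat p"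
    unfolding CU by (simp add: algebra_simps)
  then have e: "I (d + d ^ 2 * (C * w))" using add[OF mult[OF u(1)] mult[OF Ip]] unfolding d_def by metis
  \<comment> \<open>Downward induction on the exponent.\<close>
  have "I (d ^ Suc j)" if "j \<le> n" for j
    using that
  proof (induction j rule: inc_induct)
    case base
    have "I (d * d ^ n)" using mult nil d_def by blast
    then show ?case by simp
  next
    case (step j)
    have "d ^ Suc j = d ^ j * (d + d ^ 2 * (C * w)) + (- (C * w)) * d ^ Suc (Suc j)"
      by (simp add: algebra_simps power2_eq_square)
    then show ?case using add[OF mult[OF e] mult[OF step.IH]] by metis
  qed
  from this[of 0] show ?thesis by (simp add: d_def)
qed

text \<open>T stands for \<open>g\<close> and \<open>F\<close> for the action of \<gamma> on x;
  \<open>I1\<close> and \<open>I2\<close> will be the polynomials that kill x, modulo p and a level,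
  in the two quotients.\<close>

lemma int_poly_dichotomy:
  fixes F :: "int poly" and I1 I2 :: "int poly \<Rightarrow> bool"
  assumes p: "Factorial_Ring.prime p" "odd p"
    and add: "\<And>x y. I1 x \<Longrightarrow> I1 y \<Longrightarrow> I1 (x + y)" "\<And>x y. I2 x \<Longrightarrow> I2 y \<Longrightarrow> I2 (x + y)"
    and mult: "\<And>x y. I1 x \<Longrightarrow> I1 (y * x)" "\<And>x y. I2 x \<Longrightarrow> I2 (y * x)"
    and Ip: "I1 (of_nat p)" "I2 (of_nat p)"
    and cyc: "I1 ([:0, 1:] ^ (p ^ m) - 1)" "I2 ([:0, 1:] ^ (p ^ m) - 1)"
    and F: "I1 ([:0, 1:] * F - 1)" "I2 (F - [:0, 1:])"
  shows "I1 [:-1, 1:] \<or> I2 [:-1, 1:]"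
proof -
  define d :: "int poly" where "d = [:-1, 1:]"
  have dT: "d = [:0, 1:] - 1" by (simp add: d_def one_pCons)
  obtain e where "d ^ (p ^ m) - ([:0, 1:] ^ (p ^ m) - 1) = of_nat p * e"
    using prime_power_dvd_pow_minus_1[OF p, of "[:0, 1:]" m] unfolding dT by (elim dvdE)
  then have e: "d ^ (p ^ m) = ([:0, 1:] ^ (p ^ m) - 1) + e * of_nat p" by (simp add: algebra_simps)
  have nil: "I1 (d ^ (p ^ m))" "I2 (d ^ (p ^ m))" unfolding e using add mult Ip cyc by auto
  show ?thesis
  proof (cases "int p dvd poly F 1 - 1")
    case False
    \<comment> \<open>Here T F - 1 plays the role of u: its value F(1) - 1 at 1 is prime to
      p.\<close>
    have "I1 (([:0, 1:] * F - 1) * d)" using mult(1)[OF F(1), of d] by (simp add: mult.commute)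
    then have "I1 d" unfolding d_def
      using ideal_descent[OF p(1) add(1) mult(1) Ip(1) nil(1)[unfolded d_def], of "[:0, 1:] * F - 1"] False by simp
    then show ?thesis by (simp add: d_def)
  next
    case True
    then obtain k where "poly F 1 - 1 = int p * k" by (elim dvdE)
    then have k: "poly F 1 = 1 + int p * k" by simp
    \<comment> \<open>The value at 1 is divisible by p but need not vanish. The constant
      \<open>p k\<close>, which lies in both ideals, is subtracted before dividing by d.\<close>
    have "poly ([:0, 1:] * F - 1 - [:int p * k:]) 1 = 0" using k by simp
    then obtain u where u: "[:0, 1:] * F - 1 - [:int p * k:] = d * u" unfolding poly_eq_0_iff_dvd d_def by (elim dvdE)
    have "poly (F - [:0, 1:] - [:int p * k:]) 1 = 0" using k by simp
    then obtain v where v: "F - [:0, 1:] - [:int p * k:] = d * v" unfolding poly_eq_0_iff_dvd d_def by (elim dvdE)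
    have pk: "[:int p * k:] = [:k:] * of_nat p" by (simp add: of_nat_poly mult.commute)
    have "u * d = ([:0, 1:] * F - 1) + (- [:k:]) * of_nat p" using u unfolding pk by (simp add: algebra_simps)
    then have Iu: "I1 (u * d)" using add(1)[OF F(1) mult(1)[OF Ip(1)]] by metis
    have "v * d = (F - [:0, 1:]) + (- [:k:]) * of_nat p" using v unfolding pk by (simp add: algebra_simps)
    then have Iv: "I2 (v * d)" using add(2)[OF F(2) mult(2)[OF Ip(2)]] by metis
    define T :: "int poly" where "T = [:0, 1:]"
    have "d * (u - v) = (T * F - 1 - [:int p * k:]) - (F - T - [:int p * k:])"
      using u v by (simp add: T_def right_diff_distrib)
    also have "\<dots> = (T - 1) * (F + 1)" by (simp add: algebra_simps)
    finally have "d * (u - v) = d * (F + 1)" by (simp add: dT T_def)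
    moreover have "d \<noteq> 0" by (simp add: d_def)
    ultimately have "u - v = F + 1" by (metis mult_left_cancel)
    then have "poly u 1 - poly v 1 = poly F 1 + 1" by (metis poly_1 poly_add poly_diff)
    then have two: "poly u 1 - poly v 1 = 2 + int p * k" using k by simp
    have "\<not> int p dvd poly u 1 \<or> \<not> int p dvd poly v 1"
    proof (rule ccontr)
      assume "\<not> ?thesis"
      then have "int p dvd (poly u 1 - poly v 1) - int p * k" by auto
      then have "int p dvd 2" using two by simp
      then have "p dvd 2" by (metis int_dvd_int_iff of_nat_numeral)
      then have "p = 2" using p(1) by (metis primes_dvd_imp_eq two_is_prime_nat)
      then show False using p(2) by simp
    qed
    then show ?thesis
      using ideal_descent[OF p(1) add(1) mult(1) Ip(1) nil(1)[unfolded d_def] Iu[unfolded d_def]]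
        ideal_descent[OF p(1) add(2) mult(2) Ip(2) nil(2)[unfolded d_def] Iv[unfolded d_def]] by blast
  qed
qed

section \<open>The p-rank of modules generated by one element modulo p\<close>

text \<open>Connects the additive group of a module record with a quotient group: two records that
  share carrier, product and unit, while their further fields may differ.\<close>

lemma monoid_cong:
  assumes "carrier G = carrier G'" "\<And>x y. x \<otimes>\<^bsub>G\<^esub> y = x \<otimes>\<^bsub>G'\<^esub> y" "\<one>\<^bsub>G\<^esub> = \<one>\<^bsub>G'\<^esub>"
  shows "m_inv G x = m_inv G' x" "subgroup N G \<longleftrightarrow> subgroup N G'" "comm_group G \<Longrightarrow> comm_group G'"
proof -
  show inv: "m_inv G x = m_inv G' x" for x by (simp add: m_inv_def assms)
  show "subgroup N G \<longleftrightarrow> subgroup N G'" by (simp add: subgroup_def assms inv)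
  show "comm_group G'" if "comm_group G"
  proof -
    interpret comm_group G by (rule that)
    show ?thesis
    proof (rule comm_groupI, unfold assms[symmetric])
      show "\<And>x y. x \<in> carrier G \<Longrightarrow> y \<in> carrier G \<Longrightarrow> x \<otimes>\<^bsub>G\<^esub> y = y \<otimes>\<^bsub>G\<^esub> x" by (rule m_comm)
    qed (auto simp: m_assoc)
  qed
qed

lemma quotient_module_ops:
  "carrier (quotient_module M N) = rcosets\<^bsub>add_monoid M\<^esub> N"
  "x \<oplus>\<^bsub>quotient_module M N\<^esub> y = x <#>\<^bsub>add_monoid M\<^esub> y" "\<zero>\<^bsub>quotient_module M N\<^esub> = N"
  by (simp_all add: quotient_module_def A_RCOSETS_def set_add_def)

lemma comm_group_quotient_module:
  assumes "comm_group (add_monoid M)" "subgroup N (add_monoid M)"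
  shows "comm_group (add_monoid (quotient_module M N))"
proof -
  have 1: "comm_group (add_monoid M Mod N)" by (rule comm_group.abelian_FactGroup[OF assms])
  have 2: "carrier (add_monoid M Mod N) = carrier (add_monoid (quotient_module M N))"
    "\<And>x y. x \<otimes>\<^bsub>add_monoid M Mod N\<^esub> y = x \<otimes>\<^bsub>add_monoid (quotient_module M N)\<^esub> y"
    "\<one>\<^bsub>add_monoid M Mod N\<^esub> = \<one>\<^bsub>add_monoid (quotient_module M N)\<^esub>"
    by (simp_all add: quotient_module_ops FactGroup_def)
  show ?thesis by (rule monoid_cong(3)[OF 2 1])
qed

lemma rcos_sum_comm:
  assumes "comm_group G" "subgroup N G" "x \<in> carrier G" "y \<in> carrier G"
  shows "(N #>\<^bsub>G\<^esub> x) <#>\<^bsub>G\<^esub> (N #>\<^bsub>G\<^esub> y) = N #>\<^bsub>G\<^esub> (x \<otimes>\<^bsub>G\<^esub> y)"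
  using normal.rcos_sum[OF comm_group.subgroup_imp_normal[OF assms(1,2)] assms(3,4)] .

text \<open>The tensor product is spanned by 1 \<otimes> e, because 1 \<otimes> pw = p \<otimes> w =
  0. Multiples are written as powers in the additive group; of the scalar action only closure is
  assumed, which places the third family of tensor relations inside the free group.\<close>

lemma p_rank_le_1:
  fixes Q :: "(nat \<Rightarrow> int, 'y) module"
  assumes Q: "comm_group (add_monoid Q)" and p: "p > 1" and e: "e \<in> carrier Q"
    and smult: "\<And>r x. r \<in> carrier (Zp p) \<Longrightarrow> x \<in> carrier Q \<Longrightarrow> r \<odot>\<^bsub>Q\<^esub> x \<in> carrier Q"
    and gen: "\<And>y. y \<in> carrier Q \<Longrightarrow> \<exists>(z::nat). \<exists>w\<in>carrier Q.
      y = (e [^]\<^bsub>add_monoid Q\<^esub> z) \<oplus>\<^bsub>Q\<^esub> (w [^]\<^bsub>add_monoid Q\<^esub> p)"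
  shows "p_rank p Q \<le> 1"
proof -
  define S where "S = residue_ring (int p)"
  have cS: "carrier S = {0..int p - 1}" and addS: "\<And>a b. a \<oplus>\<^bsub>S\<^esub> b = (a + b) mod int p"
    by (auto simp: S_def residue_ring_def)
  define F where "F = free_Abelian_group (carrier S \<times> carrier Q)"
  define rels where "rels = tensor_relations (Zp p) S (\<lambda>a. a 1) Q"
  define Gn where "Gn = generate F (rels)"
  define F' :: "(int, int \<times> 'y \<Rightarrow>\<^sub>0 int) module" where "F' = \<lparr>carrier = carrier F, monoid.mult = undefined, one = undefined,
        ring.zero = \<one>\<^bsub>F\<^esub>, add = monoid.mult F, smult = (\<lambda>s. frag_extend (\<lambda>(a, x). frag_of (s \<otimes>\<^bsub>S\<^esub> a, x)))\<rparr>"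
  define V where "V = quotient_module F' Gn"
  have prV: "p_rank p Q = vs_dim S V"
    by (simp add: p_rank_def base_change_def V_def F'_def Gn_def F_def rels_def S_def Let_def)
  have cgF: "comm_group F" by (simp add: F_def abelian_free_Abelian_group)
  interpret F: comm_group F by (rule cgF)
  interpret Q: comm_group "add_monoid Q" by (rule Q)
  have multS: "\<And>a b. a \<otimes>\<^bsub>S\<^esub> b = (a * b) mod int p" and pS: "\<And>a. a mod int p \<in> carrier S"
    using p by (auto simp: S_def residue_ring_def)
  have addQ: "x \<oplus>\<^bsub>Q\<^esub> y \<in> carrier Q" if "x \<in> carrier Q" "y \<in> carrier Q" for x y
    using Q.m_closed[of x y] that by simp
  have fragF: "frag_of (a, y) \<in> carrier F" if "a \<in> carrier S" "y \<in> carrier Q" for a y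
    using that by (simp add: F_def)
  have multF: "f \<otimes>\<^bsub>F\<^esub> g = f + g" for f g by (simp add: F_def)
  have invF: "f \<in> carrier F \<Longrightarrow> inv\<^bsub>F\<^esub> f = - f" for f by (simp add: F_def)
  have addF: "f + g \<in> carrier F" if "f \<in> carrier F" "g \<in> carrier F" for f g
    using F.m_closed[OF that] by (simp add: multF)
  have diffF: "f - g \<in> carrier F" if "f \<in> carrier F" "g \<in> carrier F" for f g
    using addF[OF that(1) F.inv_closed[OF that(2)]] invF[OF that(2)] by simp
  have relsF: "rels \<subseteq> carrier F"
    unfolding rels_def tensor_relations_def
    using smult addQ pS by (auto simp: addS multS intro!: addF diffF fragF)
  have Gn: "subgroup Gn F" unfolding Gn_def by (rule F.generate_is_subgroup[OF relsF])
  have cV: "carrier V = rcosets\<^bsub>F\<^esub> Gn" and addV: "\<And>x y. x \<oplus>\<^bsub>V\<^esub> y = x <#>\<^bsub>F\<^esub> y" and zV: "\<zero>\<^bsub>V\<^esub> = Gn"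
    unfolding V_def quotient_module_ops by (simp_all add: F'_def RCOSETS_def r_coset_def set_mult_def)
  have eqV: "carrier (F Mod Gn) = carrier (add_monoid V)" "\<And>x y. x \<otimes>\<^bsub>F Mod Gn\<^esub> y = x \<otimes>\<^bsub>add_monoid V\<^esub> y"
    "\<one>\<^bsub>F Mod Gn\<^esub> = \<one>\<^bsub>add_monoid V\<^esub>"
    by (simp_all add: FactGroup_def cV addV zV)
  interpret V: comm_group "F Mod Gn" using comm_group.abelian_FactGroup[OF cgF Gn] .
  define b where "b = Gn #>\<^bsub>F\<^esub> frag_of (1, e)"
  have span: "carrier V \<subseteq> N" if N: "submodule N S V" "b \<in> N" for N
  proof -
    have sN: "subgroup N (F Mod Gn)" using submodule.axioms(1)[OF N(1)] monoid_cong(2)[OF eqV] by blast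
    \<comment> \<open>\<open>P f\<close> says that the class of \<open>f\<close> lies in the
      submodule \<open>N\<close>. It is additive and holds for the relations, so it only has to be
      pushed from (1, e) to all generators.\<close>
    define P where "P f \<longleftrightarrow> f \<in> carrier F \<and> Gn #>\<^bsub>F\<^esub> f \<in> N" for f
    have coset0: "Gn #>\<^bsub>F\<^esub> f = Gn" if "f \<in> Gn" for f using that Gn F.coset_join2 subgroup.mem_carrier by metis
    have PG: "P f" if "f \<in> Gn" for f
      using that coset0[OF that] subgroup.one_closed[OF sN] subgroup.mem_carrier[OF Gn] by (simp add: P_def)
    have Padd: "P (f + g)" if "P f" "P g" for f g
    proof -
      have fg: "f \<in> carrier F" "g \<in> carrier F" "Gn #>\<^bsub>F\<^esub> f \<in> N" "Gn #>\<^bsub>F\<^esub> g \<in> N" using that by (auto simp: P_def)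
      have "(Gn #>\<^bsub>F\<^esub> f) <#>\<^bsub>F\<^esub> (Gn #>\<^bsub>F\<^esub> g) \<in> N" using subgroup.m_closed[OF sN fg(3,4)] by simp
      then show ?thesis using rcos_sum_comm[OF cgF Gn fg(1,2)] F.m_closed[OF fg(1,2)] by (simp add: P_def multF)
    qed
    have Pminus: "P (- f)" if "P f" for f
    proof -
      have f: "f \<in> carrier F" "Gn #>\<^bsub>F\<^esub> f \<in> N" using that by (auto simp: P_def)
      have n: "Gn \<lhd> F" by (rule F.subgroup_imp_normal[OF Gn])
      have "Gn #>\<^bsub>F\<^esub> f \<in> carrier (F Mod Gn)" using f(1) by (auto simp: FactGroup_def RCOSETS_def)
      then have "inv\<^bsub>F Mod Gn\<^esub> (Gn #>\<^bsub>F\<^esub> f) = Gn #>\<^bsub>F\<^esub> (inv\<^bsub>F\<^esub> f)"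
        using normal.inv_FactGroup[OF n] normal.rcos_inv[OF n f(1)] by simp
      then show ?thesis using subgroup.m_inv_closed[OF sN f(2)] f(1) F.inv_closed[OF f(1)] by (simp add: P_def invF)
    qed
    have Pdiff: "P (f - g)" if "P f" "P g" for f g using Padd[OF that(1) Pminus[OF that(2)]] by simp
    have rel1: "P (frag_of (a \<oplus>\<^bsub>S\<^esub> b, x) - (frag_of (a, x) + frag_of (b, x)))"
      if "a \<in> carrier S" "b \<in> carrier S" "x \<in> carrier Q" for a b x
      by (rule PG, unfold Gn_def, rule generate.incl) (use that in \<open>auto simp: rels_def tensor_relations_def\<close>)
    have rel2: "P (frag_of (a, x \<oplus>\<^bsub>Q\<^esub> y) - (frag_of (a, x) + frag_of (a, y)))"
      if "a \<in> carrier S" "x \<in> carrier Q" "y \<in> carrier Q" for a x y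
      by (rule PG, unfold Gn_def, rule generate.incl) (use that in \<open>auto simp: rels_def tensor_relations_def\<close>)
    have Pe: "P (frag_of (1, e))" using N(2) fragF[of 1 e] e p cS by (simp add: P_def b_def)
    have S1: "1 \<in> carrier S" "0 \<in> carrier S" using p cS by auto
    have P0: "P (frag_of (0, x))" if x: "x \<in> carrier Q" for x
    proof -
      have "P (- (frag_of (0, x) - (frag_of (0, x) + frag_of (0, x))))"
        using Pminus[OF rel1[OF S1(2) S1(2) x]] p by (simp add: addS)
      then show ?thesis by (simp add: algebra_simps)
    qed
    have step: "P (f + g)" if "P (f - h)" "P (h + g)" for f g h
      using Padd[OF that] by simp
    \<comment> \<open>The residue of k times the generator: at k = p the left side becomes the
      generator over 0, and this is where multiples of p die.\<close>
    have Pk: "P (frag_of (int k mod int p, x) - frag_cmul (int k) (frag_of (1, x)))" if x: "x \<in> carrier Q" for k x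
    proof (induction k)
      case 0 then show ?case using P0[OF x] by simp
    next
      case (Suc k)
      have "int k mod int p \<in> carrier S" using p by (auto simp: cS)
      moreover have "(int k mod int p) \<oplus>\<^bsub>S\<^esub> 1 = int (Suc k) mod int p" by (simp add: addS mod_add_left_eq mod_add_right_eq add.commute)
      ultimately have "P (frag_of (int (Suc k) mod int p, x) - (frag_of (int k mod int p, x) + frag_of (1, x)))"
        using rel1[OF _ S1(1) x, of "int k mod int p"] by simp
      from Padd[OF this Suc] show ?case by (simp add: frag_cmul_distrib algebra_simps)
    qed
    have Pw: "P (frag_of (1, w [^]\<^bsub>add_monoid Q\<^esub> k) - frag_cmul (int k) (frag_of (1, w)))" if w: "w \<in> carrier Q" for k :: nat and w
    proof (induction k)
      case 0
      have z: "\<zero>\<^bsub>Q\<^esub> \<in> carrier Q" "\<zero>\<^bsub>Q\<^esub> \<oplus>\<^bsub>Q\<^esub> \<zero>\<^bsub>Q\<^esub> = \<zero>\<^bsub>Q\<^esub>" using Q.one_closed Q.l_one[OF Q.one_closed] by auto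
      have "P (- (frag_of (1, \<zero>\<^bsub>Q\<^esub>) - (frag_of (1, \<zero>\<^bsub>Q\<^esub>) + frag_of (1, \<zero>\<^bsub>Q\<^esub>))))"
        using Pminus[OF rel2[OF S1(1) z(1) z(1)]] z by simp
      then show ?case by simp
    next
      case (Suc k)
      have "w [^]\<^bsub>add_monoid Q\<^esub> k \<in> carrier Q" using Q.nat_pow_closed[of w k] w by simp
      then have "P (frag_of (1, w [^]\<^bsub>add_monoid Q\<^esub> Suc k) - (frag_of (1, w [^]\<^bsub>add_monoid Q\<^esub> k) + frag_of (1, w)))"
        using rel2[OF S1(1) _ w, of "w [^]\<^bsub>add_monoid Q\<^esub> k"] by (simp add: Q.nat_pow_Suc)
      from Padd[OF this Suc] show ?case by (simp add: frag_cmul_distrib algebra_simps)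
    qed
    have Pcm: "P (frag_cmul (int k) f)" if "P f" for k f
      by (induction k) (use that PG[OF subgroup.one_closed[OF Gn]] Padd in \<open>auto simp: frag_cmul_distrib F_def algebra_simps\<close>)
    have Py: "P (frag_of (1, y))" if y: "y \<in> carrier Q" for y
    proof -
      obtain z :: nat and w where zw: "w \<in> carrier Q" "y = (e [^]\<^bsub>add_monoid Q\<^esub> z) \<oplus>\<^bsub>Q\<^esub> (w [^]\<^bsub>add_monoid Q\<^esub> p)"
        using gen[OF y] by blast
      have c: "e [^]\<^bsub>add_monoid Q\<^esub> z \<in> carrier Q" "w [^]\<^bsub>add_monoid Q\<^esub> p \<in> carrier Q"
        using Q.nat_pow_closed[of e z] Q.nat_pow_closed[of w p] e zw by auto
      have "P (frag_of (1, e [^]\<^bsub>add_monoid Q\<^esub> z))" using Padd[OF Pw[OF e, of z] Pcm[OF Pe, of z]] by simp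
      moreover have "P (frag_of (1, w [^]\<^bsub>add_monoid Q\<^esub> p))"
      proof -
        \<comment> \<open>Modulo the relations, p(1 \<otimes> w) is (p mod p) \<otimes> w = 0
          \<otimes> w.\<close>
        have "P (frag_cmul (int p) (frag_of (1, w)))" using Pdiff[OF P0[OF zw(1)] Pk[OF zw(1), of p]] by simp
        then show ?thesis using Padd[OF Pw[OF zw(1), of p]] by fastforce
      qed
      ultimately show ?thesis using Padd[OF rel2[OF S1(1) c] Padd] zw(2) by fastforce
    qed
    have Pall: "P (frag_of (a, y))" if a: "a \<in> carrier S" and y: "y \<in> carrier Q" for a y
    proof -
      have "int (nat a) mod int p = a" using a by (auto simp: cS)
      then have "P (frag_of (a, y) - frag_cmul (int (nat a)) (frag_of (1, y)))" using Pk[OF y, of "nat a"] by simp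
      from Padd[OF this Pcm[OF Py[OF y], of "nat a"]] show ?thesis by simp
    qed
    have "P f" if "f \<in> carrier F" for f
    proof (rule frag_induction[of f "carrier S \<times> carrier Q"])
      show "Poly_Mapping.keys f \<subseteq> carrier S \<times> carrier Q" using that by (simp add: F_def)
      show "P 0" using PG[OF subgroup.one_closed[OF Gn]] by (simp add: F_def)
    qed (use Pall Pdiff in auto)
    then show ?thesis unfolding cV RCOSETS_def by (auto simp: P_def)
  qed
  have bV: "b \<in> carrier V" unfolding cV b_def RCOSETS_def using fragF[of 1 e] p cS e by auto
  \<comment> \<open>Multiplication by \<open>s\<close> on the free group. It has to preserve the
    relations for \<open>carrier V\<close> to be a submodule, which in turn confines the spans
    occurring in \<open>vs_basis\<close> to \<open>carrier V\<close>.\<close>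
  define sm where "sm s = frag_extend (\<lambda>(a, x). frag_of (s \<otimes>\<^bsub>S\<^esub> a, x :: 'y))" for s
  have sm_frag: "sm s (frag_of (a, x)) = frag_of (s \<otimes>\<^bsub>S\<^esub> a, x)" for s a x by (simp add: sm_def)
  have sm_add: "sm s (f + g) = sm s f + sm s g" and sm_diff: "sm s (f - g) = sm s f - sm s g" and sm_0: "sm s 0 = 0" for s f g
    by (simp_all add: sm_def frag_extend_add frag_extend_diff)
  have sm_minus: "sm s (- f) = - sm s f" for s f by (simp add: sm_def frag_extend_minus)
  have smF: "sm s f \<in> carrier F" if s: "s \<in> carrier S" and f: "f \<in> carrier F" for s f
  proof (rule frag_induction[of f "carrier S \<times> carrier Q"])
    show "Poly_Mapping.keys f \<subseteq> carrier S \<times> carrier Q" using f by (simp add: F_def)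
    show "sm s 0 \<in> carrier F" using F.one_closed by (simp add: sm_0 F_def)
    show "sm s (frag_of x) \<in> carrier F" if "x \<in> carrier S \<times> carrier Q" for x
      using that pS by (cases x) (auto simp: sm_frag multS intro!: fragF)
  qed (simp add: sm_diff diffF)
  have rels_sm: "sm s f \<in> rels" if s: "s \<in> carrier S" and f: "f \<in> rels" for s f
  proof -
    consider a b x where "f = frag_of (a \<oplus>\<^bsub>S\<^esub> b, x) - (frag_of (a, x) + frag_of (b, x))" "a \<in> carrier S" "b \<in> carrier S" "x \<in> carrier Q"
      | a x y where "f = frag_of (a, x \<oplus>\<^bsub>Q\<^esub> y) - (frag_of (a, x) + frag_of (a, y))" "a \<in> carrier S" "x \<in> carrier Q" "y \<in> carrier Q"
      | a r x where "f = frag_of (a \<otimes>\<^bsub>S\<^esub> r 1, x) - frag_of (a, r \<odot>\<^bsub>Q\<^esub> x)" "a \<in> carrier S" "r \<in> carrier (Zp p)" "x \<in> carrier Q"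
      using f unfolding rels_def tensor_relations_def by blast
    then show ?thesis
    proof cases
      case 1
      have "s \<otimes>\<^bsub>S\<^esub> (a \<oplus>\<^bsub>S\<^esub> b) = (s \<otimes>\<^bsub>S\<^esub> a) \<oplus>\<^bsub>S\<^esub> (s \<otimes>\<^bsub>S\<^esub> b)"
        by (simp add: multS addS mod_mult_right_eq mod_add_eq distrib_left)
      then have "sm s f = frag_of ((s \<otimes>\<^bsub>S\<^esub> a) \<oplus>\<^bsub>S\<^esub> (s \<otimes>\<^bsub>S\<^esub> b), x) - (frag_of (s \<otimes>\<^bsub>S\<^esub> a, x) + frag_of (s \<otimes>\<^bsub>S\<^esub> b, x))"
        using 1(1) by (simp add: sm_diff sm_add sm_frag)
      moreover have "s \<otimes>\<^bsub>S\<^esub> a \<in> carrier S" "s \<otimes>\<^bsub>S\<^esub> b \<in> carrier S" using pS by (auto simp: multS)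
      ultimately show ?thesis using 1(4) unfolding rels_def tensor_relations_def by blast
    next
      case 2
      then have "sm s f = frag_of (s \<otimes>\<^bsub>S\<^esub> a, x \<oplus>\<^bsub>Q\<^esub> y) - (frag_of (s \<otimes>\<^bsub>S\<^esub> a, x) + frag_of (s \<otimes>\<^bsub>S\<^esub> a, y))"
        by (simp add: sm_diff sm_add sm_frag)
      moreover have "s \<otimes>\<^bsub>S\<^esub> a \<in> carrier S" using pS by (auto simp: multS)
      ultimately show ?thesis using 2(3,4) unfolding rels_def tensor_relations_def by blast
    next
      case 3
      have "s \<otimes>\<^bsub>S\<^esub> (a \<otimes>\<^bsub>S\<^esub> r 1) = (s \<otimes>\<^bsub>S\<^esub> a) \<otimes>\<^bsub>S\<^esub> r 1"
        by (simp add: multS mod_mult_right_eq mod_mult_left_eq mult.assoc)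
      then have "sm s f = frag_of ((s \<otimes>\<^bsub>S\<^esub> a) \<otimes>\<^bsub>S\<^esub> r 1, x) - frag_of (s \<otimes>\<^bsub>S\<^esub> a, r \<odot>\<^bsub>Q\<^esub> x)"
        using 3(1) by (simp add: sm_diff sm_frag)
      moreover have "s \<otimes>\<^bsub>S\<^esub> a \<in> carrier S" using pS by (auto simp: multS)
      ultimately show ?thesis using 3(3,4) unfolding rels_def tensor_relations_def by blast
    qed
  qed
  have Gn_sm: "sm s f \<in> Gn" if s: "s \<in> carrier S" and f: "f \<in> Gn" for s f
    using f unfolding Gn_def
  proof (induction rule: generate.induct)
    case one then show ?case using generate.one[of F rels] by (simp add: sm_0 F_def)
  next
    case (incl h) then show ?case using rels_sm[OF s] by (blast intro: generate.incl)
  next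
    case (inv h)
    have "inv\<^bsub>F\<^esub> (sm s h) \<in> generate F rels" using rels_sm[OF s inv] by (rule generate.inv)
    then show ?case using invF[of h] invF[of "sm s h"] inv relsF smF[OF s, of h] by (auto simp: sm_minus)
  next
    case (eng h1 h2) then show ?case using generate.eng[of "sm s h1" F rels "sm s h2"] by (simp add: multF sm_add)
  qed
  have smultV: "s \<odot>\<^bsub>V\<^esub> C = Gn <+>\<^bsub>F'\<^esub> (sm s ` C)" for s C by (simp add: V_def quotient_module_def F'_def sm_def)
  have set_addF: "A <+>\<^bsub>F'\<^esub> B = {f + g | f g. f \<in> A \<and> g \<in> B}" for A B
    by (auto simp: set_add_def set_mult_def F'_def multF)
  have carV: "submodule (carrier V) S V"
  proof (intro submodule.intro submodule_axioms.intro)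
    show "subgroup (carrier V) (add_monoid V)" using V.subgroup_self monoid_cong(2)[OF eqV] eqV(1) by simp
    show "s \<odot>\<^bsub>V\<^esub> C \<in> carrier V" if s: "s \<in> carrier S" and C: "C \<in> carrier V" for s C
    proof -
      obtain f where f: "f \<in> carrier F" "C = Gn #>\<^bsub>F\<^esub> f" using C by (auto simp: cV RCOSETS_def)
      have Cf: "C = (\<lambda>g. g + f) ` Gn" by (auto simp: f(2) r_coset_def multF)
      have "s \<odot>\<^bsub>V\<^esub> C = {g + (sm s h + sm s f) | g h. g \<in> Gn \<and> h \<in> Gn}"
        unfolding smultV set_addF Cf by (auto simp: sm_add image_image)
      also have "\<dots> = (\<lambda>g. g + sm s f) ` Gn"
      proof (intro equalityI subsetI)
        fix y assume "y \<in> {g + (sm s h + sm s f) | g h. g \<in> Gn \<and> h \<in> Gn}"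
        then obtain g h where gh: "g \<in> Gn" "h \<in> Gn" "y = (g + sm s h) + sm s f" by (auto simp: add.assoc)
        have "g + sm s h \<in> Gn" using subgroup.m_closed[OF Gn gh(1) Gn_sm[OF s gh(2)]] by (simp add: multF)
        then show "y \<in> (\<lambda>g. g + sm s f) ` Gn" using gh(3) by auto
      next
        fix y assume "y \<in> (\<lambda>g. g + sm s f) ` Gn"
        then obtain g where "g \<in> Gn" "y = g + (sm s 0 + sm s f)" by (auto simp: sm_0)
        moreover have "0 \<in> Gn" using subgroup.one_closed[OF Gn] by (simp add: F_def)
        ultimately show "y \<in> {g + (sm s h + sm s f) | g h. g \<in> Gn \<and> h \<in> Gn}" by blast
      qed
      also have "\<dots> = Gn #>\<^bsub>F\<^esub> sm s f" by (auto simp: r_coset_def multF)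
      finally show ?thesis using smF[OF s f(1)] by (auto simp: cV RCOSETS_def)
    qed
  qed
  have span_sub: "module_span S V B \<subseteq> carrier V" if "B \<subseteq> carrier V" for B
    using carV that by (auto simp: module_span_def)
  have span_b: "module_span S V {b} = carrier V"
    using span_sub[of "{b}"] bV span by (auto simp: module_span_def)
  \<comment> \<open>Bases are irredundant, so the singleton qualifies only if the empty set does not
    span already.\<close>
  obtain B where B: "finite B" "vs_basis S V B" "card B \<le> 1"
  proof (cases "module_span S V {} = carrier V")
    case True
    then have "vs_basis S V {}" by (simp add: vs_basis_def)
    then show thesis using that[of "{}"] by simp
  next
    case False
    have "b \<notin> module_span S V {}"
    proof
      assume "b \<in> module_span S V {}"
      then have "carrier V \<subseteq> module_span S V {}" using span by (auto simp: module_span_def)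
      then show False using False span_sub[of "{}"] by auto
    qed
    then have "vs_basis S V {b}" using bV span_b by (simp add: vs_basis_def)
    then show thesis using that[of "{b}"] by simp
  qed
  have "vs_dim S V \<le> enat (card B)" unfolding vs_dim_def by (rule INF_lower) (use B in auto)
  also have "\<dots> \<le> 1" using B(3) by (simp add: one_enat_def)
  finally show ?thesis by (simp add: prV)
qed

section \<open>The ring Zp\<close>

lemma Zp_ops:
  "(x \<oplus>\<^bsub>Zp p\<^esub> y) n = (x n + y n) mod int p ^ n" "(x \<otimes>\<^bsub>Zp p\<^esub> y) n = (x n * y n) mod int p ^ n"
  "\<zero>\<^bsub>Zp p\<^esub> n = 0" "\<one>\<^bsub>Zp p\<^esub> n = 1 mod int p ^ n"
  by (simp_all add: Zp_def)

definition zp_of_int :: "nat \<Rightarrow> int \<Rightarrow> nat \<Rightarrow> int" where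
  "zp_of_int p z = (\<lambda>n. z mod int p ^ n)"

context
  fixes p :: nat assumes p0: "p > 0"
begin

lemma Zp_closed:
  assumes "x \<in> carrier (Zp p)" "y \<in> carrier (Zp p)"
  shows "x \<oplus>\<^bsub>Zp p\<^esub> y \<in> carrier (Zp p)" "x \<otimes>\<^bsub>Zp p\<^esub> y \<in> carrier (Zp p)"
proof -
  have pp: "int p ^ n > 0" for n using p0 by simp
  have x: "x (Suc n) mod int p ^ n = x n" and y: "y (Suc n) mod int p ^ n = y n" for n
    using Zp_carrierD(3)[OF assms(1)] Zp_carrierD(3)[OF assms(2)] by auto
  have mm: "a mod int p ^ Suc n mod int p ^ n = a mod int p ^ n" for a n by (simp add: mod_mod_cancel)
  have "(x (Suc n) + y (Suc n)) mod int p ^ Suc n mod int p ^ n = (x n + y n) mod int p ^ n" for n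
    unfolding mm by (metis mod_add_eq x y)
  then show "x \<oplus>\<^bsub>Zp p\<^esub> y \<in> carrier (Zp p)" using pp by (simp add: Zp_def)
  have "(x (Suc n) * y (Suc n)) mod int p ^ Suc n mod int p ^ n = (x n * y n) mod int p ^ n" for n
    unfolding mm by (metis mod_mult_eq x y)
  then show "x \<otimes>\<^bsub>Zp p\<^esub> y \<in> carrier (Zp p)" using pp by (simp add: Zp_def)
qed

lemma zp_of_int_closed [simp]: "zp_of_int p z \<in> carrier (Zp p)"
  using p0 by (auto simp: zp_of_int_def Zp_def mod_mod_cancel)

lemma Zp_one_zero: "\<one>\<^bsub>Zp p\<^esub> = zp_of_int p 1" "\<zero>\<^bsub>Zp p\<^esub> = zp_of_int p 0"
  by (auto simp: zp_of_int_def Zp_def)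

lemma zp_of_int_ops:
  "zp_of_int p a \<oplus>\<^bsub>Zp p\<^esub> zp_of_int p b = zp_of_int p (a + b)" "zp_of_int p a \<otimes>\<^bsub>Zp p\<^esub> zp_of_int p b = zp_of_int p (a * b)"
  by (rule ext, simp add: Zp_ops zp_of_int_def mod_add_eq mod_mult_eq)+

lemma Zp_mod_self: "x \<in> carrier (Zp p) \<Longrightarrow> x n mod int p ^ n = x n"
  using Zp_carrierD by (simp add: mod_pos_pos_trivial)

lemma abelian_monoid_Zp: "abelian_monoid (Zp p)"
proof (rule abelian_monoidI)
  show "\<zero>\<^bsub>Zp p\<^esub> \<in> carrier (Zp p)" by (simp add: Zp_one_zero)
  show "x \<oplus>\<^bsub>Zp p\<^esub> y \<oplus>\<^bsub>Zp p\<^esub> z = x \<oplus>\<^bsub>Zp p\<^esub> (y \<oplus>\<^bsub>Zp p\<^esub> z)" for x y z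
    by (rule ext) (simp add: Zp_ops mod_add_left_eq mod_add_right_eq add.assoc)
  show "\<zero>\<^bsub>Zp p\<^esub> \<oplus>\<^bsub>Zp p\<^esub> x = x" if "x \<in> carrier (Zp p)" for x
    by (rule ext) (simp add: Zp_ops Zp_mod_self[OF that])
  show "x \<oplus>\<^bsub>Zp p\<^esub> y = y \<oplus>\<^bsub>Zp p\<^esub> x" for x y by (rule ext) (simp add: Zp_ops add.commute)
qed (rule Zp_closed)

lemma Zp_mult_one_zero:
  assumes "x \<in> carrier (Zp p)"
  shows "\<one>\<^bsub>Zp p\<^esub> \<otimes>\<^bsub>Zp p\<^esub> x = x" "\<zero>\<^bsub>Zp p\<^esub> \<otimes>\<^bsub>Zp p\<^esub> x = \<zero>\<^bsub>Zp p\<^esub>" "x \<otimes>\<^bsub>Zp p\<^esub> \<zero>\<^bsub>Zp p\<^esub> = \<zero>\<^bsub>Zp p\<^esub>"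
  by (rule ext, use Zp_mod_self[OF assms] in \<open>simp add: Zp_ops mod_mult_left_eq\<close>)+

lemma Zp_finsum:
  assumes "f \<in> A \<rightarrow> carrier (Zp p)" "finite A"
  shows "finsum (Zp p) f A n = (\<Sum>a\<in>A. f a n) mod int p ^ n"
proof -
  interpret abelian_monoid "Zp p" by (rule abelian_monoid_Zp)
  show ?thesis using assms(2,1)
  proof (induction A)
    case empty then show ?case by (simp add: Zp_ops)
  next
    case (insert a A)
    then have "finsum (Zp p) f (insert a A) = f a \<oplus>\<^bsub>Zp p\<^esub> finsum (Zp p) f A" by (simp add: finsum_insert Pi_def)
    then show ?case using insert by (simp add: Zp_ops mod_add_right_eq)
  qed
qed

lemma Zp_finsum_delta:
  assumes "finite A" "i \<in> A" "f i \<in> carrier (Zp p)" "\<And>a. a \<in> A \<Longrightarrow> a \<noteq> i \<Longrightarrow> f a = \<zero>\<^bsub>Zp p\<^esub>"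
  shows "finsum (Zp p) f A = f i"
proof
  fix n
  have "f \<in> A \<rightarrow> carrier (Zp p)" using assms(3,4) by (auto simp: Zp_one_zero) (metis Zp_one_zero(2) assms(3) assms(4) zp_of_int_closed)
  then have "finsum (Zp p) f A n = (\<Sum>a\<in>A. f a n) mod int p ^ n" using assms(1) by (rule Zp_finsum)
  also have "(\<Sum>a\<in>A. f a n) = (\<Sum>a\<in>A. if a = i then f i n else 0)"
    by (rule sum.cong) (use assms(4) in \<open>auto simp: Zp_ops\<close>)
  finally show "finsum (Zp p) f A n = f i n" using assms(1,2) Zp_mod_self[OF assms(3)] by simp
qed

end

section \<open>Completed group rings\<close>

lemma openin_product_topology_nbhd:
  assumes "openin (product_topology Y I) S" "x \<in> S"
  shows "\<exists>U. finite {i \<in> I. U i \<noteq> topspace (Y i)} \<and> (\<forall>i\<in>I. openin (Y i) (U i)) \<and> x \<in> Pi\<^sub>E I U \<and> Pi\<^sub>E I U \<subseteq> S"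
  using assms by (simp add: openin_product_topology_alt)

text \<open>What the completed group ring asks of the open normal subgroups: finite quotients and
  directedness under intersection. The topology on the group enters only through
  \<open>open_normal\<close>.\<close>

locale cgr = group G for G :: "'g monoid" (structure) +
  fixes T :: "'g topology" and p :: nat
  assumes p0: "p > 0"
    and finite_rcosets: "U \<in> open_normal G T \<Longrightarrow> finite (rcosets U)"
    and carrier_open: "carrier G \<in> open_normal G T"
    and Int_open: "U \<in> open_normal G T \<Longrightarrow> V \<in> open_normal G T \<Longrightarrow> U \<inter> V \<in> open_normal G T"
begin

abbreviation "\<O> \<equiv> open_normal G T"
abbreviation "R \<equiv> completed_group_ring p G T"

lemma open_normal_D: "U \<in> \<O> \<Longrightarrow> U \<lhd> G" "U \<in> \<O> \<Longrightarrow> subgroup U G"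
  by (auto simp: open_normal_def normal_imp_subgroup)

lemma rcosetsI: "U \<in> \<O> \<Longrightarrow> g \<in> carrier G \<Longrightarrow> U #> g \<in> rcosets U"
  by (auto simp: RCOSETS_def)

lemma rcosetsE: "c \<in> rcosets U \<Longrightarrow> (\<And>g. g \<in> carrier G \<Longrightarrow> c = U #> g \<Longrightarrow> P) \<Longrightarrow> P"
  by (auto simp: RCOSETS_def)

lemma mem_rcoset_iff:
  assumes "U \<in> \<O>" "g \<in> carrier G" "c \<in> rcosets U"
  shows "g \<in> c \<longleftrightarrow> c = U #> g"
proof -
  obtain h where h: "h \<in> carrier G" "c = U #> h" using assms(3) by (rule rcosetsE)
  show ?thesis using repr_independence[OF _ h(1) open_normal_D(2)[OF assms(1)], of g] rcos_self[OF assms(2) open_normal_D(2)[OF assms(1)]] h(2) by auto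
qed

lemma mem_rcoset_self: "U \<in> \<O> \<Longrightarrow> g \<in> carrier G \<Longrightarrow> g \<in> U #> g"
  by (rule rcos_self[OF _ open_normal_D(2)])

lemma rcoset_eq_iff:
  assumes "U \<in> \<O>" "g \<in> carrier G" "h \<in> carrier G"
  shows "U #> g = U #> h \<longleftrightarrow> g \<otimes> inv h \<in> U"
proof
  assume "U #> g = U #> h"
  then have "g \<in> U #> h" using mem_rcoset_self[OF assms(1,2)] by simp
  then obtain u where "u \<in> U" "g = u \<otimes> h" by (auto simp: r_coset_def)
  then show "g \<otimes> inv h \<in> U" using assms(3) subgroup.mem_carrier[OF open_normal_D(2)[OF assms(1)]] by (simp add: m_assoc)
next
  assume "g \<otimes> inv h \<in> U"
  then have "g \<in> U #> h" using assms by (auto simp: r_coset_def m_assoc intro!: bexI[of _ "g \<otimes> inv h"])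
  then show "U #> g = U #> h" using repr_independence[OF _ assms(3) open_normal_D(2)[OF assms(1)]] by simp
qed

lemma rcoset_mult: "U \<in> \<O> \<Longrightarrow> g \<in> carrier G \<Longrightarrow> h \<in> carrier G \<Longrightarrow> (U #> g) <#> (U #> h) = U #> (g \<otimes> h)"
  by (rule normal.rcos_sum[OF open_normal_D(1)])

lemma rcoset_inv: "U \<in> \<O> \<Longrightarrow> g \<in> carrier G \<Longrightarrow> inv\<^bsub>G Mod U\<^esub> (U #> g) = U #> inv g"
  using normal.inv_FactGroup[OF open_normal_D(1), of U "U #> g"] normal.rcos_inv[OF open_normal_D(1), of U g]
  by (auto simp: FactGroup_def RCOSETS_def)

lemma cgr_carrier_iff: "\<mu> \<in> carrier R \<longleftrightarrow> \<mu> \<in> extensional \<O> \<and>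
  (\<forall>U\<in>\<O>. \<mu> U \<in> extensional (rcosets U) \<and> (\<forall>c\<in>rcosets U. \<mu> U c \<in> carrier (Zp p))) \<and>
  (\<forall>U\<in>\<O>. \<forall>V\<in>\<O>. V \<subseteq> U \<longrightarrow> (\<forall>c\<in>rcosets U. \<mu> U c = (\<Oplus>\<^bsub>Zp p\<^esub>d\<in>{d \<in> rcosets V. d \<subseteq> c}. \<mu> V d)))"
  unfolding completed_group_ring_def group_ring_def
  by (auto simp: FactGroup_def PiE_def Pi_def)

lemma cgr_Zp: "\<mu> \<in> carrier R \<Longrightarrow> U \<in> \<O> \<Longrightarrow> c \<in> rcosets U \<Longrightarrow> \<mu> U c \<in> carrier (Zp p)"
  unfolding cgr_carrier_iff by blast

lemma cgr_compat:
  "\<mu> \<in> carrier R \<Longrightarrow> U \<in> \<O> \<Longrightarrow> V \<in> \<O> \<Longrightarrow> V \<subseteq> U \<Longrightarrow> c \<in> rcosets U \<Longrightarrow>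
    \<mu> U c = (\<Oplus>\<^bsub>Zp p\<^esub>d\<in>{d \<in> rcosets V. d \<subseteq> c}. \<mu> V d)"
  unfolding cgr_carrier_iff by blast

lemma cgr_eqI:
  assumes "\<mu> \<in> carrier R" "\<nu> \<in> carrier R" "\<And>U c. U \<in> \<O> \<Longrightarrow> c \<in> rcosets U \<Longrightarrow> \<mu> U c = \<nu> U c"
  shows "\<mu> = \<nu>"
proof (rule extensionalityI[of _ \<O>])
  fix U assume U: "U \<in> \<O>"
  show "\<mu> U = \<nu> U"
    by (rule extensionalityI[of _ "rcosets U"]) (use assms U in \<open>auto simp: cgr_carrier_iff\<close>)
qed (use assms in \<open>auto simp: cgr_carrier_iff\<close>)

lemma cgr_add_apply: "U \<in> \<O> \<Longrightarrow> c \<in> rcosets U \<Longrightarrow> (\<mu> \<oplus>\<^bsub>R\<^esub> \<nu>) U c = \<mu> U c \<oplus>\<^bsub>Zp p\<^esub> \<nu> U c"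
  by (simp add: completed_group_ring_def group_ring_def FactGroup_def)

lemma cgr_zero_apply: "U \<in> \<O> \<Longrightarrow> c \<in> rcosets U \<Longrightarrow> \<zero>\<^bsub>R\<^esub> U c = \<zero>\<^bsub>Zp p\<^esub>"
  by (simp add: completed_group_ring_def group_ring_def FactGroup_def)

lemma cgr_mult_apply: "U \<in> \<O> \<Longrightarrow> c \<in> rcosets U \<Longrightarrow>
  (\<mu> \<otimes>\<^bsub>R\<^esub> \<nu>) U c = (\<Oplus>\<^bsub>Zp p\<^esub>a\<in>rcosets U. \<mu> U a \<otimes>\<^bsub>Zp p\<^esub> \<nu> U (inv\<^bsub>G Mod U\<^esub> a <#> c))"
  by (simp add: completed_group_ring_def group_ring_def FactGroup_def)

lemma quot_closed:
  assumes "U \<in> \<O>" "a \<in> rcosets U" "c \<in> rcosets U"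
  shows "inv\<^bsub>G Mod U\<^esub> a <#> c \<in> rcosets U"
proof -
  obtain g where g: "g \<in> carrier G" "a = U #> g" using assms(2) by (rule rcosetsE)
  obtain h where h: "h \<in> carrier G" "c = U #> h" using assms(3) by (rule rcosetsE)
  show ?thesis using rcoset_inv[OF assms(1) g(1)] rcoset_mult[OF assms(1) inv_closed[OF g(1)] h(1)]
    rcosetsI[OF assms(1), of "inv g \<otimes> h"] g h by simp
qed

abbreviation single where "single \<equiv> cgr_single p G T"

lemma single_apply: "U \<in> \<O> \<Longrightarrow> c \<in> rcosets U \<Longrightarrow> single a g U c = (if g \<in> c then a else \<zero>\<^bsub>Zp p\<^esub>)"
  by (simp add: cgr_single_def)

text \<open>For compatibility, at most one coset of \<open>V\<close> inside \<open>c\<close> carries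
  a coefficient, namely the one of g, and it lies in \<open>c\<close> exactly when g does.\<close>

lemma single_closed:
  assumes a: "a \<in> carrier (Zp p)" and g: "g \<in> carrier G"
  shows "single a g \<in> carrier R"
  unfolding cgr_carrier_iff
proof (intro conjI ballI impI)
  have z: "\<zero>\<^bsub>Zp p\<^esub> \<in> carrier (Zp p)" using p0 by (simp add: Zp_one_zero)
  show "single a g \<in> extensional \<O>" by (simp add: cgr_single_def)
  fix U assume U: "U \<in> \<O>"
  show "single a g U \<in> extensional (rcosets U)" using U by (simp add: cgr_single_def)
  show "single a g U c \<in> carrier (Zp p)" if "c \<in> rcosets U" for c using that U a z by (simp add: single_apply)
  fix V c assume V: "V \<in> \<O>" "V \<subseteq> U" and c: "c \<in> rcosets U"
  let ?D = "{d \<in> rcosets V. d \<subseteq> c}"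
  have fin: "finite ?D" using finite_rcosets[OF V(1)] by simp
  show "single a g U c = (\<Oplus>\<^bsub>Zp p\<^esub>d\<in>?D. single a g V d)"
  proof (cases "g \<in> c")
    case True
    have cg: "c = U #> g" using mem_rcoset_iff[OF U g c] True by simp
    have "V #> g \<in> ?D" using rcosetsI[OF V(1) g] V(2) unfolding cg by (auto simp: r_coset_def)
    then have "(\<Oplus>\<^bsub>Zp p\<^esub>d\<in>?D. single a g V d) = single a g V (V #> g)"
      using mem_rcoset_iff[OF V(1) g] a mem_rcoset_self[OF V(1) g]
      by (intro Zp_finsum_delta[OF p0 fin]) (auto simp: single_apply[OF V(1)])
    then show ?thesis using True mem_rcoset_self[OF V(1) g] single_apply[OF U c] single_apply[OF V(1) rcosetsI[OF V(1) g]] by simp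
  next
    case False
    have "(\<Oplus>\<^bsub>Zp p\<^esub>d\<in>?D. single a g V d) = \<zero>\<^bsub>Zp p\<^esub>"
    proof
      fix n
      have "(\<Oplus>\<^bsub>Zp p\<^esub>d\<in>?D. single a g V d) n = (\<Sum>d\<in>?D. single a g V d n) mod int p ^ n"
        using a z by (intro Zp_finsum[OF p0 _ fin]) (auto simp: single_apply[OF V(1)])
      also have "(\<Sum>d\<in>?D. single a g V d n) = 0"
        using False by (intro sum.neutral) (auto simp: single_apply[OF V(1)] Zp_ops)
      finally show "(\<Oplus>\<^bsub>Zp p\<^esub>d\<in>?D. single a g V d) n = \<zero>\<^bsub>Zp p\<^esub> n" by (simp add: Zp_ops)
    qed
    then show ?thesis using False by (simp add: single_apply[OF U c])
  qed
qed

text \<open>In the convolution only the coset of g contributes, which leaves a translation by the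
  inverse of g.\<close>

lemma single_mult_apply:
  assumes a: "a \<in> carrier (Zp p)" and g: "g \<in> carrier G" and n: "\<nu> \<in> carrier R" and U: "U \<in> \<O>" and x: "x \<in> carrier G"
  shows "(single a g \<otimes>\<^bsub>R\<^esub> \<nu>) U (U #> x) = a \<otimes>\<^bsub>Zp p\<^esub> \<nu> U (U #> (inv g \<otimes> x))"
proof -
  note cx = rcosetsI[OF U x] and cg = rcosetsI[OF U g]
  have "(single a g \<otimes>\<^bsub>R\<^esub> \<nu>) U (U #> x) = (\<Oplus>\<^bsub>Zp p\<^esub>d\<in>rcosets U. single a g U d \<otimes>\<^bsub>Zp p\<^esub> \<nu> U (inv\<^bsub>G Mod U\<^esub> d <#> (U #> x)))"
    by (rule cgr_mult_apply[OF U cx])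
  also have "\<dots> = single a g U (U #> g) \<otimes>\<^bsub>Zp p\<^esub> \<nu> U (inv\<^bsub>G Mod U\<^esub> (U #> g) <#> (U #> x))"
  proof (rule Zp_finsum_delta[OF p0 finite_rcosets[OF U] cg])
    show "single a g U (U #> g) \<otimes>\<^bsub>Zp p\<^esub> \<nu> U (inv\<^bsub>G Mod U\<^esub> (U #> g) <#> (U #> x)) \<in> carrier (Zp p)"
      by (intro Zp_closed[OF p0] cgr_Zp[OF single_closed[OF a g] U cg] cgr_Zp[OF n U quot_closed[OF U cg cx]])
    fix d assume d: "d \<in> rcosets U" "d \<noteq> U #> g"
    then have "single a g U d = \<zero>\<^bsub>Zp p\<^esub>" using mem_rcoset_iff[OF U g d(1)] by (simp add: single_apply[OF U])
    then show "single a g U d \<otimes>\<^bsub>Zp p\<^esub> \<nu> U (inv\<^bsub>G Mod U\<^esub> d <#> (U #> x)) = \<zero>\<^bsub>Zp p\<^esub>"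
      using Zp_mult_one_zero(2)[OF p0 cgr_Zp[OF n U quot_closed[OF U d(1) cx]]] by simp
  qed
  also have "single a g U (U #> g) = a" by (simp add: single_apply[OF U cg] mem_rcoset_self[OF U g])
  also have "inv\<^bsub>G Mod U\<^esub> (U #> g) <#> (U #> x) = U #> (inv g \<otimes> x)"
    using rcoset_inv[OF U g] rcoset_mult[OF U inv_closed[OF g] x] by simp
  finally show ?thesis .
qed

lemma single_one: "single \<one>\<^bsub>Zp p\<^esub> \<one> = \<one>\<^bsub>R\<^esub>"
proof -
  have "\<one> \<in> c \<longleftrightarrow> c = U" if "U \<in> \<O>" "c \<in> rcosets U" for U c
    using mem_rcoset_iff[OF that(1) one_closed that(2)] coset_mult_one[OF subgroup.subset[OF open_normal_D(2)[OF that(1)]]] by simp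
  then show ?thesis
    by (auto simp: cgr_single_def completed_group_ring_def group_ring_def FactGroup_def restrict_def fun_eq_iff)
qed

lemma single_add: "single a g \<oplus>\<^bsub>R\<^esub> single b g = single (a \<oplus>\<^bsub>Zp p\<^esub> b) g"
  using abelian_monoid.l_zero[OF abelian_monoid_Zp[OF p0] abelian_monoid.zero_closed[OF abelian_monoid_Zp[OF p0]]]
  by (auto simp: cgr_single_def completed_group_ring_def group_ring_def FactGroup_def restrict_def fun_eq_iff)

lemma single_zero: "single \<zero>\<^bsub>Zp p\<^esub> g = \<zero>\<^bsub>R\<^esub>"
  by (auto simp: cgr_single_def completed_group_ring_def group_ring_def FactGroup_def restrict_def fun_eq_iff)

text \<open>The kernel of the map from Z_p[[G]] to (Z/p^n)[G/V]. These ideals are the levels, and by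
  \<open>open_nbhd_0\<close> every neighbourhood of 0 contains one of them.\<close>

definition cgr_ideal :: "'g set \<Rightarrow> nat \<Rightarrow> 'g cgr set" where
  "cgr_ideal V n = {\<mu> \<in> carrier R. \<forall>c\<in>rcosets V. \<mu> V c n = 0}"

lemma cgr_ideal_subset: "cgr_ideal V n \<subseteq> carrier R" by (auto simp: cgr_ideal_def)

lemma cgr_ideal_mono:
  assumes "V \<in> \<O>" "U \<in> \<O>" "V \<subseteq> U" "n \<le> m"
  shows "cgr_ideal V m \<subseteq> cgr_ideal U n"
proof
  fix \<mu> assume m: "\<mu> \<in> cgr_ideal V m"
  then have mR: "\<mu> \<in> carrier R" by (auto simp: cgr_ideal_def)
  have "\<mu> U c n = 0" if c: "c \<in> rcosets U" for c
  proof -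
    let ?D = "{d \<in> rcosets V. d \<subseteq> c}"
    have "\<mu> U c n = (\<Sum>d\<in>?D. \<mu> V d n) mod int p ^ n"
      unfolding cgr_compat[OF mR assms(2,1,3) c]
      by (rule Zp_finsum[OF p0]) (use cgr_Zp[OF mR assms(1)] finite_rcosets[OF assms(1)] in auto)
    moreover have "\<mu> V d n = 0" if "d \<in> ?D" for d
      using Zp_mod_le[OF cgr_Zp[OF mR assms(1)] assms(4), of d] m that by (simp add: cgr_ideal_def)
    ultimately show ?thesis by simp
  qed
  then show "\<mu> \<in> cgr_ideal U n" using mR by (simp add: cgr_ideal_def)
qed

text \<open>The topology is a product in two stages: a basic open set restricts finitely many
  quotients G/U, and for each of them finitely many coefficients to some finite precision.
  \<open>V\<close> is contained in the subgroups involved and \<open>N\<close> bounds the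
  precisions.\<close>

lemma open_nbhd_0:
  assumes W: "openin (completed_group_ring_topology p G T) W" "\<zero>\<^bsub>R\<^esub> \<in> W"
  shows "\<exists>V\<in>\<O>. \<exists>n. cgr_ideal V n \<subseteq> W"
proof -
  obtain W' where W': "openin (product_topology (\<lambda>U. product_topology (\<lambda>_. Zp_topology p) (rcosets U)) \<O>) W'" "W = W' \<inter> carrier R"
    using W(1) by (auto simp: completed_group_ring_topology_def openin_subtopology)
  have ts: "topspace (Zp_topology p) = carrier (Zp p)" by (simp add: Zp_topology_def)
  let ?Y = "\<lambda>U. product_topology (\<lambda>_. Zp_topology p) (rcosets U)"
  have "\<exists>B. finite {U \<in> \<O>. B U \<noteq> topspace (?Y U)} \<and> (\<forall>U\<in>\<O>. openin (?Y U) (B U)) \<and> \<zero>\<^bsub>R\<^esub> \<in> Pi\<^sub>E \<O> B \<and> Pi\<^sub>E \<O> B \<subseteq> W'"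
    by (rule openin_product_topology_nbhd[OF W'(1)]) (use W(2) W'(2) in blast)
  then obtain B where B: "finite {U \<in> \<O>. B U \<noteq> topspace (?Y U)}"
    "\<forall>U\<in>\<O>. openin (?Y U) (B U)" "\<zero>\<^bsub>R\<^esub> \<in> Pi\<^sub>E \<O> B" "Pi\<^sub>E \<O> B \<subseteq> W'"
    by auto
  have one: "\<exists>n. \<forall>f\<in>extensional (rcosets U). (\<forall>c\<in>rcosets U. f c \<in> carrier (Zp p) \<and> f c n = 0) \<longrightarrow> f \<in> B U" if U: "U \<in> \<O>" for U
  proof -
    have z: "\<zero>\<^bsub>R\<^esub> U \<in> B U" using B(3) U by (auto simp: PiE_def Pi_def)
    have oBU: "openin (product_topology (\<lambda>_. Zp_topology p) (rcosets U)) (B U)" using B(2) U by blast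
    have "\<exists>C. finite {c \<in> rcosets U. C c \<noteq> topspace (Zp_topology p)} \<and> (\<forall>c\<in>rcosets U. openin (Zp_topology p) (C c)) \<and>
      \<zero>\<^bsub>R\<^esub> U \<in> Pi\<^sub>E (rcosets U) C \<and> Pi\<^sub>E (rcosets U) C \<subseteq> B U"
      by (rule openin_product_topology_nbhd[OF oBU z])
    then obtain C where C: "\<forall>c\<in>rcosets U. openin (Zp_topology p) (C c)" "\<zero>\<^bsub>R\<^esub> U \<in> Pi\<^sub>E (rcosets U) C" "Pi\<^sub>E (rcosets U) C \<subseteq> B U"
      by auto
    have "\<forall>c\<in>rcosets U. \<exists>m. \<forall>x\<in>carrier (Zp p). x m = 0 \<longrightarrow> x \<in> C c"
    proof
      fix c assume c: "c \<in> rcosets U"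
      have "\<zero>\<^bsub>R\<^esub> U c \<in> C c" using C(2) c by (auto simp: PiE_def Pi_def)
      then have "(\<lambda>n. 0) \<in> C c" unfolding cgr_zero_apply[OF U c] by (simp add: Zp_def)
      then show "\<exists>m. \<forall>x\<in>carrier (Zp p). x m = 0 \<longrightarrow> x \<in> C c" using C(1) c by (intro Zp_topology_nbhd_0) auto
    qed
    then obtain m where m: "\<And>c x. c \<in> rcosets U \<Longrightarrow> x \<in> carrier (Zp p) \<Longrightarrow> x (m c) = 0 \<Longrightarrow> x \<in> C c" by metis
    define n where "n = Max (insert 0 (m ` (rcosets U)))"
    have mn: "m c \<le> n" if "c \<in> rcosets U" for c unfolding n_def using finite_rcosets[OF U] that by (intro Max_ge) auto
    have "f \<in> B U" if f: "f \<in> extensional (rcosets U)" "\<forall>c\<in>rcosets U. f c \<in> carrier (Zp p) \<and> f c n = 0" for f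
    proof -
      have "f c \<in> C c" if c: "c \<in> rcosets U" for c
      proof (rule m[OF c])
        have fc: "f c \<in> carrier (Zp p)" "f c n = 0" using f(2) c by blast+
        show "f c \<in> carrier (Zp p)" by (rule fc(1))
        show "f c (m c) = 0" using Zp_mod_le[OF fc(1) mn[OF c]] fc(2) by simp
      qed
      then have "f \<in> Pi\<^sub>E (rcosets U) C" using f(1) by (auto simp: PiE_def)
      then show ?thesis using C(3) by blast
    qed
    then show ?thesis by blast
  qed
  then obtain n where n: "\<And>U f. U \<in> \<O> \<Longrightarrow> f \<in> extensional (rcosets U) \<Longrightarrow> (\<forall>c\<in>rcosets U. f c \<in> carrier (Zp p) \<and> f c (n U) = 0) \<Longrightarrow> f \<in> B U"
    by metis
  define S where "S = {U \<in> \<O>. B U \<noteq> topspace (product_topology (\<lambda>_. Zp_topology p) (rcosets U))}"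
  have S: "finite S" "S \<subseteq> \<O>" using B(1) by (auto simp: S_def)
  have "\<exists>V\<in>\<O>. \<forall>U\<in>S. V \<subseteq> U" using S
  proof (induction S)
    case empty then show ?case using carrier_open by blast
  next
    case (insert U S)
    then obtain V where "V \<in> \<O>" "\<forall>U\<in>S. V \<subseteq> U" by auto
    then show ?case using Int_open[of V U] insert by (intro bexI[of _ "V \<inter> U"]) auto
  qed
  then obtain V where V: "V \<in> \<O>" "\<And>U. U \<in> S \<Longrightarrow> V \<subseteq> U" by blast
  define N where "N = Max (insert 0 (n ` S))"
  have nN: "n U \<le> N" if "U \<in> S" for U unfolding N_def using S(1) that by (intro Max_ge) auto
  have "cgr_ideal V N \<subseteq> W"
  proof
    fix \<mu> assume mu: "\<mu> \<in> cgr_ideal V N"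
    then have mR: "\<mu> \<in> carrier R" using cgr_ideal_subset by blast
    have "\<mu> U \<in> B U" if U: "U \<in> \<O>" for U
    proof (cases "U \<in> S")
      case True
      have "\<mu> \<in> cgr_ideal U (n U)" using cgr_ideal_mono[OF V(1) U V(2)[OF True] nN[OF True]] mu by blast
      then show ?thesis using cgr_Zp[OF mR U] mR U by (intro n[OF U]) (auto simp: cgr_ideal_def cgr_carrier_iff)
    next
      case False
      then have "B U = topspace (product_topology (\<lambda>_. Zp_topology p) (rcosets U))" using U by (auto simp: S_def)
      then show ?thesis using mR U by (auto simp: ts cgr_carrier_iff PiE_def)
    qed
    then have "\<mu> \<in> Pi\<^sub>E \<O> B" using mR by (auto simp: PiE_def cgr_carrier_iff)
    then show "\<mu> \<in> W" using B(4) W'(2) mR by blast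
  qed
  then show ?thesis using V(1) by blast
qed

lemma topspace_cgr: "topspace (completed_group_ring_topology p G T) = carrier R"
  by (auto simp: completed_group_ring_topology_def Zp_topology_def cgr_carrier_iff PiE_def Pi_def)

end

section \<open>Evaluation of integer polynomials\<close>

text \<open>Evaluation of \<int>[T] in a record ring at \<open>t\<close>, with
  \<open>\<iota>\<close> as the map from \<int>. It lets the polynomial dichotomy, proved for
  \<open>int poly\<close>, speak about group elements of Z_p[[G]].\<close>

locale int_eval = cring S for S :: "('a, 'b) ring_scheme" (structure) +
  fixes \<iota> :: "int \<Rightarrow> 'a" and t :: 'a
  assumes iota_closed [simp]: "\<iota> z \<in> carrier S" and t_closed [simp]: "t \<in> carrier S"
    and iota_add: "\<iota> (a + b) = \<iota> a \<oplus> \<iota> b" and iota_mult: "\<iota> (a * b) = \<iota> a \<otimes> \<iota> b"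
    and iota_0 [simp]: "\<iota> 0 = \<zero>" and iota_1 [simp]: "\<iota> 1 = \<one>"
begin

text \<open>Horner's scheme, for which \<open>ev_pCons\<close> supports induction over
  \<open>pCons\<close>.\<close>

definition ev :: "int poly \<Rightarrow> 'a" where
  "ev P = fold_coeffs (\<lambda>a r. \<iota> a \<oplus> t \<otimes> r) P \<zero>"

lemma ev_0 [simp]: "ev 0 = \<zero>" by (simp add: ev_def)

lemma ev_pCons: "ev (pCons a P) = \<iota> a \<oplus> t \<otimes> ev P"
proof (cases "a = 0 \<and> P = 0")
  case True then show ?thesis by simp
next
  case False
  then show ?thesis by (cases "P = 0") (simp_all add: ev_def)
qed

lemma ev_closed [simp]: "ev P \<in> carrier S"
  by (induction P) (auto simp: ev_pCons)

lemma ev_const: "ev [:a:] = \<iota> a" by (simp add: ev_pCons)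

lemma ev_1 [simp]: "ev 1 = \<one>" by (simp add: one_pCons ev_pCons)

lemma ev_t: "ev [:0, 1:] = t" by (simp add: ev_pCons)

lemma ev_add: "ev (P + Q) = ev P \<oplus> ev Q"
proof (induction P arbitrary: Q)
  case 0 then show ?case by simp
next
  case (pCons a P)
  obtain b Q' where Q: "Q = pCons b Q'" by (cases Q)
  have "(\<iota> a \<oplus> \<iota> b) \<oplus> t \<otimes> (ev P \<oplus> ev Q') = (\<iota> a \<oplus> t \<otimes> ev P) \<oplus> (\<iota> b \<oplus> t \<otimes> ev Q')"
    by (simp add: r_distr a_ac)
  then show ?case using pCons.IH by (simp add: Q ev_pCons iota_add)
qed

lemma ev_smult: "ev (Polynomial.smult a P) = \<iota> a \<otimes> ev P"
proof (induction P)
  case (pCons b P)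
  then show ?case by (simp add: ev_pCons iota_mult r_distr m_lcomm)
qed simp

lemma ev_mult: "ev (P * Q) = ev P \<otimes> ev Q"
proof (induction P)
  case (pCons a P)
  have "ev (pCons a P * Q) = ev (Polynomial.smult a Q) \<oplus> ev (pCons 0 (P * Q))" by (simp add: ev_add)
  also have "\<dots> = \<iota> a \<otimes> ev Q \<oplus> t \<otimes> (ev P \<otimes> ev Q)" by (simp add: ev_smult ev_pCons pCons.IH)
  also have "\<dots> = ev (pCons a P) \<otimes> ev Q" by (simp add: ev_pCons l_distr m_assoc)
  finally show ?case .
qed simp

lemma ev_minus: "ev (- P) = \<ominus> ev P"
proof -
  have "ev (- P) \<oplus> ev P = \<zero>" using ev_add[of "- P" P] by simp
  then show ?thesis by (simp add: sum_zero_eq_neg)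
qed

lemma ev_diff: "ev (P - Q) = ev P \<ominus> ev Q"
  using ev_add[of P "- Q"] by (simp add: ev_minus a_minus_def)

lemma ev_power: "ev (P ^ n) = ev P [^] n"
  by (induction n) (simp_all add: ev_mult nat_pow_Suc m_comm)

lemma ev_of_nat: "ev (of_nat n) = \<iota> (int n)"
  by (simp add: of_nat_poly ev_const)

end

section \<open>Group elements in completed group rings\<close>

lemma Gal_carrier_update: "Gal L F = (Gal L k)\<lparr>carrier := carrier (Gal L F)\<rparr>"
  by (simp add: Gal_def)

context cgr
begin

text \<open>Cosets of \<open>V\<close> inside \<open>c\<close> that miss \<open>A\<close> have
  coefficient 0; those that meet \<open>A\<close> correspond under d |-> d \<inter> A to the cosets
  of V \<inter> A inside c \<inter> A. The sum over \<open>V\<close> thus becomes the compatibility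
  sum of \<open>\<mu>\<close>.\<close>

lemma cgr_incl_closed:
  assumes A: "subgroup A G" and open_A: "\<And>U. U \<in> \<O> \<Longrightarrow> U \<inter> A \<in> open_normal (G\<lparr>carrier := A\<rparr>) T'"
    and m: "\<mu> \<in> carrier (completed_group_ring p (G\<lparr>carrier := A\<rparr>) T')"
  shows "cgr_incl p G T A \<mu> \<in> carrier R"
proof -
  define GA where "GA = G\<lparr>carrier := A\<rparr>"
  have rcA: "W #>\<^bsub>GA\<^esub> h = W #> h" for W h by (simp add: GA_def r_coset_def)
  have rcsA: "rcosets\<^bsub>GA\<^esub> W = {W #> h | h. h \<in> A}" for W by (auto simp: RCOSETS_def rcA) (auto simp: GA_def)
  have AG: "A \<subseteq> carrier G" by (rule subgroup.subset[OF A])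
  have inter: "(U #> h) \<inter> A = (U \<inter> A) #> h" if "U \<in> \<O>" "h \<in> A" for U h
  proof
    show "(U \<inter> A) #> h \<subseteq> (U #> h) \<inter> A" using subgroup.m_closed[OF A] that(2) by (auto simp: r_coset_def)
    show "(U #> h) \<inter> A \<subseteq> (U \<inter> A) #> h"
    proof
      fix x assume x: "x \<in> (U #> h) \<inter> A"
      then obtain u where u: "u \<in> U" "x = u \<otimes> h" by (auto simp: r_coset_def)
      have uG: "u \<in> carrier G" using u(1) subgroup.mem_carrier[OF open_normal_D(2)[OF that(1)]] by simp
      have "u = x \<otimes> inv h" using u(2) uG that(2) AG by (simp add: m_assoc subset_iff)
      then have "u \<in> A" using x that(2) subgroup.m_closed[OF A] subgroup.m_inv_closed[OF A] by simp
      then show "x \<in> (U \<inter> A) #> h" using u by (auto simp: r_coset_def)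
    qed
  qed
  have mem_c: "c = U #> h" if "U \<in> \<O>" "c \<in> rcosets U" "h \<in> c \<inter> A" for U c h
    using mem_rcoset_iff[OF that(1) _ that(2), of h] that(3) AG by blast
  have cA: "c \<inter> A \<in> rcosets\<^bsub>GA\<^esub> (U \<inter> A)" if Uc: "U \<in> \<O>" "c \<in> rcosets U" "c \<inter> A \<noteq> {}" for U c
  proof -
    obtain h where h: "h \<in> c \<inter> A" using Uc(3) by blast
    then show ?thesis using mem_c[OF Uc(1,2) h] inter[OF Uc(1), of h] by (auto simp: rcsA)
  qed
  have mZp: "\<mu> W c \<in> carrier (Zp p)" if "W \<in> open_normal GA T'" "c \<in> rcosets\<^bsub>GA\<^esub> W" for W c
    using m that unfolding GA_def[symmetric] completed_group_ring_def group_ring_def by (auto simp: FactGroup_def PiE_def Pi_def)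
  have mall: "\<forall>U\<in>open_normal GA T'. \<forall>V\<in>open_normal GA T'. V \<subseteq> U \<longrightarrow>
    (\<forall>c\<in>rcosets\<^bsub>GA\<^esub> U. \<mu> U c = (\<Oplus>\<^bsub>Zp p\<^esub>d\<in>{d \<in> rcosets\<^bsub>GA\<^esub> V. d \<subseteq> c}. \<mu> V d))"
    using m unfolding GA_def[symmetric] completed_group_ring_def partial_object.simps mem_Collect_eq by (elim conjE)
  have mcompat: "\<mu> U c = (\<Oplus>\<^bsub>Zp p\<^esub>d\<in>{d \<in> rcosets\<^bsub>GA\<^esub> V. d \<subseteq> c}. \<mu> V d)"
    if "U \<in> open_normal GA T'" "V \<in> open_normal GA T'" "V \<subseteq> U" "c \<in> rcosets\<^bsub>GA\<^esub> U" for U V c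
    using mall that by blast
  note oA = open_A[folded GA_def]
  define \<nu> where "\<nu> = cgr_incl p G T A \<mu>"
  have nu: "\<nu> U c = (if c \<inter> A = {} then \<zero>\<^bsub>Zp p\<^esub> else \<mu> (U \<inter> A) (c \<inter> A))" if "U \<in> \<O>" "c \<in> rcosets U" for U c
    using that by (simp add: \<nu>_def cgr_incl_def)
  have nuZp: "\<nu> U c \<in> carrier (Zp p)" if "U \<in> \<O>" "c \<in> rcosets U" for U c
    unfolding nu[OF that] using mZp[OF oA[OF that(1)] cA[OF that]] zp_of_int_closed[OF p0, of 0]
    by (auto simp flip: Zp_one_zero(2)[OF p0])
  have "\<nu> U c = (\<Oplus>\<^bsub>Zp p\<^esub>d\<in>{d \<in> rcosets V. d \<subseteq> c}. \<nu> V d)"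
    if UV: "U \<in> \<O>" "V \<in> \<O>" "V \<subseteq> U" and c: "c \<in> rcosets U" for U V c
  proof
    fix n
    let ?D = "{d \<in> rcosets V. d \<subseteq> c}"
    define D1 where "D1 = {d \<in> ?D. d \<inter> A \<noteq> {}}"
    have fin: "finite ?D" using finite_rcosets[OF UV(2)] by simp
    have "(\<Oplus>\<^bsub>Zp p\<^esub>d\<in>?D. \<nu> V d) n = (\<Sum>d\<in>?D. \<nu> V d n) mod int p ^ n"
      by (rule Zp_finsum[OF p0 _ fin]) (use nuZp[OF UV(2)] in auto)
    also have "(\<Sum>d\<in>?D. \<nu> V d n) = (\<Sum>d\<in>D1. \<mu> (V \<inter> A) (d \<inter> A) n)"
      by (rule sum.mono_neutral_cong_right[OF fin]) (auto simp: D1_def nu[OF UV(2)] Zp_ops)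
    also have "\<dots> mod int p ^ n = \<nu> U c n"
    proof (cases "c \<inter> A = {}")
      case True
      then have "D1 = {}" by (auto simp: D1_def)
      then show ?thesis using True by (simp add: nu[OF UV(1) c] Zp_ops)
    next
      case False
      have inj: "inj_on (\<lambda>d. d \<inter> A) D1"
      proof (rule inj_onI)
        fix d d' assume d: "d \<in> D1" "d' \<in> D1" "d \<inter> A = d' \<inter> A"
        then obtain h where "h \<in> d \<inter> A" "h \<in> d' \<inter> A" by (auto simp: D1_def)
        then show "d = d'" using mem_c[OF UV(2), of d h] mem_c[OF UV(2), of d' h] d by (auto simp: D1_def)
      qed
      have im: "(\<lambda>d. d \<inter> A) ` D1 = {d \<in> rcosets\<^bsub>GA\<^esub> (V \<inter> A). d \<subseteq> c \<inter> A}"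
      proof (intro equalityI subsetI)
        fix e assume "e \<in> (\<lambda>d. d \<inter> A) ` D1"
        then show "e \<in> {d \<in> rcosets\<^bsub>GA\<^esub> (V \<inter> A). d \<subseteq> c \<inter> A}" using cA[OF UV(2)] by (auto simp: D1_def)
      next
        fix e assume e: "e \<in> {d \<in> rcosets\<^bsub>GA\<^esub> (V \<inter> A). d \<subseteq> c \<inter> A}"
        then obtain h where h: "h \<in> A" "e = (V \<inter> A) #> h" by (auto simp: rcsA)
        have hG: "h \<in> carrier G" using h(1) AG by auto
        have hd: "h \<in> (V #> h) \<inter> A" using mem_rcoset_self[OF UV(2) hG] h(1) by simp
        have ed: "e = (V #> h) \<inter> A" using inter[OF UV(2) h(1)] h(2) by simp
        then have "h \<in> c \<inter> A" using e hd by auto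
        then have "c = U #> h" by (rule mem_c[OF UV(1) c])
        then have "V #> h \<subseteq> c" using UV(3) by (auto simp: r_coset_def)
        then have "V #> h \<in> D1" using rcosetsI[OF UV(2) hG] hd by (auto simp: D1_def)
        then show "e \<in> (\<lambda>d. d \<inter> A) ` D1" using ed by blast
      qed
      have fD1: "finite D1" by (rule finite_subset[OF _ fin]) (auto simp: D1_def)
      have "\<nu> U c n = (\<Oplus>\<^bsub>Zp p\<^esub>d\<in>{d \<in> rcosets\<^bsub>GA\<^esub> (V \<inter> A). d \<subseteq> c \<inter> A}. \<mu> (V \<inter> A) d) n"
      proof -
        have "V \<inter> A \<subseteq> U \<inter> A" using UV(3) by blast
        from mcompat[OF oA[OF UV(1)] oA[OF UV(2)] this cA[OF UV(1) c False]] False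
        show ?thesis by (simp only: nu[OF UV(1) c] if_False)
      qed
      also have "\<dots> = (\<Sum>d\<in>{d \<in> rcosets\<^bsub>GA\<^esub> (V \<inter> A). d \<subseteq> c \<inter> A}. \<mu> (V \<inter> A) d n) mod int p ^ n"
      proof (rule Zp_finsum[OF p0])
        show "\<mu> (V \<inter> A) \<in> {d \<in> rcosets\<^bsub>GA\<^esub> (V \<inter> A). d \<subseteq> c \<inter> A} \<rightarrow> carrier (Zp p)" using mZp[OF oA[OF UV(2)]] by auto
        show "finite {d \<in> rcosets\<^bsub>GA\<^esub> (V \<inter> A). d \<subseteq> c \<inter> A}" unfolding im[symmetric] using fD1 by simp
      qed
      also have "\<dots> = (\<Sum>d\<in>D1. \<mu> (V \<inter> A) (d \<inter> A) n) mod int p ^ n"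
        unfolding im[symmetric] by (simp add: sum.reindex[OF inj])
      finally show ?thesis by simp
    qed
    finally show "\<nu> U c n = (\<Oplus>\<^bsub>Zp p\<^esub>d\<in>?D. \<nu> V d) n" by simp
  qed
  moreover have "\<nu> \<in> extensional \<O>" "\<And>U. U \<in> \<O> \<Longrightarrow> \<nu> U \<in> extensional (rcosets U)" by (auto simp: \<nu>_def cgr_incl_def)
  ultimately have "\<nu> \<in> carrier R" unfolding cgr_carrier_iff using nuZp by blast
  then show ?thesis by (simp add: \<nu>_def)
qed

text \<open>Through this, an element coming from Z_p[[A]] lives on the cosets of powers of
  \<open>g\<close> once \<open>g\<close> generates \<open>A\<close> modulo \<open>U\<close>.\<close>

lemma cgr_incl_support:
  assumes "U \<in> \<O>" "c \<in> rcosets U" "cgr_incl p G T A \<mu> U c n \<noteq> 0"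
  shows "c \<inter> A \<noteq> {}"
  using assms by (auto simp: cgr_incl_def Zp_ops)

end

text \<open>Commutativity of Z_p[[G]] is an assumption of this locale. In the application it is part
  of the module axioms for \<open>M\<close>, since \<open>module\<close> is a locale over a
  commutative ring.\<close>

locale cgr_ring = cgr +
  assumes cring_R: "cring (completed_group_ring p G T)"
begin

sublocale R: cring "completed_group_ring p G T" by (rule cring_R)

abbreviation zi where "zi z \<equiv> single (zp_of_int p z) \<one>"
abbreviation gp where "gp g \<equiv> single \<one>\<^bsub>Zp p\<^esub> g"

lemma zi_closed [simp]: "zi z \<in> carrier R" by (simp add: single_closed zp_of_int_closed[OF p0])
lemma gp_closed [simp]: "g \<in> carrier G \<Longrightarrow> gp g \<in> carrier R"
  using single_closed[of "\<one>\<^bsub>Zp p\<^esub>" g] zp_of_int_closed[OF p0, of 1] by (simp add: Zp_one_zero(1)[OF p0])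

lemma single_mult:
  assumes a: "a \<in> carrier (Zp p)" "b \<in> carrier (Zp p)" and g: "g \<in> carrier G" "h \<in> carrier G"
  shows "single a g \<otimes>\<^bsub>R\<^esub> single b h = single (a \<otimes>\<^bsub>Zp p\<^esub> b) (g \<otimes> h)"
proof (rule cgr_eqI)
  have ab: "a \<otimes>\<^bsub>Zp p\<^esub> b \<in> carrier (Zp p)" using Zp_closed(2)[OF p0 a] .
  show "single a g \<otimes>\<^bsub>R\<^esub> single b h \<in> carrier R" using single_closed a g by simp
  show "single (a \<otimes>\<^bsub>Zp p\<^esub> b) (g \<otimes> h) \<in> carrier R" using single_closed[OF ab] g by simp
  fix U c assume U: "U \<in> \<O>" and c: "c \<in> rcosets U"
  obtain x where x: "x \<in> carrier G" "c = U #> x" using c by (rule rcosetsE)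
  have gx: "inv g \<otimes> x \<in> carrier G" using g x by simp
  have "h \<in> U #> (inv g \<otimes> x) \<longleftrightarrow> U #> (inv g \<otimes> x) = U #> h"
    by (rule mem_rcoset_iff[OF U g(2) rcosetsI[OF U gx]])
  also have "\<dots> \<longleftrightarrow> U #> x = U #> (g \<otimes> h)"
  proof
    assume e: "U #> (inv g \<otimes> x) = U #> h"
    have "U #> x = U #> (g \<otimes> (inv g \<otimes> x))" using g x by (simp add: m_assoc[symmetric])
    also have "\<dots> = (U #> g) <#> (U #> h)" using rcoset_mult[OF U g(1) gx] e by simp
    finally show "U #> x = U #> (g \<otimes> h)" using rcoset_mult[OF U g] by simp
  next
    assume e: "U #> x = U #> (g \<otimes> h)"
    have "U #> (inv g \<otimes> x) = (U #> inv g) <#> (U #> (g \<otimes> h))" using rcoset_mult[OF U _ x(1), of "inv g"] g e by simp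
    also have "\<dots> = U #> h" using rcoset_mult[OF U, of "inv g" "g \<otimes> h"] g by (simp add: m_assoc[symmetric])
    finally show "U #> (inv g \<otimes> x) = U #> h" .
  qed
  also have "\<dots> \<longleftrightarrow> g \<otimes> h \<in> U #> x" using mem_rcoset_iff[OF U m_closed[OF g] rcosetsI[OF U x(1)]] by simp
  finally have iff: "h \<in> U #> (inv g \<otimes> x) \<longleftrightarrow> g \<otimes> h \<in> U #> x" .
  show "(single a g \<otimes>\<^bsub>R\<^esub> single b h) U c = single (a \<otimes>\<^bsub>Zp p\<^esub> b) (g \<otimes> h) U c"
    unfolding x(2) single_mult_apply[OF a(1) g(1) single_closed[OF a(2) g(2)] U x(1)]
      single_apply[OF U rcosetsI[OF U gx]] single_apply[OF U rcosetsI[OF U x(1)]]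
    using iff Zp_mult_one_zero(3)[OF p0 a(1)] by simp
qed

lemma zi_add: "zi (a + b) = zi a \<oplus>\<^bsub>R\<^esub> zi b" by (simp add: single_add zp_of_int_ops[OF p0])
lemma zi_mult: "zi (a * b) = zi a \<otimes>\<^bsub>R\<^esub> zi b"
  using single_mult[of "zp_of_int p a" "zp_of_int p b" \<one> \<one>] zp_of_int_closed[OF p0] by (simp add: zp_of_int_ops[OF p0])
lemma zi_0: "zi 0 = \<zero>\<^bsub>R\<^esub>" by (simp add: single_zero flip: Zp_one_zero(2)[OF p0])
lemma zi_1: "zi 1 = \<one>\<^bsub>R\<^esub>" by (simp add: single_one flip: Zp_one_zero(1)[OF p0])

lemma gp_mult: "g \<in> carrier G \<Longrightarrow> h \<in> carrier G \<Longrightarrow> gp g \<otimes>\<^bsub>R\<^esub> gp h = gp (g \<otimes> h)"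
proof -
  have o: "\<one>\<^bsub>Zp p\<^esub> \<in> carrier (Zp p)" using zp_of_int_closed[OF p0, of 1] by (simp add: Zp_one_zero(1)[OF p0])
  show "g \<in> carrier G \<Longrightarrow> h \<in> carrier G \<Longrightarrow> gp g \<otimes>\<^bsub>R\<^esub> gp h = gp (g \<otimes> h)"
    using single_mult[OF o o] by (simp add: Zp_mult_one_zero(1)[OF p0 o])
qed

lemma gp_one: "gp \<one> = \<one>\<^bsub>R\<^esub>" by (rule single_one)

lemma gp_pow: "g \<in> carrier G \<Longrightarrow> gp g [^]\<^bsub>R\<^esub> (n::nat) = gp (g [^] n)"
  by (induction n) (simp_all add: gp_one gp_mult R.nat_pow_Suc nat_pow_Suc)

lemma zi_gp: "g \<in> carrier G \<Longrightarrow> zi z \<otimes>\<^bsub>R\<^esub> gp g = single (zp_of_int p z) g"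
  using single_mult[of "zp_of_int p z" "\<one>\<^bsub>Zp p\<^esub>" \<one> g] zp_of_int_closed[OF p0] zp_of_int_ops(2)[OF p0, of z 1]
  by (simp add: Zp_one_zero(1)[OF p0])

text \<open>Only addition is known coefficient by coefficient; the difference is recovered from (a -
  b) + b = a.\<close>

lemma ideal_diff_iff:
  assumes V: "V \<in> \<O>" and ab: "a \<in> carrier R" "b \<in> carrier R"
  shows "a \<ominus>\<^bsub>R\<^esub> b \<in> cgr_ideal V n \<longleftrightarrow> (\<forall>c\<in>rcosets V. a V c n = b V c n)"
proof -
  have eq: "(a \<ominus>\<^bsub>R\<^esub> b) V c n = 0 \<longleftrightarrow> a V c n = b V c n" if c: "c \<in> rcosets V" for c
  proof -
    let ?d = "(a \<ominus>\<^bsub>R\<^esub> b) V c n"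
    have d: "(a \<ominus>\<^bsub>R\<^esub> b) V c \<in> carrier (Zp p)" using cgr_Zp[OF _ V c] ab by simp
    have bz: "b V c \<in> carrier (Zp p)" using cgr_Zp[OF _ V c] ab by simp
    have "(a \<ominus>\<^bsub>R\<^esub> b) \<oplus>\<^bsub>R\<^esub> b = a" using ab by (simp add: R.minus_eq R.a_assoc R.l_neg)
    then have e: "a V c n = (?d + b V c n) mod int p ^ n" using cgr_add_apply[OF V c, of "a \<ominus>\<^bsub>R\<^esub> b" b] by (simp add: Zp_ops)
    show ?thesis
    proof
      assume "?d = 0" then show "a V c n = b V c n" using e Zp_mod_self[OF p0 bz] by simp
    next
      assume "a V c n = b V c n"
      then have "(?d + b V c n) mod int p ^ n = (0 + b V c n) mod int p ^ n" using e Zp_mod_self[OF p0 bz] by simp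
      then have "?d mod int p ^ n = 0" by (simp add: mod_eq_dvd_iff mod_eq_0_iff_dvd)
      then show "?d = 0" using Zp_mod_self[OF p0 d] by simp
    qed
  qed
  then show ?thesis using ab by (auto simp: cgr_ideal_def)
qed

lemma ideal_add:
  assumes V: "V \<in> \<O>" and "a \<in> cgr_ideal V n" "b \<in> cgr_ideal V n"
  shows "a \<oplus>\<^bsub>R\<^esub> b \<in> cgr_ideal V n"
  using assms by (auto simp: cgr_ideal_def cgr_add_apply Zp_ops)

lemma ideal_mult:
  assumes V: "V \<in> \<O>" and a: "a \<in> carrier R" and b: "b \<in> cgr_ideal V n"
  shows "a \<otimes>\<^bsub>R\<^esub> b \<in> cgr_ideal V n"
proof -
  have bR: "b \<in> carrier R" using b by (simp add: cgr_ideal_def)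
  have "(a \<otimes>\<^bsub>R\<^esub> b) V c n = 0" if c: "c \<in> rcosets V" for c
  proof -
    have "(a \<otimes>\<^bsub>R\<^esub> b) V c n = (\<Sum>d\<in>rcosets V. (a V d \<otimes>\<^bsub>Zp p\<^esub> b V (inv\<^bsub>G Mod V\<^esub> d <#> c)) n) mod int p ^ n"
      unfolding cgr_mult_apply[OF V c]
      using cgr_Zp[OF a V] cgr_Zp[OF bR V quot_closed[OF V _ c]] Zp_closed(2)[OF p0]
      by (intro Zp_finsum[OF p0 _ finite_rcosets[OF V]]) auto
    also have "(\<Sum>d\<in>rcosets V. (a V d \<otimes>\<^bsub>Zp p\<^esub> b V (inv\<^bsub>G Mod V\<^esub> d <#> c)) n) = 0"
      using b quot_closed[OF V _ c] by (intro sum.neutral) (auto simp: cgr_ideal_def Zp_ops)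
    finally show ?thesis by simp
  qed
  then show ?thesis using a bR by (simp add: cgr_ideal_def)
qed

lemma ideal_zero: "V \<in> \<O> \<Longrightarrow> \<zero>\<^bsub>R\<^esub> \<in> cgr_ideal V n"
  by (simp add: cgr_ideal_def cgr_zero_apply Zp_ops)

lemma ideal_minus:
  assumes V: "V \<in> \<O>" and b: "b \<in> cgr_ideal V n" shows "\<ominus>\<^bsub>R\<^esub> b \<in> cgr_ideal V n"
proof -
  have "b \<in> carrier R" using b by (simp add: cgr_ideal_def)
  then have "\<ominus>\<^bsub>R\<^esub> b = (\<ominus>\<^bsub>R\<^esub> \<one>\<^bsub>R\<^esub>) \<otimes>\<^bsub>R\<^esub> b" by (simp add: R.l_minus)
  then show ?thesis using ideal_mult[OF V _ b] by simp
qed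

lemma gp_diff_ideal:
  assumes V: "V \<in> \<O>" and g: "g \<in> carrier G" "h \<in> carrier G" and e: "g \<otimes> inv h \<in> V"
  shows "gp g \<ominus>\<^bsub>R\<^esub> gp h \<in> cgr_ideal V n"
proof -
  have "g \<in> c \<longleftrightarrow> h \<in> c" if "c \<in> rcosets V" for c
    using mem_rcoset_iff[OF V g(1) that] mem_rcoset_iff[OF V g(2) that] rcoset_eq_iff[OF V g] e by auto
  then show ?thesis unfolding ideal_diff_iff[OF V gp_closed[OF g(1)] gp_closed[OF g(2)]] by (simp add: single_apply[OF V])
qed

lemma int_eval: "g \<in> carrier G \<Longrightarrow> int_eval R zi (gp g)"
  by (intro int_eval.intro int_eval_axioms.intro cring_R) (auto simp: zi_add zi_mult zi_0 zi_1)

text \<open>Induction on the number of cosets whose coefficient is nonzero modulo p^n: a term z g^i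
  with g^i in such a coset removes it. This is why f can be replaced by an integer polynomial in
  \<open>g\<close> at a given level.\<close>

lemma approx_by_polynomial:
  assumes V: "V \<in> \<O>" and g: "g \<in> carrier G" and s: "s \<in> carrier R"
    and supp: "\<And>c. c \<in> rcosets V \<Longrightarrow> s V c n \<noteq> 0 \<Longrightarrow> \<exists>i::nat. g [^] i \<in> c"
  shows "\<exists>P. s \<ominus>\<^bsub>R\<^esub> int_eval.ev R zi (gp g) P \<in> cgr_ideal V n"
  using s supp
proof (induction "card {c \<in> rcosets V. s V c n \<noteq> 0}" arbitrary: s rule: less_induct)
  case less
  interpret E: int_eval R zi "gp g" by (rule int_eval[OF g])
  let ?S = "{c \<in> rcosets V. s V c n \<noteq> 0}"
  have fin: "finite ?S" using finite_rcosets[OF V] by simp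
  show ?case
  proof (cases "?S = {}")
    case True
    then have "s \<in> cgr_ideal V n" using less.prems(1) by (auto simp: cgr_ideal_def)
    then show ?thesis using less.prems(1) by (intro exI[of _ 0]) (simp add: R.minus_eq)
  next
    case False
    then obtain c where c: "c \<in> rcosets V" "s V c n \<noteq> 0" by auto
    then obtain i :: nat where i: "g [^] i \<in> c" using less.prems(2) by blast
    \<comment> \<open>Component n of a p-adic integer is an honest integer, the least residue modulo
      p^n, and can serve as a coefficient.\<close>
    define z where "z = s V c n"
    have gi: "g [^] i \<in> carrier G" using g by simp
    have zm: "z mod int p ^ n = z" unfolding z_def by (rule Zp_mod_self[OF p0 cgr_Zp[OF less.prems(1) V c(1)]])
    define e where "e = single (zp_of_int p z) (g [^] i)"
    have eR: "e \<in> carrier R" unfolding e_def by (rule single_closed[OF zp_of_int_closed[OF p0] gi])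
    have e_ev: "e = E.ev (Polynomial.monom z i)"
    proof -
      have "Polynomial.monom z i = [:z:] * [:0, 1:] ^ i" by (simp add: monom_altdef)
      then show ?thesis by (simp only: E.ev_mult E.ev_power E.ev_t E.ev_const gp_pow[OF g] zi_gp[OF gi] e_def)
    qed
    have e_app: "e V d n = (if d = c then z else 0)" if d: "d \<in> rcosets V" for d
      using mem_rcoset_iff[OF V gi d] mem_rcoset_iff[OF V gi c(1)] i zm
      by (auto simp: e_def single_apply[OF V d] zp_of_int_def Zp_ops)
    define s' where "s' = s \<ominus>\<^bsub>R\<^esub> e"
    have s'R: "s' \<in> carrier R" using less.prems(1) eR by (simp add: s'_def)
    have s_eq: "s = s' \<oplus>\<^bsub>R\<^esub> e" using less.prems(1) eR by (simp add: s'_def R.minus_eq R.a_assoc R.l_neg)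
    have s'_app: "s' V d n = (if d = c then 0 else s V d n)" if d: "d \<in> rcosets V" for d
    proof -
      have dz: "s' V d n mod int p ^ n = s' V d n" by (rule Zp_mod_self[OF p0 cgr_Zp[OF s'R V d]])
      have "s V d n = (s' V d n + e V d n) mod int p ^ n" using arg_cong[OF s_eq, of "\<lambda>f. f V d n"] cgr_add_apply[OF V d] by (simp add: Zp_ops)
      then have 1: "s V d n = (s' V d n + (if d = c then z else 0)) mod int p ^ n" by (simp add: e_app[OF d])
      show ?thesis
      proof (cases "d = c")
        case True
        then have "(s' V d n + z) mod int p ^ n = (0 + z) mod int p ^ n" using 1 zm by (simp add: z_def)
        then have "s' V d n mod int p ^ n = 0" by (simp add: mod_eq_dvd_iff mod_eq_0_iff_dvd)
        then show ?thesis using dz True by simp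
      qed (use 1 dz in simp)
    qed
    have "{d \<in> rcosets V. s' V d n \<noteq> 0} = ?S - {c}" using c(1) by (auto simp: s'_app split: if_splits)
    then have "card {d \<in> rcosets V. s' V d n \<noteq> 0} < card ?S" using fin c by (simp add: card_Diff1_less del: card_Diff_insert)
    moreover have "\<exists>i::nat. g [^] i \<in> d" if "d \<in> rcosets V" "s' V d n \<noteq> 0" for d
      using that less.prems(2) by (auto simp: s'_app split: if_splits)
    ultimately obtain P where P: "s' \<ominus>\<^bsub>R\<^esub> E.ev P \<in> cgr_ideal V n" using less.hyps[of s'] s'R by blast
    have "s \<ominus>\<^bsub>R\<^esub> E.ev (P + Polynomial.monom z i) = s' \<ominus>\<^bsub>R\<^esub> E.ev P"
      unfolding E.ev_add e_ev[symmetric] s'_def using less.prems(1) eR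
      by (simp add: R.minus_eq R.minus_add R.a_ac)
    then show ?thesis using P by metis
  qed
qed

end

section \<open>Profinite modules over completed group rings\<close>

locale profinite_cgr_module = cgr G T p for G :: "'g monoid" (structure) and T p +
  fixes M :: "('g cgr, 'x) module" and TM :: "'x topology"
  assumes prof: "profinite_module (completed_group_ring p G T) (completed_group_ring_topology p G T) M TM"
begin

sublocale module "completed_group_ring p G T" M
  using prof by (simp add: profinite_module_def)

sublocale cgr_ring G T p
  by unfold_locales

lemma topology_facts:
  shows topspace_TM: "topspace TM = carrier M" and compact_TM: "compact_space TM" and Hausdorff_TM: "Hausdorff_space TM"
    and cont_add: "continuous_map (prod_topology TM TM) TM (\<lambda>(x, y). x \<oplus>\<^bsub>M\<^esub> y)"
    and cont_smult2: "continuous_map (prod_topology (completed_group_ring_topology p G T) TM) TM (\<lambda>(r, x). r \<odot>\<^bsub>M\<^esub> x)"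
  using prof by (auto simp: profinite_module_def profinite_space_def)

lemma continuous_map_add:
  assumes "continuous_map Z TM f" "continuous_map Z TM g"
  shows "continuous_map Z TM (\<lambda>z. f z \<oplus>\<^bsub>M\<^esub> g z)"
  using continuous_map_compose[OF continuous_map_pairedI[OF assms] cont_add] by (simp add: o_def)

lemma continuous_map_smult:
  assumes "r \<in> carrier R" "continuous_map Z TM f"
  shows "continuous_map Z TM (\<lambda>z. r \<odot>\<^bsub>M\<^esub> f z)"
proof -
  have "continuous_map Z (completed_group_ring_topology p G T) (\<lambda>z. r)" using assms(1) by (simp add: topspace_cgr)
  from continuous_map_compose[OF continuous_map_pairedI[OF this assms(2)] cont_smult2] show ?thesis by (simp add: o_def)
qed

lemma continuous_map_orbit:
  assumes "x \<in> carrier M"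
  shows "continuous_map (completed_group_ring_topology p G T) TM (\<lambda>r. r \<odot>\<^bsub>M\<^esub> x)"
proof -
  let ?TR = "completed_group_ring_topology p G T"
  have "continuous_map ?TR ?TR (\<lambda>r. r)" "continuous_map ?TR TM (\<lambda>r. x)" using assms by (simp_all add: topspace_TM)
  from continuous_map_compose[OF continuous_map_pairedI[OF this] cont_smult2] show ?thesis by (simp add: o_def)
qed

text \<open>Continuity of r |-> y + r x at 0; it will separate a point from a closed set at a finite
  level.\<close>

lemma orbit_nbhd:
  assumes W: "openin TM W" "y \<in> W" and x: "x \<in> carrier M"
  shows "\<exists>V\<in>\<O>. \<exists>n. \<forall>\<kappa>\<in>cgr_ideal V n. y \<oplus>\<^bsub>M\<^esub> \<kappa> \<odot>\<^bsub>M\<^esub> x \<in> W"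
proof -
  let ?TR = "completed_group_ring_topology p G T"
  have y: "y \<in> carrier M" using openin_subset[OF W(1)] W(2) topspace_TM by auto
  have "continuous_map ?TR TM (\<lambda>r. y \<oplus>\<^bsub>M\<^esub> r \<odot>\<^bsub>M\<^esub> x)"
    by (rule continuous_map_add[OF _ continuous_map_orbit[OF x]]) (simp add: y topspace_TM)
  from openin_continuous_map_preimage[OF this W(1)]
  have o: "openin ?TR {r \<in> carrier R. y \<oplus>\<^bsub>M\<^esub> r \<odot>\<^bsub>M\<^esub> x \<in> W}" by (simp add: topspace_cgr)
  have "\<zero>\<^bsub>R\<^esub> \<in> {r \<in> carrier R. y \<oplus>\<^bsub>M\<^esub> r \<odot>\<^bsub>M\<^esub> x \<in> W}" using x y W(2) by simp
  from open_nbhd_0[OF o this] show ?thesis by blast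
qed

text \<open>For a subgroup \<open>N\<close>, the preimage in M of the F_p-span of x in M/(N + pM).
  Letting \<open>z\<close> run through finitely many residues, instead of all of \<int>, presents it
  as a finite union of compact sets.\<close>

definition gen_set :: "'x set \<Rightarrow> 'x \<Rightarrow> 'x set" where
  "gen_set N x = {zi z \<odot>\<^bsub>M\<^esub> x \<oplus>\<^bsub>M\<^esub> (n \<oplus>\<^bsub>M\<^esub> zi (int p) \<odot>\<^bsub>M\<^esub> w) | z n w. z \<in> {0..<int p} \<and> n \<in> N \<and> w \<in> carrier M}"

text \<open>For each residue the piece is a continuous image of the compact product of
  \<open>N\<close> and M, hence closed in a Hausdorff space.\<close>

lemma closedin_gen_set:
  assumes N: "closedin TM N" and x: "x \<in> carrier M"
  shows "closedin TM (gen_set N x)"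
proof -
  define f where "f z = (\<lambda>(n, w). zi z \<odot>\<^bsub>M\<^esub> x \<oplus>\<^bsub>M\<^esub> (n \<oplus>\<^bsub>M\<^esub> zi (int p) \<odot>\<^bsub>M\<^esub> w))" for z
  have "gen_set N x = (\<Union>z\<in>{0..<int p}. f z ` (N \<times> carrier M))"
    unfolding gen_set_def f_def by force
  moreover have "closedin TM (f z ` (N \<times> carrier M))" for z
  proof -
    have "continuous_map (prod_topology TM TM) TM (\<lambda>q. zi z \<odot>\<^bsub>M\<^esub> x \<oplus>\<^bsub>M\<^esub> (fst q \<oplus>\<^bsub>M\<^esub> zi (int p) \<odot>\<^bsub>M\<^esub> snd q))"
      using x by (intro continuous_map_add continuous_map_smult zi_closed continuous_map_fst continuous_map_snd)
        (simp add: topspace_TM)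
    then have c: "continuous_map (prod_topology TM TM) TM (f z)" by (simp add: f_def case_prod_unfold)
    have "compactin TM N" by (rule closedin_compact_space[OF compact_TM N])
    moreover have "compactin TM (carrier M)" using compact_TM by (simp add: compact_space_def topspace_TM)
    ultimately have "compactin (prod_topology TM TM) (N \<times> carrier M)" by (simp add: compactin_Times)
    from image_compactin[OF this c] show ?thesis by (rule compactin_imp_closedin[OF Hausdorff_TM])
  qed
  ultimately show ?thesis by (auto intro!: closedin_Union)
qed

text \<open>\<open>N1\<close> and \<open>N2\<close> are subgroups with no assumed stability under
  \<open>g\<close>, so polynomials P with P(g)x in N + pM + Ix need not form an ideal. The
  assumptions \<open>N1\<close> and \<open>N2\<close> hold for every y, which permits a multiplier Q
  in the definition of the ideals.\<close>

lemma level_dichotomy: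
  assumes pr: "Factorial_Ring.prime p" "odd p"
    and V: "V \<in> \<O>" and x: "x \<in> carrier M"
    and N: "subgroup N1 (add_monoid M)" "subgroup N2 (add_monoid M)"
    and g: "g \<in> carrier G" "\<gamma> \<in> carrier G" "h1 \<in> carrier G" "h2 \<in> carrier G"
    and gpow: "g [^] (p ^ m) \<in> V" and h1: "h1 = g \<otimes> \<gamma>" and h2: "(g \<otimes> h2) \<otimes> inv \<gamma> \<in> V"
    and N1: "\<And>y. y \<in> carrier M \<Longrightarrow> gp h1 \<odot>\<^bsub>M\<^esub> y \<ominus>\<^bsub>M\<^esub> y \<in> N1"
    and N2: "\<And>y. y \<in> carrier M \<Longrightarrow> gp h2 \<odot>\<^bsub>M\<^esub> y \<ominus>\<^bsub>M\<^esub> y \<in> N2"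
    and S: "\<And>y. y \<in> carrier M \<Longrightarrow> \<exists>s\<in>carrier R. y = s \<odot>\<^bsub>M\<^esub> x \<and> (\<forall>c\<in>rcosets V. s V c n \<noteq> 0 \<longrightarrow> (\<exists>i::nat. g [^] i \<in> c))"
  shows "(\<forall>y\<in>carrier M. \<exists>e\<in>gen_set N1 x. \<exists>\<kappa>\<in>cgr_ideal V n. y = e \<oplus>\<^bsub>M\<^esub> \<kappa> \<odot>\<^bsub>M\<^esub> x) \<or>
         (\<forall>y\<in>carrier M. \<exists>e\<in>gen_set N2 x. \<exists>\<kappa>\<in>cgr_ideal V n. y = e \<oplus>\<^bsub>M\<^esub> \<kappa> \<odot>\<^bsub>M\<^esub> x)"
proof -
  interpret E: int_eval R zi "gp g" by (rule int_eval[OF g(1)])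
  define I where "I = cgr_ideal V n"
  have IR: "\<kappa> \<in> carrier R" if "\<kappa> \<in> I" for \<kappa> using that cgr_ideal_subset by (auto simp: I_def)
  note Iadd = ideal_add[OF V, of _ n, folded I_def] and Imult = ideal_mult[OF V, of _ _ n, folded I_def]
    and I0 = ideal_zero[OF V, of n, folded I_def] and Iminus = ideal_minus[OF V, of _ n, folded I_def]
  have S': "\<exists>s\<in>carrier R. \<exists>P. \<exists>\<kappa>\<in>I. y = s \<odot>\<^bsub>M\<^esub> x \<and> s = E.ev P \<oplus>\<^bsub>R\<^esub> \<kappa>" if y: "y \<in> carrier M" for y
  proof -
    obtain s where s: "s \<in> carrier R" "y = s \<odot>\<^bsub>M\<^esub> x" "\<And>c. c \<in> rcosets V \<Longrightarrow> s V c n \<noteq> 0 \<Longrightarrow> \<exists>i::nat. g [^] i \<in> c"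
      using S[OF y] by blast
    obtain P where P: "s \<ominus>\<^bsub>R\<^esub> E.ev P \<in> I" using approx_by_polynomial[OF V g(1) s(1,3)] by (auto simp: I_def)
    have "s = E.ev P \<oplus>\<^bsub>R\<^esub> (s \<ominus>\<^bsub>R\<^esub> E.ev P)" using s(1) by (simp add: R.minus_eq R.a_ac R.r_neg)
    then show ?thesis using s(1,2) P by blast
  qed
  \<comment> \<open>The subgroup N + pM + Ix, modulo which everything at this level is
    computed.\<close>
  define W where "W N = {k \<oplus>\<^bsub>M\<^esub> zi (int p) \<odot>\<^bsub>M\<^esub> w \<oplus>\<^bsub>M\<^esub> \<kappa> \<odot>\<^bsub>M\<^esub> x | k w \<kappa>. k \<in> N \<and> w \<in> carrier M \<and> \<kappa> \<in> I}" for N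
  have sgM: "k \<in> carrier M" if "subgroup N (add_monoid M)" "k \<in> N" for N k using subgroup.mem_carrier[OF that] by simp
  have sg0: "\<zero>\<^bsub>M\<^esub> \<in> N" if "subgroup N (add_monoid M)" for N using subgroup.one_closed[OF that] by simp
  have sgadd: "k \<oplus>\<^bsub>M\<^esub> l \<in> N" if "subgroup N (add_monoid M)" "k \<in> N" "l \<in> N" for N k l using subgroup.m_closed[OF that] by simp
  have Wadd: "a \<oplus>\<^bsub>M\<^esub> b \<in> W N" if sg: "subgroup N (add_monoid M)" and ab: "a \<in> W N" "b \<in> W N" for N a b
  proof -
    obtain k w \<kappa> where 1: "k \<in> N" "w \<in> carrier M" "\<kappa> \<in> I" "a = k \<oplus>\<^bsub>M\<^esub> zi (int p) \<odot>\<^bsub>M\<^esub> w \<oplus>\<^bsub>M\<^esub> \<kappa> \<odot>\<^bsub>M\<^esub> x"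
      using ab(1) by (auto simp: W_def)
    obtain k' w' \<kappa>' where 2: "k' \<in> N" "w' \<in> carrier M" "\<kappa>' \<in> I" "b = k' \<oplus>\<^bsub>M\<^esub> zi (int p) \<odot>\<^bsub>M\<^esub> w' \<oplus>\<^bsub>M\<^esub> \<kappa>' \<odot>\<^bsub>M\<^esub> x"
      using ab(2) by (auto simp: W_def)
    have "a \<oplus>\<^bsub>M\<^esub> b = (k \<oplus>\<^bsub>M\<^esub> k') \<oplus>\<^bsub>M\<^esub> zi (int p) \<odot>\<^bsub>M\<^esub> (w \<oplus>\<^bsub>M\<^esub> w') \<oplus>\<^bsub>M\<^esub> (\<kappa> \<oplus>\<^bsub>R\<^esub> \<kappa>') \<odot>\<^bsub>M\<^esub> x"
      using 1 2 x sgM[OF sg 1(1)] sgM[OF sg 2(1)] IR[OF 1(3)] IR[OF 2(3)]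
      by (simp add: smult_l_distr smult_r_distr M.a_ac)
    then show ?thesis using sgadd[OF sg 1(1) 2(1)] Iadd[OF 1(3) 2(3)] 1 2 by (auto simp: W_def)
  qed
  have WN: "k \<oplus>\<^bsub>M\<^esub> \<kappa> \<odot>\<^bsub>M\<^esub> x \<in> W N" if "subgroup N (add_monoid M)" "k \<in> N" "\<kappa> \<in> I" for N k \<kappa>
  proof -
    have "k \<oplus>\<^bsub>M\<^esub> \<kappa> \<odot>\<^bsub>M\<^esub> x = k \<oplus>\<^bsub>M\<^esub> zi (int p) \<odot>\<^bsub>M\<^esub> \<zero>\<^bsub>M\<^esub> \<oplus>\<^bsub>M\<^esub> \<kappa> \<odot>\<^bsub>M\<^esub> x" using sgM[OF that(1,2)] by simp
    then show ?thesis using that(2,3) M.zero_closed unfolding W_def by blast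
  qed
  have WI: "\<kappa> \<odot>\<^bsub>M\<^esub> x \<in> W N" if "subgroup N (add_monoid M)" "\<kappa> \<in> I" for N \<kappa>
    using WN[OF that(1) sg0[OF that(1)] that(2)] IR[OF that(2)] x by simp
  have Wp: "zi (int p) \<odot>\<^bsub>M\<^esub> w \<in> W N" if "subgroup N (add_monoid M)" "w \<in> carrier M" for N w
  proof -
    have "zi (int p) \<odot>\<^bsub>M\<^esub> w = \<zero>\<^bsub>M\<^esub> \<oplus>\<^bsub>M\<^esub> zi (int p) \<odot>\<^bsub>M\<^esub> w \<oplus>\<^bsub>M\<^esub> \<zero>\<^bsub>R\<^esub> \<odot>\<^bsub>M\<^esub> x" using that(2) x by simp
    then show ?thesis using that(2) sg0[OF that(1)] I0 unfolding W_def by blast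
  qed
  \<comment> \<open>The quantifier over Q makes \<open>J N\<close> closed under multiplication
    although \<open>W N\<close> is not known to be.\<close>
  define J where "J N P \<longleftrightarrow> (\<forall>Q. E.ev (P * Q) \<odot>\<^bsub>M\<^esub> x \<in> W N)" for N P
  have Jadd: "J N (a + b)" if "subgroup N (add_monoid M)" "J N a" "J N b" for N a b
    using that Wadd x by (auto simp: J_def distrib_right E.ev_add smult_l_distr)
  have Jmult: "J N (b * a)" if "J N a" for N a b
  proof -
    have "E.ev (b * a * Q) \<odot>\<^bsub>M\<^esub> x \<in> W N" for Q
    proof -
      have "b * a * Q = a * (b * Q)" by (simp only: mult.assoc mult.left_commute)
      moreover have "E.ev (a * (b * Q)) \<odot>\<^bsub>M\<^esub> x \<in> W N" using that unfolding J_def by (rule spec)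
      ultimately show ?thesis by (simp only:)
    qed
    then show ?thesis unfolding J_def by (rule allI)
  qed
  have Jp: "J N (of_nat p)" if "subgroup N (add_monoid M)" for N
    using Wp[OF that] x by (auto simp: J_def E.ev_mult E.ev_of_nat smult_assoc1)
  have Jcyc: "J N ([:0, 1:] ^ (p ^ m) - 1)" if sg: "subgroup N (add_monoid M)" for N
    unfolding J_def
  proof
    fix Q
    have "gp (g [^] (p ^ m)) \<ominus>\<^bsub>R\<^esub> gp \<one> \<in> I" unfolding I_def by (rule gp_diff_ideal[OF V]) (use g(1) gpow in auto)
    then have "E.ev ([:0, 1:] ^ (p ^ m) - 1) \<in> I" using g(1) by (simp add: E.ev_diff E.ev_power E.ev_t gp_pow gp_one)
    then have "E.ev Q \<otimes>\<^bsub>R\<^esub> E.ev ([:0, 1:] ^ (p ^ m) - 1) \<in> I" by (intro Imult) auto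
    then show "E.ev (([:0, 1:] ^ (p ^ m) - 1) * Q) \<odot>\<^bsub>M\<^esub> x \<in> W N" unfolding mult.commute[of _ Q] E.ev_mult by (rule WI[OF sg])
  qed
  \<comment> \<open>\<open>f\<close> expresses the action of \<gamma> on the generator x, and
    \<open>F\<close> is its polynomial approximation with error \<open>\<kappa>\<close> in
    \<open>I\<close>.\<close>
  have "gp \<gamma> \<odot>\<^bsub>M\<^esub> x \<in> carrier M" using g x by simp
  then obtain f F \<kappa> where f: "f \<in> carrier R" "gp \<gamma> \<odot>\<^bsub>M\<^esub> x = f \<odot>\<^bsub>M\<^esub> x" "\<kappa> \<in> I" "f = E.ev F \<oplus>\<^bsub>R\<^esub> \<kappa>" using S' by blast
  have kR: "\<kappa> \<in> carrier R" by (rule IR[OF f(3)])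
  have J1: "J N1 ([:0, 1:] * F - 1)"
    unfolding J_def
  proof
    fix Q
    \<comment> \<open>The relation of \<open>h1\<close> is applied to y = Q(g)x: as h1 = g\<gamma>,
      h1 y - y is (g f - 1) Q(g) x.\<close>
    define r where "r = gp g \<otimes>\<^bsub>R\<^esub> E.ev Q"
    have rR: "r \<in> carrier R" using g by (simp add: r_def)
    have "gp h1 \<odot>\<^bsub>M\<^esub> (E.ev Q \<odot>\<^bsub>M\<^esub> x) = (r \<otimes>\<^bsub>R\<^esub> gp \<gamma>) \<odot>\<^bsub>M\<^esub> x"
    proof -
      have "gp h1 \<odot>\<^bsub>M\<^esub> (E.ev Q \<odot>\<^bsub>M\<^esub> x) = ((gp g \<otimes>\<^bsub>R\<^esub> gp \<gamma>) \<otimes>\<^bsub>R\<^esub> E.ev Q) \<odot>\<^bsub>M\<^esub> x"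
        using g x by (simp add: h1 gp_mult smult_assoc1)
      also have "(gp g \<otimes>\<^bsub>R\<^esub> gp \<gamma>) \<otimes>\<^bsub>R\<^esub> E.ev Q = r \<otimes>\<^bsub>R\<^esub> gp \<gamma>" using g by (simp add: r_def R.m_ac)
      finally show ?thesis .
    qed
    also have "\<dots> = (r \<otimes>\<^bsub>R\<^esub> f) \<odot>\<^bsub>M\<^esub> x" using g x rR f by (simp add: smult_assoc1)
    also have "\<dots> = (r \<otimes>\<^bsub>R\<^esub> E.ev F) \<odot>\<^bsub>M\<^esub> x \<oplus>\<^bsub>M\<^esub> (r \<otimes>\<^bsub>R\<^esub> \<kappa>) \<odot>\<^bsub>M\<^esub> x"
      using rR x kR by (simp add: f(4) R.r_distr smult_l_distr)
    finally have 1: "gp h1 \<odot>\<^bsub>M\<^esub> (E.ev Q \<odot>\<^bsub>M\<^esub> x) = (r \<otimes>\<^bsub>R\<^esub> E.ev F) \<odot>\<^bsub>M\<^esub> x \<oplus>\<^bsub>M\<^esub> (r \<otimes>\<^bsub>R\<^esub> \<kappa>) \<odot>\<^bsub>M\<^esub> x" .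
    have "([:0, 1:] * F - 1) * Q = ([:0, 1:] * Q) * F - Q" by (simp add: algebra_simps)
    then have "E.ev (([:0, 1:] * F - 1) * Q) = r \<otimes>\<^bsub>R\<^esub> E.ev F \<ominus>\<^bsub>R\<^esub> E.ev Q"
      by (simp only: E.ev_diff E.ev_mult E.ev_t r_def)
    then have "E.ev (([:0, 1:] * F - 1) * Q) \<odot>\<^bsub>M\<^esub> x = (r \<otimes>\<^bsub>R\<^esub> E.ev F) \<odot>\<^bsub>M\<^esub> x \<ominus>\<^bsub>M\<^esub> E.ev Q \<odot>\<^bsub>M\<^esub> x"
      using rR x by (simp add: R.minus_eq M.minus_eq smult_l_distr smult_l_minus)
    also have "\<dots> = (gp h1 \<odot>\<^bsub>M\<^esub> (E.ev Q \<odot>\<^bsub>M\<^esub> x) \<ominus>\<^bsub>M\<^esub> E.ev Q \<odot>\<^bsub>M\<^esub> x) \<oplus>\<^bsub>M\<^esub> (\<ominus>\<^bsub>R\<^esub> (r \<otimes>\<^bsub>R\<^esub> \<kappa>)) \<odot>\<^bsub>M\<^esub> x"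
      unfolding 1 using rR x kR by (simp add: M.minus_eq smult_l_minus M.a_ac M.r_neg M.r_neg1 M.r_neg2)
    also have "\<dots> \<in> W N1" by (rule WN[OF N(1) N1 Iminus[OF Imult[OF rR f(3)]]]) (use x in simp)
    finally show "E.ev (([:0, 1:] * F - 1) * Q) \<odot>\<^bsub>M\<^esub> x \<in> W N1" .
  qed
  have J2: "J N2 (F - [:0, 1:])"
    unfolding J_def
  proof
    fix Q
    \<comment> \<open>The relation of \<open>h2\<close> is applied to y = g Q(g) x, since it is g h2
      that agrees with \<gamma> modulo \<open>V\<close>. The result is (f - g) Q(g) x, up to errors
      that lie in \<open>I\<close>.\<close>
    define r where "r = gp g \<otimes>\<^bsub>R\<^esub> E.ev Q"
    have rR: "r \<in> carrier R" using g by (simp add: r_def)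
    define \<kappa>2 where "\<kappa>2 = gp (g \<otimes> h2) \<ominus>\<^bsub>R\<^esub> gp \<gamma>"
    have k2: "\<kappa>2 \<in> I" unfolding \<kappa>2_def I_def by (rule gp_diff_ideal[OF V _ g(2) h2]) (use g in simp)
    have gh2: "gp (g \<otimes> h2) = gp \<gamma> \<oplus>\<^bsub>R\<^esub> \<kappa>2" 
    proof -
      have "gp (g \<otimes> h2) \<in> carrier R" "gp \<gamma> \<in> carrier R" using g by auto
      then show ?thesis by (simp add: \<kappa>2_def R.minus_eq R.a_lcomm[of "gp \<gamma>" "gp (g \<otimes> h2)"] R.r_neg)
    qed
    define \<kappa>3 where "\<kappa>3 = E.ev Q \<otimes>\<^bsub>R\<^esub> \<kappa> \<oplus>\<^bsub>R\<^esub> E.ev Q \<otimes>\<^bsub>R\<^esub> \<kappa>2"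
    have k3: "\<kappa>3 \<in> I" unfolding \<kappa>3_def by (intro Iadd Imult f(3) k2) auto
    have k2R: "\<kappa>2 \<in> carrier R" and k3R: "\<kappa>3 \<in> carrier R" using IR k2 k3 by auto
    have "gp h2 \<odot>\<^bsub>M\<^esub> (r \<odot>\<^bsub>M\<^esub> x) = (gp h2 \<otimes>\<^bsub>R\<^esub> r) \<odot>\<^bsub>M\<^esub> x" using g x rR by (simp add: smult_assoc1)
    also have "gp h2 \<otimes>\<^bsub>R\<^esub> r = E.ev Q \<otimes>\<^bsub>R\<^esub> gp (g \<otimes> h2)" using g by (simp add: r_def R.m_ac flip: gp_mult)
    also have "\<dots> = E.ev Q \<otimes>\<^bsub>R\<^esub> gp \<gamma> \<oplus>\<^bsub>R\<^esub> E.ev Q \<otimes>\<^bsub>R\<^esub> \<kappa>2" using g k2R by (simp add: gh2 R.r_distr)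
    also have "\<dots> \<odot>\<^bsub>M\<^esub> x = (E.ev Q \<otimes>\<^bsub>R\<^esub> f) \<odot>\<^bsub>M\<^esub> x \<oplus>\<^bsub>M\<^esub> (E.ev Q \<otimes>\<^bsub>R\<^esub> \<kappa>2) \<odot>\<^bsub>M\<^esub> x"
      using g x f k2R by (simp add: smult_l_distr smult_assoc1)
    also have "\<dots> = (E.ev F \<otimes>\<^bsub>R\<^esub> E.ev Q) \<odot>\<^bsub>M\<^esub> x \<oplus>\<^bsub>M\<^esub> \<kappa>3 \<odot>\<^bsub>M\<^esub> x"
      using x kR k2R by (simp add: f(4) \<kappa>3_def R.r_distr smult_l_distr M.a_ac R.m_comm[of "E.ev F"])
    finally have 1: "gp h2 \<odot>\<^bsub>M\<^esub> (r \<odot>\<^bsub>M\<^esub> x) = (E.ev F \<otimes>\<^bsub>R\<^esub> E.ev Q) \<odot>\<^bsub>M\<^esub> x \<oplus>\<^bsub>M\<^esub> \<kappa>3 \<odot>\<^bsub>M\<^esub> x" .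
    have "(F - [:0, 1:]) * Q = F * Q - [:0, 1:] * Q" by (simp only: left_diff_distrib)
    then have "E.ev ((F - [:0, 1:]) * Q) = E.ev F \<otimes>\<^bsub>R\<^esub> E.ev Q \<ominus>\<^bsub>R\<^esub> r"
      by (simp only: E.ev_diff E.ev_mult E.ev_t r_def)
    then have "E.ev ((F - [:0, 1:]) * Q) \<odot>\<^bsub>M\<^esub> x = (E.ev F \<otimes>\<^bsub>R\<^esub> E.ev Q) \<odot>\<^bsub>M\<^esub> x \<ominus>\<^bsub>M\<^esub> r \<odot>\<^bsub>M\<^esub> x"
      using rR x by (simp add: R.minus_eq M.minus_eq smult_l_distr smult_l_minus)
    also have "\<dots> = (gp h2 \<odot>\<^bsub>M\<^esub> (r \<odot>\<^bsub>M\<^esub> x) \<ominus>\<^bsub>M\<^esub> r \<odot>\<^bsub>M\<^esub> x) \<oplus>\<^bsub>M\<^esub> (\<ominus>\<^bsub>R\<^esub> \<kappa>3) \<odot>\<^bsub>M\<^esub> x"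
      unfolding 1 using rR x k3R by (simp add: M.minus_eq smult_l_minus M.a_ac M.r_neg M.r_neg1 M.r_neg2)
    also have "\<dots> \<in> W N2" by (rule WN[OF N(2) N2 Iminus[OF k3]]) (use x rR in simp)
    finally show "E.ev ((F - [:0, 1:]) * Q) \<odot>\<^bsub>M\<^esub> x \<in> W N2" .
  qed
  have concl: "\<exists>e\<in>gen_set N x. \<exists>\<kappa>\<in>I. y = e \<oplus>\<^bsub>M\<^esub> \<kappa> \<odot>\<^bsub>M\<^esub> x"
    if sg: "subgroup N (add_monoid M)" and JN: "J N [:-1, 1:]" and y: "y \<in> carrier M" for N y
  proof -
    obtain s P \<kappa> where s: "s \<in> carrier R" "\<kappa> \<in> I" "y = s \<odot>\<^bsub>M\<^esub> x" "s = E.ev P \<oplus>\<^bsub>R\<^esub> \<kappa>" using S'[OF y] by blast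
    define z where "z = poly P 1"
    \<comment> \<open>P is its value at 1 plus a multiple of T - 1, and the multiple sends x into
      \<open>W N\<close>.\<close>
    have "poly (P - [:z:]) 1 = 0" by (simp add: z_def)
    then obtain Q where "P - [:z:] = [:-1, 1:] * Q" unfolding poly_eq_0_iff_dvd by (elim dvdE)
    then have "P = [:z:] + [:-1, 1:] * Q" by (metis add.commute diff_add_cancel)
    then have evP: "E.ev P = zi z \<oplus>\<^bsub>R\<^esub> E.ev ([:-1, 1:] * Q)" by (simp only: E.ev_add E.ev_const)
    obtain k w \<kappa>' where w: "k \<in> N" "w \<in> carrier M" "\<kappa>' \<in> I"
      "E.ev ([:-1, 1:] * Q) \<odot>\<^bsub>M\<^esub> x = k \<oplus>\<^bsub>M\<^esub> zi (int p) \<odot>\<^bsub>M\<^esub> w \<oplus>\<^bsub>M\<^esub> \<kappa>' \<odot>\<^bsub>M\<^esub> x"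
      using JN unfolding J_def W_def by blast
    \<comment> \<open>The integer is reduced to a residue, as \<open>gen_set\<close> demands; the
      rest is absorbed in pM.\<close>
    have "zi z = zi (z mod int p) \<oplus>\<^bsub>R\<^esub> zi (int p) \<otimes>\<^bsub>R\<^esub> zi (z div int p)"
      by (simp flip: zi_add zi_mult)
    then have zz: "zi z \<odot>\<^bsub>M\<^esub> x = zi (z mod int p) \<odot>\<^bsub>M\<^esub> x \<oplus>\<^bsub>M\<^esub> zi (int p) \<odot>\<^bsub>M\<^esub> (zi (z div int p) \<odot>\<^bsub>M\<^esub> x)"
      using x by (simp add: smult_l_distr smult_assoc1)
    define w' where "w' = zi (z div int p) \<odot>\<^bsub>M\<^esub> x \<oplus>\<^bsub>M\<^esub> w"
    have w': "w' \<in> carrier M" using x w by (simp add: w'_def)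
    define e where "e = zi (z mod int p) \<odot>\<^bsub>M\<^esub> x \<oplus>\<^bsub>M\<^esub> (k \<oplus>\<^bsub>M\<^esub> zi (int p) \<odot>\<^bsub>M\<^esub> w')"
    have "y = zi z \<odot>\<^bsub>M\<^esub> x \<oplus>\<^bsub>M\<^esub> E.ev ([:-1, 1:] * Q) \<odot>\<^bsub>M\<^esub> x \<oplus>\<^bsub>M\<^esub> \<kappa> \<odot>\<^bsub>M\<^esub> x"
      using IR[OF s(2)] x E.ev_closed[of "[:-1, 1:] * Q"] by (simp only: s(3,4) evP smult_l_distr zi_closed R.a_closed)
    also have "\<dots> = e \<oplus>\<^bsub>M\<^esub> (\<kappa> \<oplus>\<^bsub>R\<^esub> \<kappa>') \<odot>\<^bsub>M\<^esub> x"
      unfolding w(4) zz e_def w'_def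
      using IR[OF s(2)] IR[OF w(3)] x w(2) sgM[OF sg w(1)] by (simp add: smult_l_distr smult_r_distr M.a_ac)
    finally have "y = e \<oplus>\<^bsub>M\<^esub> (\<kappa> \<oplus>\<^bsub>R\<^esub> \<kappa>') \<odot>\<^bsub>M\<^esub> x" .
    moreover have "e \<in> gen_set N x"
    proof -
      have "z mod int p \<in> {0..<int p}" using p0 by simp
      then show ?thesis unfolding gen_set_def e_def using w(1) w' by blast
    qed
    ultimately show ?thesis using Iadd[OF s(2) w(3)] by blast
  qed
  have "J N1 [:-1, 1:] \<or> J N2 [:-1, 1:]"
    by (rule int_poly_dichotomy[OF pr Jadd[OF N(1)] Jadd[OF N(2)] Jmult Jmult Jp[OF N(1)] Jp[OF N(2)] Jcyc[OF N(1)] Jcyc[OF N(2)] J1 J2])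
  then show ?thesis using concl N unfolding I_def by blast
qed

text \<open>If both inclusions failed, witnesses y1 and y2 would avoid the closed sets even after
  adding Ix for sufficiently small levels I. Intersecting the two subgroups and taking the larger
  exponent gives one level at which both alternatives fail.\<close>

lemma gen_set_dichotomy:
  assumes x: "x \<in> carrier M" and N: "closedin TM N1" "closedin TM N2"
    and level: "\<And>V n. V \<in> \<O> \<Longrightarrow> (\<forall>y\<in>carrier M. \<exists>e\<in>gen_set N1 x. \<exists>\<kappa>\<in>cgr_ideal V n. y = e \<oplus>\<^bsub>M\<^esub> \<kappa> \<odot>\<^bsub>M\<^esub> x) \<or>
         (\<forall>y\<in>carrier M. \<exists>e\<in>gen_set N2 x. \<exists>\<kappa>\<in>cgr_ideal V n. y = e \<oplus>\<^bsub>M\<^esub> \<kappa> \<odot>\<^bsub>M\<^esub> x)"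
  shows "carrier M \<subseteq> gen_set N1 x \<or> carrier M \<subseteq> gen_set N2 x"
proof (rule ccontr)
  assume "\<not> ?thesis"
  then obtain y1 y2 where y: "y1 \<in> carrier M" "y1 \<notin> gen_set N1 x" "y2 \<in> carrier M" "y2 \<notin> gen_set N2 x" by blast
  have sep: "\<exists>V\<in>\<O>. \<exists>n. \<forall>\<kappa>\<in>cgr_ideal V n. y \<oplus>\<^bsub>M\<^esub> \<kappa> \<odot>\<^bsub>M\<^esub> x \<notin> gen_set N x"
    if "closedin TM N" "y \<in> carrier M" "y \<notin> gen_set N x" for N y
  proof -
    have "openin TM (topspace TM - gen_set N x)" using closedin_gen_set[OF that(1) x] by (rule openin_diff[OF openin_topspace])
    from orbit_nbhd[OF this _ x, of y] that show ?thesis unfolding topspace_TM by blast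
  qed
  obtain V1 n1 where V1: "V1 \<in> \<O>" "\<And>\<kappa>. \<kappa> \<in> cgr_ideal V1 n1 \<Longrightarrow> y1 \<oplus>\<^bsub>M\<^esub> \<kappa> \<odot>\<^bsub>M\<^esub> x \<notin> gen_set N1 x" using sep[OF N(1) y(1,2)] by blast
  obtain V2 n2 where V2: "V2 \<in> \<O>" "\<And>\<kappa>. \<kappa> \<in> cgr_ideal V2 n2 \<Longrightarrow> y2 \<oplus>\<^bsub>M\<^esub> \<kappa> \<odot>\<^bsub>M\<^esub> x \<notin> gen_set N2 x" using sep[OF N(2) y(3,4)] by blast
  define V where "V = V1 \<inter> V2"
  define n where "n = max n1 n2"
  have V: "V \<in> \<O>" unfolding V_def by (rule Int_open[OF V1(1) V2(1)])
  have sub1: "cgr_ideal V n \<subseteq> cgr_ideal V1 n1" by (rule cgr_ideal_mono[OF V V1(1)]) (auto simp: V_def n_def)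
  have sub2: "cgr_ideal V n \<subseteq> cgr_ideal V2 n2" by (rule cgr_ideal_mono[OF V V2(1)]) (auto simp: V_def n_def)
  have undo: "y \<oplus>\<^bsub>M\<^esub> (\<ominus>\<^bsub>R\<^esub> \<kappa>) \<odot>\<^bsub>M\<^esub> x = e" if "y = e \<oplus>\<^bsub>M\<^esub> \<kappa> \<odot>\<^bsub>M\<^esub> x" "y \<in> carrier M" "e \<in> carrier M" "\<kappa> \<in> cgr_ideal V n" for y e \<kappa>
  proof -
    have "\<kappa> \<in> carrier R" using that(4) cgr_ideal_subset by blast
    then show ?thesis using that(3) x unfolding that(1) by (simp add: smult_l_minus M.a_assoc M.r_neg)
  qed
  have genM: "gen_set N x \<subseteq> carrier M" if "closedin TM N" for N using closedin_subset[OF closedin_gen_set[OF that x]] topspace_TM by simp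
  from level[OF V, of n] show False
  proof
    assume "\<forall>y\<in>carrier M. \<exists>e\<in>gen_set N1 x. \<exists>\<kappa>\<in>cgr_ideal V n. y = e \<oplus>\<^bsub>M\<^esub> \<kappa> \<odot>\<^bsub>M\<^esub> x"
    then obtain e \<kappa> where e: "e \<in> gen_set N1 x" "\<kappa> \<in> cgr_ideal V n" "y1 = e \<oplus>\<^bsub>M\<^esub> \<kappa> \<odot>\<^bsub>M\<^esub> x" using y(1) by blast
    have "y1 \<oplus>\<^bsub>M\<^esub> (\<ominus>\<^bsub>R\<^esub> \<kappa>) \<odot>\<^bsub>M\<^esub> x = e" using undo[OF e(3) y(1) _ e(2)] e(1) genM[OF N(1)] by blast
    then show False using V1(2)[of "\<ominus>\<^bsub>R\<^esub> \<kappa>"] ideal_minus[OF V e(2)] sub1 e(1) by auto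
  next
    assume "\<forall>y\<in>carrier M. \<exists>e\<in>gen_set N2 x. \<exists>\<kappa>\<in>cgr_ideal V n. y = e \<oplus>\<^bsub>M\<^esub> \<kappa> \<odot>\<^bsub>M\<^esub> x"
    then obtain e \<kappa> where e: "e \<in> gen_set N2 x" "\<kappa> \<in> cgr_ideal V n" "y2 = e \<oplus>\<^bsub>M\<^esub> \<kappa> \<odot>\<^bsub>M\<^esub> x" using y(3) by blast
    have "y2 \<oplus>\<^bsub>M\<^esub> (\<ominus>\<^bsub>R\<^esub> \<kappa>) \<odot>\<^bsub>M\<^esub> x = e" using undo[OF e(3) y(3) _ e(2)] e(1) genM[OF N(2)] by blast
    then show False using V2(2)[of "\<ominus>\<^bsub>R\<^esub> \<kappa>"] ideal_minus[OF V e(2)] sub2 e(1) by auto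
  qed
qed

end

section \<open>Coinvariants\<close>

lemma (in cgr) one_in_G: "\<one> \<in> carrier G" by simp

context profinite_cgr_module
begin

abbreviation Mz :: "(nat \<Rightarrow> int, 'x) module" where
  "Mz \<equiv> restrict_scalars (\<lambda>a. single a \<one>) M"

text \<open>Literally the family intersected in \<open>coinvariants\<close>, including subtraction
  in \<open>Mz\<close>, so that unfolding the definitions at the end matches it.\<close>

abbreviation coinv_submodules :: "'g set \<Rightarrow> 'x set set" where
  "coinv_submodules H \<equiv> {N. submodule N (Zp p) Mz \<and> closedin TM N \<and>
     (\<forall>h\<in>H. \<forall>y\<in>carrier M. gp h \<odot>\<^bsub>M\<^esub> y \<ominus>\<^bsub>Mz\<^esub> y \<in> N)}"

lemma Mz_ops:
  "carrier (add_monoid M) = carrier (add_monoid Mz)" "y \<otimes>\<^bsub>add_monoid M\<^esub> w = y \<otimes>\<^bsub>add_monoid Mz\<^esub> w"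
  "\<one>\<^bsub>add_monoid M\<^esub> = \<one>\<^bsub>add_monoid Mz\<^esub>"
  by (simp_all add: restrict_scalars_def)

lemma comm_group_Mz: "comm_group (add_monoid Mz)"
  by (rule monoid_cong(3)[OF Mz_ops M.a_comm_group])

lemma subgroup_Mz: "subgroup N (add_monoid Mz) \<longleftrightarrow> subgroup N (add_monoid M)"
  using monoid_cong(2)[OF Mz_ops] by blast

lemma minus_Mz: "y \<ominus>\<^bsub>Mz\<^esub> w = y \<ominus>\<^bsub>M\<^esub> w"
  using monoid_cong(1)[OF Mz_ops, of w] Mz_ops(2)[of y] by (simp add: a_minus_def a_inv_def)

lemma coinv_facts:
  assumes H: "H \<subseteq> carrier G"
  defines "N \<equiv> \<Inter> (coinv_submodules H)"
  shows "submodule N (Zp p) Mz" "closedin TM N" "subgroup N (add_monoid M)"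
    "\<And>h y. h \<in> H \<Longrightarrow> y \<in> carrier M \<Longrightarrow> gp h \<odot>\<^bsub>M\<^esub> y \<ominus>\<^bsub>M\<^esub> y \<in> N"
proof -
  interpret A: comm_group "add_monoid Mz" by (rule comm_group_Mz)
  have "submodule (carrier M) (Zp p) Mz"
  proof (intro submodule.intro submodule_axioms.intro)
    show "subgroup (carrier M) (add_monoid Mz)" using A.subgroup_self by (simp add: restrict_scalars_def)
    show "a \<odot>\<^bsub>Mz\<^esub> y \<in> carrier M" if "a \<in> carrier (Zp p)" "y \<in> carrier M" for a y
      using single_closed[OF that(1) one_in_G] that(2) by (simp add: restrict_scalars_def)
  qed
  moreover have "closedin TM (carrier M)" using closedin_topspace[of TM] by (simp add: topspace_TM)
  \<comment> \<open>The family is not empty; otherwise its intersection would be the whole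
    type.\<close>
  ultimately have ne: "carrier M \<in> coinv_submodules H" using H by (auto simp: minus_Mz subset_iff)
  show 1: "submodule N (Zp p) Mz"
  proof (intro submodule.intro submodule_axioms.intro)
    show "subgroup N (add_monoid Mz)" unfolding N_def
      by (rule A.subgroups_Inter) (use ne submodule.axioms(1) in blast)+
    show "a \<odot>\<^bsub>Mz\<^esub> y \<in> N" if ay: "a \<in> carrier (Zp p)" "y \<in> N" for a y
      unfolding N_def
    proof (rule InterI)
      fix L assume L: "L \<in> coinv_submodules H"
      then have "submodule L (Zp p) Mz" by (elim CollectE conjE)
      moreover have "y \<in> L" using ay(2) L unfolding N_def by (rule InterD)
      ultimately show "a \<odot>\<^bsub>Mz\<^esub> y \<in> L" using ay(1) by (intro submodule.smult_closed)
    qed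
  qed
  show "closedin TM N" unfolding N_def by (rule closedin_Inter) (use ne in auto)
  show "subgroup N (add_monoid M)" using submodule.axioms(1)[OF 1] subgroup_Mz by simp
  show "gp h \<odot>\<^bsub>M\<^esub> y \<ominus>\<^bsub>M\<^esub> y \<in> N" if "h \<in> H" "y \<in> carrier M" for h y
    unfolding N_def
  proof (rule InterI)
    fix L assume "L \<in> coinv_submodules H"
    then have "\<forall>h\<in>H. \<forall>y\<in>carrier M. gp h \<odot>\<^bsub>M\<^esub> y \<ominus>\<^bsub>Mz\<^esub> y \<in> L" by (elim CollectE conjE)
    then show "gp h \<odot>\<^bsub>M\<^esub> y \<ominus>\<^bsub>M\<^esub> y \<in> L" using that unfolding minus_Mz by blast
  qed
qed

text \<open>Converts integer scalars into powers of the additive group, the form in which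
  \<open>p_rank_le_1\<close> takes its generators.\<close>

lemma zi_pow: "y \<in> carrier M \<Longrightarrow> zi (int k) \<odot>\<^bsub>M\<^esub> y = y [^]\<^bsub>add_monoid Mz\<^esub> k"
proof (induction k)
  case 0 then show ?case by (simp add: zi_0 restrict_scalars_def)
next
  case (Suc k)
  interpret A: comm_group "add_monoid Mz" by (rule comm_group_Mz)
  have "zi (int (Suc k)) = zi (int k) \<oplus>\<^bsub>R\<^esub> zi 1" by (simp add: add.commute flip: zi_add)
  then have "zi (int (Suc k)) \<odot>\<^bsub>M\<^esub> y = zi (int k) \<odot>\<^bsub>M\<^esub> y \<oplus>\<^bsub>M\<^esub> y"
    using Suc.prems by (simp only: smult_l_distr zi_closed zi_1 R.one_closed smult_one)
  then show ?case using Suc by (simp add: A.nat_pow_Suc restrict_scalars_def)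
qed

text \<open>In the quotient the summand of \<open>gen_set\<close> from \<open>N\<close> disappears,
  and each class is a multiple of the class of x plus p times another class.\<close>

lemma p_rank_quotient_le_1:
  assumes p1: "p > 1" and N: "submodule N (Zp p) Mz" and x: "x \<in> carrier M" and gen: "carrier M \<subseteq> gen_set N x"
  shows "p_rank p (quotient_module Mz N) \<le> 1"
proof -
  define A where "A = add_monoid Mz"
  define Q where "Q = quotient_module Mz N"
  interpret A: comm_group A unfolding A_def by (rule comm_group_Mz)
  have sN: "subgroup N A" using submodule.axioms(1)[OF N] by (simp add: A_def)
  have nN: "N \<lhd> A" by (rule A.subgroup_imp_normal[OF sN])
  have cA: "carrier A = carrier M" and mA: "\<And>y w. y \<otimes>\<^bsub>A\<^esub> w = y \<oplus>\<^bsub>M\<^esub> w" by (simp_all add: A_def restrict_scalars_def)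
  have cQ: "carrier Q = rcosets\<^bsub>A\<^esub> N" and aQ: "\<And>C D. C \<oplus>\<^bsub>Q\<^esub> D = C <#>\<^bsub>A\<^esub> D" and zQ: "\<zero>\<^bsub>Q\<^esub> = N"
    by (simp_all add: Q_def A_def quotient_module_ops)
  interpret QG: comm_group "add_monoid Q" unfolding Q_def
    by (rule comm_group_quotient_module[OF comm_group_Mz submodule.axioms(1)[OF N]])
  have rcQ: "N #>\<^bsub>A\<^esub> y \<in> carrier Q" if "y \<in> carrier M" for y using that by (auto simp: cQ RCOSETS_def cA)
  have rcE: "\<exists>y\<in>carrier M. C = N #>\<^bsub>A\<^esub> y" if "C \<in> carrier Q" for C using that by (auto simp: cQ RCOSETS_def cA)
  have rcadd: "(N #>\<^bsub>A\<^esub> y) <#>\<^bsub>A\<^esub> (N #>\<^bsub>A\<^esub> w) = N #>\<^bsub>A\<^esub> (y \<oplus>\<^bsub>M\<^esub> w)" if "y \<in> carrier M" "w \<in> carrier M" for y w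
    using normal.rcos_sum[OF nN, of y w] that by (simp add: cA mA)
  have pow: "N #>\<^bsub>A\<^esub> (y [^]\<^bsub>A\<^esub> k) = (N #>\<^bsub>A\<^esub> y) [^]\<^bsub>add_monoid Q\<^esub> k" if y: "y \<in> carrier M" for y and k :: nat
  proof (induction k)
    case 0 then show ?case using A.coset_mult_one[OF subgroup.subset[OF sN]] by (simp add: zQ)
  next
    case (Suc k)
    have yk: "y [^]\<^bsub>A\<^esub> k \<in> carrier M" using A.nat_pow_closed[of y k] y cA by simp
    have "N #>\<^bsub>A\<^esub> (y [^]\<^bsub>A\<^esub> Suc k) = (N #>\<^bsub>A\<^esub> (y [^]\<^bsub>A\<^esub> k)) <#>\<^bsub>A\<^esub> (N #>\<^bsub>A\<^esub> y)"
      using rcadd[OF yk y] by (simp add: A.nat_pow_Suc mA)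
    then show ?case by (simp add: Suc aQ QG.nat_pow_Suc)
  qed
  show ?thesis unfolding Q_def[symmetric]
  proof (rule p_rank_le_1[where e = "N #>\<^bsub>A\<^esub> x"])
    show "comm_group (add_monoid Q)" by (rule QG.comm_group_axioms)
    show "p > 1" by (rule p1)
    show "N #>\<^bsub>A\<^esub> x \<in> carrier Q" by (rule rcQ[OF x])
    fix r C assume r: "r \<in> carrier (Zp p)" and C: "C \<in> carrier Q"
    obtain y where y: "y \<in> carrier M" "C = N #>\<^bsub>A\<^esub> y" using rcE[OF C] by blast
    have rR: "single r \<one> \<in> carrier R" by (rule single_closed[OF r one_in_G])
    have NM: "k \<in> carrier M" if "k \<in> N" for k using subgroup.mem_carrier[OF sN that] cA by simp
    have rN: "single r \<one> \<odot>\<^bsub>M\<^esub> k \<in> N" if "k \<in> N" for k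
      using submodule.smult_closed[OF N r that] by (simp add: restrict_scalars_def)
    have "r \<odot>\<^bsub>Q\<^esub> C = {k \<oplus>\<^bsub>M\<^esub> single r \<one> \<odot>\<^bsub>M\<^esub> (l \<oplus>\<^bsub>M\<^esub> y) | k l. k \<in> N \<and> l \<in> N}"
      unfolding Q_def quotient_module_def y(2) by (auto simp: set_add_def set_mult_def r_coset_def mA restrict_scalars_def)
    \<comment> \<open>The action on cosets adds \<open>N\<close> to the image of the whole coset;
      since \<open>N\<close> is a submodule, one representative suffices.\<close>
    also have "\<dots> = {k \<oplus>\<^bsub>M\<^esub> single r \<one> \<odot>\<^bsub>M\<^esub> y | k. k \<in> N}"
    proof (intro equalityI subsetI)
      fix u assume "u \<in> {k \<oplus>\<^bsub>M\<^esub> single r \<one> \<odot>\<^bsub>M\<^esub> (l \<oplus>\<^bsub>M\<^esub> y) | k l. k \<in> N \<and> l \<in> N}"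
      then obtain k l where kl: "k \<in> N" "l \<in> N" "u = k \<oplus>\<^bsub>M\<^esub> single r \<one> \<odot>\<^bsub>M\<^esub> (l \<oplus>\<^bsub>M\<^esub> y)" by blast
      have "u = (k \<oplus>\<^bsub>M\<^esub> single r \<one> \<odot>\<^bsub>M\<^esub> l) \<oplus>\<^bsub>M\<^esub> single r \<one> \<odot>\<^bsub>M\<^esub> y"
        using kl NM[OF kl(1)] NM[OF kl(2)] rR y(1) by (simp add: smult_r_distr M.a_assoc)
      moreover have "k \<oplus>\<^bsub>M\<^esub> single r \<one> \<odot>\<^bsub>M\<^esub> l \<in> N" using subgroup.m_closed[OF sN kl(1) rN[OF kl(2)]] by (simp add: mA)
      ultimately show "u \<in> {k \<oplus>\<^bsub>M\<^esub> single r \<one> \<odot>\<^bsub>M\<^esub> y | k. k \<in> N}" by blast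
    next
      fix u assume "u \<in> {k \<oplus>\<^bsub>M\<^esub> single r \<one> \<odot>\<^bsub>M\<^esub> y | k. k \<in> N}"
      then obtain k where k: "k \<in> N" "u = k \<oplus>\<^bsub>M\<^esub> single r \<one> \<odot>\<^bsub>M\<^esub> y" by blast
      have "\<zero>\<^bsub>M\<^esub> \<in> N" using subgroup.one_closed[OF sN] by (simp add: A_def restrict_scalars_def)
      moreover have "u = k \<oplus>\<^bsub>M\<^esub> single r \<one> \<odot>\<^bsub>M\<^esub> (\<zero>\<^bsub>M\<^esub> \<oplus>\<^bsub>M\<^esub> y)" using k(2) y(1) by simp
      ultimately show "u \<in> {k \<oplus>\<^bsub>M\<^esub> single r \<one> \<odot>\<^bsub>M\<^esub> (l \<oplus>\<^bsub>M\<^esub> y) | k l. k \<in> N \<and> l \<in> N}" using k(1) by blast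
    qed
    also have "\<dots> = N #>\<^bsub>A\<^esub> (single r \<one> \<odot>\<^bsub>M\<^esub> y)" by (auto simp: r_coset_def mA)
    finally show "r \<odot>\<^bsub>Q\<^esub> C \<in> carrier Q" using rcQ rR y(1) by simp
  next
    fix C assume "C \<in> carrier Q"
    then obtain y where y: "y \<in> carrier M" "C = N #>\<^bsub>A\<^esub> y" using rcE by blast
    then obtain z n w where z: "z \<in> {0..<int p}" "n \<in> N" "w \<in> carrier M"
      "y = zi z \<odot>\<^bsub>M\<^esub> x \<oplus>\<^bsub>M\<^esub> (n \<oplus>\<^bsub>M\<^esub> zi (int p) \<odot>\<^bsub>M\<^esub> w)"
      using gen unfolding gen_set_def by blast
    define a where "a = zi z \<odot>\<^bsub>M\<^esub> x"
    define b where "b = zi (int p) \<odot>\<^bsub>M\<^esub> w"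
    have ab: "a \<in> carrier M" "b \<in> carrier M" using x z(3) by (auto simp: a_def b_def)
    have nM: "n \<in> carrier M" using subgroup.mem_carrier[OF sN z(2)] cA by simp
    have "y = n \<otimes>\<^bsub>A\<^esub> (a \<oplus>\<^bsub>M\<^esub> b)" using z(4) ab nM by (simp add: mA a_def[symmetric] b_def[symmetric] M.a_lcomm)
    then have "C = (N #>\<^bsub>A\<^esub> n) #>\<^bsub>A\<^esub> (a \<oplus>\<^bsub>M\<^esub> b)"
      using A.coset_mult_assoc[OF subgroup.subset[OF sN], of n "a \<oplus>\<^bsub>M\<^esub> b"] y(2) ab nM cA by simp
    also have "N #>\<^bsub>A\<^esub> n = N" using A.coset_join2[OF _ sN z(2)] nM cA by simp
    finally have "C = (N #>\<^bsub>A\<^esub> a) \<oplus>\<^bsub>Q\<^esub> (N #>\<^bsub>A\<^esub> b)" using rcadd[OF ab] by (simp add: aQ)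
    moreover have "a = x [^]\<^bsub>A\<^esub> nat z" using zi_pow[OF x, of "nat z"] z(1) by (simp add: a_def A_def)
    moreover have "b = w [^]\<^bsub>A\<^esub> p" using zi_pow[OF z(3), of p] by (simp add: b_def A_def)
    ultimately have "C = ((N #>\<^bsub>A\<^esub> x) [^]\<^bsub>add_monoid Q\<^esub> nat z) \<oplus>\<^bsub>Q\<^esub> ((N #>\<^bsub>A\<^esub> w) [^]\<^bsub>add_monoid Q\<^esub> p)"
      using pow x z(3) by simp
    then show "\<exists>(z::nat). \<exists>w\<in>carrier Q. C = ((N #>\<^bsub>A\<^esub> x) [^]\<^bsub>add_monoid Q\<^esub> z) \<oplus>\<^bsub>Q\<^esub> (w [^]\<^bsub>add_monoid Q\<^esub> p)"
      using rcQ[OF z(3)] by blast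
  qed
qed

end

section \<open>The theorem for the Galois group of K over k\<close>

lemma (in iwasawa_setting) cgr_K: "cgr (Gal K k) (krull_topology K k) p"
proof -
  interpret group "Gal K k" by (rule group_Gal[OF K_sub k_K])
  show ?thesis
  proof (intro cgr.intro cgr_axioms.intro)
    show "group (Gal K k)" by (rule group_Gal[OF K_sub k_K])
    show "p > 0" using p(1) prime_gt_0_nat by auto
    show "finite (rcosets\<^bsub>Gal K k\<^esub> U)" if "U \<in> open_normal (Gal K k) (krull_topology K k)" for U
      using that finite_index[of U] normal_imp_subgroup by (auto simp: open_normal_def)
    have "carrier (Gal K k) \<lhd> Gal K k" by (rule normal_invI[OF subgroup_self]) auto
    moreover have "openin (krull_topology K k) (carrier (Gal K k))"
      using openin_topspace[of "krull_topology K k"] topspace_krull[OF K_sub] by simp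
    ultimately show "carrier (Gal K k) \<in> open_normal (Gal K k) (krull_topology K k)" by (simp add: open_normal_def)
    show "U \<inter> V \<in> open_normal (Gal K k) (krull_topology K k)"
      if "U \<in> open_normal (Gal K k) (krull_topology K k)" "V \<in> open_normal (Gal K k) (krull_topology K k)" for U V
      using that normal_subgroup_intersect by (auto simp: open_normal_def)
  qed
qed

theorem theorem3p2:
  fixes p :: nat
    and k k_cy k_an k_inf K :: "complex set"
    and M :: "((complex \<Rightarrow> complex) cgr, 'x) module"
    and T :: "'x topology"
  assumes "CM_field k"
    and "Factorial_Ring.prime p" and "odd p" and "splits_completely p k"
    and "cyclotomic_Zp_extension p k k_cy"
    and "anticyclotomic_Zp_extension p k k_an"
    and "K = compositum k_cy k_an"
    and "profinite_module (Iwasawa_algebra p K k) (Iwasawa_algebra_topology p K k) M T"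
    and "cyclic_module (Iwasawa_algebra p K k_cy)
           (restrict_scalars
              (cgr_incl p (Gal K k) (krull_topology K k) (carrier (Gal K k_cy))) M)"
    and "Zp_extension p k k_inf" and "k_inf \<subseteq> K" and "k_inf \<inter> k_an = k"
  shows "p_rank p (galois_coinvariants p K k k_inf M T) \<le> 1 \<or>
         p_rank p (galois_coinvariants p K k (cnj ` k_inf) M T) \<le> 1"
proof -
  interpret iwasawa_setting p k k_cy k_an k_inf K
    by unfold_locales (use assms in auto)
  interpret profinite_cgr_module "Gal K k" "krull_topology K k" p M T
    by (intro profinite_cgr_module.intro profinite_cgr_module_axioms.intro cgr_K assms(8))
  let ?G = "Gal K k" and ?A = "carrier (Gal K k_cy)"
  note subA = subgroup_Gal[OF K_sub cy_facts(2) cy_K]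
  obtain x where x: "x \<in> carrier M" and cyc: "carrier M = {cgr_incl p ?G (krull_topology K k) ?A r \<odot>\<^bsub>M\<^esub> x | r. r \<in> carrier (Iwasawa_algebra p K k_cy)}"
    using assms(9) by (auto simp: cyclic_module_def restrict_scalars_def)
  \<comment> \<open>The Krull topology on Gal(K/k_cy) is the subspace topology from
    Gal(K/k).\<close>
  have openA: "U \<inter> ?A \<in> open_normal (?G\<lparr>carrier := ?A\<rparr>) (krull_topology K k_cy)" if U: "U \<in> \<O>" for U
  proof -
    have "U \<inter> ?A \<lhd> ?G\<lparr>carrier := ?A\<rparr>" by (rule normal_Int_subgroup[OF subA open_normal_D(1)[OF U]])
    moreover have "openin (krull_topology K k_cy) (U \<inter> ?A)"
    proof -
      obtain W where W: "openin (product_topology (\<lambda>_. discrete_topology K) K) W" "U = W \<inter> carrier ?G"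
        using U by (auto simp: open_normal_def krull_topology_def openin_subtopology)
      then have "U \<inter> ?A = W \<inter> ?A" using subgroup.subset[OF subA] by auto
      then show ?thesis using W(1) by (auto simp: krull_topology_def openin_subtopology)
    qed
    ultimately show ?thesis by (simp add: open_normal_def)
  qed
  \<comment> \<open>\<open>Gal K k_cy\<close> is the record \<open>Gal K k\<close> with a smaller
    carrier, the form expected by \<open>cgr_incl_closed\<close>.\<close>
  have incl: "cgr_incl p ?G (krull_topology K k) ?A r \<in> carrier R" if "r \<in> carrier (Iwasawa_algebra p K k_cy)" for r
    using cgr_incl_closed[OF subA openA, of r] that Gal_carrier_update[of K k_cy k] by simp
  define H1 where "H1 = carrier (Gal K k_inf)"
  define H2 where "H2 = carrier (Gal K (cnj ` k_inf))"
  have k_cinf: "k \<subseteq> cnj ` k_inf" using image_mono[OF inf_facts(3), of cnj] k_cnj by simp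
  have H: "H1 \<subseteq> carrier ?G" "H2 \<subseteq> carrier ?G"
    unfolding H1_def H2_def by (rule Gal_mono[OF K_sub inf_facts(3)], rule Gal_mono[OF K_sub k_cinf])
  define N1 where "N1 = \<Inter> (coinv_submodules H1)"
  define N2 where "N2 = \<Inter> (coinv_submodules H2)"
  note c1 = coinv_facts[OF H(1), folded N1_def] and c2 = coinv_facts[OF H(2), folded N2_def]
  have "(\<forall>y\<in>carrier M. \<exists>e\<in>gen_set N1 x. \<exists>\<kappa>\<in>cgr_ideal V n. y = e \<oplus>\<^bsub>M\<^esub> \<kappa> \<odot>\<^bsub>M\<^esub> x) \<or>
        (\<forall>y\<in>carrier M. \<exists>e\<in>gen_set N2 x. \<exists>\<kappa>\<in>cgr_ideal V n. y = e \<oplus>\<^bsub>M\<^esub> \<kappa> \<odot>\<^bsub>M\<^esub> x)" if V: "V \<in> \<O>" for V n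
  proof -
    have oV: "openin (krull_topology K k) V" using V by (simp add: open_normal_def)
    obtain g \<gamma> h1 h2 m where g: "g \<in> ?A" "\<gamma> \<in> carrier ?G" "h1 \<in> H1" "h2 \<in> H2"
      "\<And>h. h \<in> ?A \<Longrightarrow> \<exists>i::nat. h \<otimes>\<^bsub>?G\<^esub> inv\<^bsub>?G\<^esub> (g [^]\<^bsub>?G\<^esub> i) \<in> V"
      "g [^]\<^bsub>?G\<^esub> (p ^ m) \<in> V" "h1 = g \<otimes>\<^bsub>?G\<^esub> \<gamma>" "(g \<otimes>\<^bsub>?G\<^esub> h2) \<otimes>\<^bsub>?G\<^esub> inv\<^bsub>?G\<^esub> \<gamma> \<in> V"
      using level[OF oV open_normal_D(2)[OF V]] unfolding H1_def H2_def by blast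
    have gG: "g \<in> carrier ?G" using subgroup.mem_carrier[OF subA g(1)] .
    show ?thesis
    proof (rule level_dichotomy[OF assms(2,3) V x c1(3) c2(3) gG g(2) _ _ g(6,7,8) c1(4)[OF g(3)] c2(4)[OF g(4)]])
      show "h1 \<in> carrier ?G" "h2 \<in> carrier ?G" using g(3,4) H by auto
      fix y assume "y \<in> carrier M"
      then obtain r where r: "r \<in> carrier (Iwasawa_algebra p K k_cy)" "y = cgr_incl p ?G (krull_topology K k) ?A r \<odot>\<^bsub>M\<^esub> x"
        using cyc by blast
      \<comment> \<open>A coset in the support meets Gal(K/k_cy), and modulo \<open>V\<close> every
        element there is a power of \<open>g\<close>.\<close>
      have "\<exists>i::nat. g [^]\<^bsub>?G\<^esub> i \<in> c" if c: "c \<in> rcosets\<^bsub>?G\<^esub> V" "cgr_incl p ?G (krull_topology K k) ?A r V c n \<noteq> 0" for c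
      proof -
        obtain h where h: "h \<in> c" "h \<in> ?A" using cgr_incl_support[OF V c] by blast
        have hG: "h \<in> carrier ?G" using subgroup.mem_carrier[OF subA h(2)] .
        obtain i :: nat where i: "h \<otimes>\<^bsub>?G\<^esub> inv\<^bsub>?G\<^esub> (g [^]\<^bsub>?G\<^esub> i) \<in> V" using g(5)[OF h(2)] by blast
        have gi: "g [^]\<^bsub>?G\<^esub> i \<in> carrier ?G" using gG by simp
        have "c = V #>\<^bsub>?G\<^esub> h" using mem_rcoset_iff[OF V hG c(1)] h(1) by simp
        also have "\<dots> = V #>\<^bsub>?G\<^esub> (g [^]\<^bsub>?G\<^esub> i)" using rcoset_eq_iff[OF V hG gi] i by simp
        finally show ?thesis using mem_rcoset_self[OF V gi] by blast
      qed
      then show "\<exists>s\<in>carrier R. y = s \<odot>\<^bsub>M\<^esub> x \<and> (\<forall>c\<in>rcosets\<^bsub>?G\<^esub> V. s V c n \<noteq> 0 \<longrightarrow> (\<exists>i::nat. g [^]\<^bsub>?G\<^esub> i \<in> c))"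
        using r incl[OF r(1)] by blast
    qed
  qed
  then have "carrier M \<subseteq> gen_set N1 x \<or> carrier M \<subseteq> gen_set N2 x"
    by (rule gen_set_dichotomy[OF x c1(2) c2(2)])
  moreover have "p > 1" using assms(2) prime_gt_1_nat by blast
  ultimately have "p_rank p (quotient_module Mz N1) \<le> 1 \<or> p_rank p (quotient_module Mz N2) \<le> 1"
    using p_rank_quotient_le_1[OF _ c1(1) x] p_rank_quotient_le_1[OF _ c2(1) x] by blast
  then show ?thesis
    unfolding galois_coinvariants_def coinvariants_def N1_def N2_def H1_def H2_def
    by (simp add: restrict_scalars_def)
qed

end
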